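(* Let $N\in[1,\infty)$ and let $(X,d,m)$ be a geodesic metric measure space in which $\mathscr{E}_N$ is strongly displacement convex. Then for every $x\in X$, \[ m\left(\{y\in X : \text{there exist two distinct geodesics between } x \text{ and } y\}\right)=0 . \]
   Context: Standing assumptions: $(X,d,m)$ is a metric measure space, $(X,d)$ is a complete geodesic metric space, $m$ is a Borel measure on $X$ with support $X$. Geodesics of $X$ are parametrized as continuous maps $\gamma\colon[0,1]\to X$ with $d(\gamma(t),\gamma(s)) = |t-s|\,d(\gamma(0),\gamma(1))$ for all $s,t\in[0,1]$; a geodesic between $x$ and $y$ is such a $\gamma$ with $\gamma(0)=x$, $\gamma(1)=y$. Wasserstein space: $\mathcal{P}(X)$ is the set of Borel probability measures on $X$, and $W_2(\mu,\nu) = \left(\inf_\sigma \int_{X\times X} d(x,y)^2\,d\sigma(x,y)\right)^{1/2}$ (possibly $+\infty$), the infimum being over $\sigma\in\mathcal{P}(X\times X)$ with first marginal $\mu$ and second marginal $\nu$. $\operatorname{Geo}(\mathcal{P}(X))$ is the set of constant speed geodesics of $(\mathcal{P}(X),W_2)$, i.e. continuous $\Gamma\colon[0,1]\to\mathcal{P}(X)$ with $W_2(\Gamma(t),\Gamma(s))=|t-s|W_2(\Gamma(0),\Gamma(1))<\infty$ for all $s,t\in[0,1]$. Entropy: for $\mu\in\mathcal{P}(X)$ with Lebesgue decomposition $\mu=\rho m+\mu^\perp$ with respect to $m$, the Rényi entropy functional is $\mathscr{E}_N(\mu)=-\int_X\rho^{1-1/N}\,dm$ (the integrand being $0$ where $\rho=0$).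 Strong displacement convexity: a functional $\mathscr{F}\colon\mathcal{P}(X)\to\mathbb{R}\cup\{-\infty,\infty\}$ is strongly displacement convex if for every $\Gamma\in\operatorname{Geo}(\mathcal{P}(X))$ and all $s\in[0,1]$, $\mathscr{F}(\Gamma(s))\le(1-s)\mathscr{F}(\Gamma(0))+s\mathscr{F}(\Gamma(1))$.
   Formalization: The measure m is additionally assumed sigma-finite (automatic if m is locally finite), since otherwise the Lebesgue decomposition defining the entropy need not exist, e.g. for infinity times Lebesgue measure on the plane. *)

theory Defs
  imports "HOL-Probability.Probability"
begin

(* The underlying space is the whole type.  Curves on [0,1] are functions on the reals of which
   only the values on {0..1} matter. *)

definition geodesic_between :: "(real \<Rightarrow> 'a::metric_space) \<Rightarrow> 'a \<Rightarrow> 'a \<Rightarrow> bool" where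
  "geodesic_between \<gamma> x y \<longleftrightarrow>
     continuous_on {0..1} \<gamma> \<and>
     (\<forall>s\<in>{0..1}. \<forall>t\<in>{0..1}. dist (\<gamma> t) (\<gamma> s) = \<bar>t - s\<bar> * dist (\<gamma> 0) (\<gamma> 1)) \<and>
     \<gamma> 0 = x \<and> \<gamma> 1 = y"

definition geodesic_space :: "'a::metric_space itself \<Rightarrow> bool" where
  "geodesic_space _ \<longleftrightarrow> (\<forall>x y::'a. \<exists>\<gamma>. geodesic_between \<gamma> x y)"

definition measure_support :: "'a::topological_space measure \<Rightarrow> 'a set" where
  "measure_support m = {x. \<forall>U. open U \<and> x \<in> U \<longrightarrow> 0 < emeasure m U}"

definition borel_prob :: "'a::topological_space measure set" where
  "borel_prob = {\<mu>. sets \<mu> = sets borel \<and> prob_space \<mu>}"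

(* Couplings live on the Borel sigma-algebra of the product space, not on the product
   sigma-algebra; the two coincide for separable spaces. *)
definition couplings ::
    "'a::topological_space measure \<Rightarrow> 'a measure \<Rightarrow> ('a \<times> 'a) measure set" where
  "couplings \<mu> \<nu> = {\<sigma> \<in> borel_prob. distr \<sigma> borel fst = \<mu> \<and> distr \<sigma> borel snd = \<nu>}"

definition transport_cost :: "'a::metric_space measure \<Rightarrow> 'a measure \<Rightarrow> ennreal" where
  "transport_cost \<mu> \<nu> =
     (INF \<sigma>\<in>couplings \<mu> \<nu>. \<integral>\<^sup>+ p. ennreal ((dist (fst p) (snd p))\<^sup>2) \<partial>\<sigma>)"

definition W2 :: "'a::metric_space measure \<Rightarrow> 'a measure \<Rightarrow> ennreal" where
  "W2 \<mu> \<nu> = (if transport_cost \<mu> \<nu> = \<top> then \<top>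
             else ennreal (sqrt (enn2real (transport_cost \<mu> \<nu>))))"

definition wasserstein_geodesics :: "(real \<Rightarrow> 'a::metric_space measure) set" where
  "wasserstein_geodesics =
     {\<Gamma>. (\<forall>t\<in>{0..1}. \<Gamma> t \<in> borel_prob) \<and>
         (\<forall>t\<in>{0..1}. ((\<lambda>s. W2 (\<Gamma> s) (\<Gamma> t)) \<longlongrightarrow> 0) (at t within {0..1})) \<and>
         W2 (\<Gamma> 0) (\<Gamma> 1) < \<top> \<and>
         (\<forall>s\<in>{0..1}. \<forall>t\<in>{0..1}. W2 (\<Gamma> t) (\<Gamma> s) = ennreal \<bar>t - s\<bar> * W2 (\<Gamma> 0) (\<Gamma> 1))}"

definition mutually_singular :: "'a measure \<Rightarrow> 'a measure \<Rightarrow> bool" where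
  "mutually_singular m \<nu> \<longleftrightarrow> (\<exists>S\<in>null_sets m. emeasure \<nu> (space m - S) = 0)"

definition lebesgue_decomposition ::
    "'a measure \<Rightarrow> 'a measure \<Rightarrow> ('a \<Rightarrow> real) \<Rightarrow> 'a measure \<Rightarrow> bool" where
  "lebesgue_decomposition m \<mu> \<rho> \<nu> \<longleftrightarrow>
     \<rho> \<in> borel_measurable m \<and> (\<forall>x\<in>space m. 0 \<le> \<rho> x) \<and>
     sets \<nu> = sets m \<and> mutually_singular m \<nu> \<and>
     (\<forall>A\<in>sets m. emeasure \<mu> A = emeasure (density m (\<lambda>x. ennreal (\<rho> x))) A + emeasure \<nu> A)"

(* For sigma-finite m and a probability measure mu such a density exists and is unique m-a.e.,
   so the choice does not affect integrals against m. *)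
definition ac_density :: "'a measure \<Rightarrow> 'a measure \<Rightarrow> 'a \<Rightarrow> real" where
  "ac_density m \<mu> = (SOME \<rho>. \<exists>\<nu>. lebesgue_decomposition m \<mu> \<rho> \<nu>)"

(* 0 powr a = 0 for every a, including a = 0, so for N = 1 the integrand is the indicator
   of the set where the density is positive. *)
definition renyi_entropy :: "real \<Rightarrow> 'a measure \<Rightarrow> 'a measure \<Rightarrow> ereal" where
  "renyi_entropy N m \<mu> =
     - enn2ereal (\<integral>\<^sup>+ x. ennreal (ac_density m \<mu> x powr (1 - 1 / N)) \<partial>m)"

definition strongly_displacement_convex :: "('a::metric_space measure \<Rightarrow> ereal) \<Rightarrow> bool" where
  "strongly_displacement_convex F \<longleftrightarrow>
     (\<forall>\<Gamma>\<in>wasserstein_geodesics. \<forall>s\<in>{0..1}.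
        F (\<Gamma> s) \<le> ereal (1 - s) * F (\<Gamma> 0) + ereal s * F (\<Gamma> 1))"

end

theory Submission
  imports Defs
begin

text \<open>
  Write \<open>H(\<mu>) = \<integral> \<rho>\<^bsup>1-1/N\<^esup> dm\<close> for the negative of the entropy. The product is the only coupling of
  a measure with the Dirac mass at \<open>x\<close>, so a measure can be transported optimally to this Dirac mass
  along any measurable choice of geodesics that end at \<open>x\<close>: if \<open>T t w\<close> is the position at time \<open>t\<close> of the geodesic chosen for
  the parameter \<open>w\<close>, the laws of \<open>T t\<close> form a Wasserstein geodesic (\<open>flow_wasserstein_geodesic\<close>),
  along which \<open>H\<close> is concave. Since \<open>H\<close> is at most \<open>m(S)\<^bsup>1/N\<^esup>\<close> for a measure carried by \<open>S\<close>, with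
  equality for the uniform distribution on \<open>S\<close>, a first consequence is a contraction estimate: if
  the geodesics starting in \<open>C\<close> are in \<open>K\<close> at time \<open>s\<close>, then \<open>(1-s)\<^sup>N m(C) \<le> m(K)\<close> (\<open>contraction\<close>).

  The uniqueness mechanism is \<open>two_flows_contradiction\<close>. Suppose that through each point of a set \<open>C\<close>
  of positive finite measure pass, at time \<open>a\<close>, two geodesics that end at \<open>x\<close>, and that at time
  \<open>b > a\<close> the first family lies in one set and the second in another set disjoint from it. Start with the
  uniform distribution on \<open>C\<close> at time \<open>a\<close> and follow each family with probability one half. Mixing
  mutually singular measures multiplies \<open>H\<close> by \<open>2\<^bsup>1/N\<^esup>\<close>, while concavity on \<open>[a,1]\<close> and on \<open>[0,b]\<close>
  allows \<open>H\<close> to vary only by factors that tend to \<open>1\<close> as \<open>b - a\<close> tends to \<open>0\<close>. So when \<open>a\<close> and \<open>b\<close>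
  are close the set of such fork points is null, and by contraction so is the set of starting points whose
  geodesics fork there. At times before \<open>a\<close> the argument relies on \<open>H \<ge> 0\<close> alone, and this makes it
  local in time.

  Let now two geodesics from \<open>y\<close> to \<open>x\<close> differ, and let \<open>\<tau>\<close> be their last common time before a time at
  which they differ. If \<open>\<tau> > 0\<close>, splicing produces two geodesics that agree at a rational time just
  before \<open>\<tau>\<close> and differ at one just after. If \<open>\<tau> = 0\<close>, then \<open>y\<close> is a fork point as soon as it is an
  interior point of a geodesic that ends at \<open>x\<close>, and almost every \<open>y\<close> is
  (\<open>extendable_almost_everywhere\<close>): a compact set \<open>A\<close> of other points would be contracted into small
  neighbourhoods of \<open>A\<close>, but outside \<open>A\<close>, and these have vanishing measure if \<open>m\<close> is finite on bounded
  sets.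

  That finiteness is itself a consequence of convexity. A Baire category argument finds a
  ball \<open>B\<close> and a compact set \<open>K\<close> of finite measure such that each point of \<open>B\<close> has a midpoint in \<open>K\<close> with
  each point of at least half of a fixed set \<open>A\<close>; Fubini and the contraction estimate towards the points
  of \<open>A\<close> then bound \<open>m(B)\<close> by a multiple of \<open>m(K)\<close> (\<open>exists_finite_ball\<close>).

  Geodesics have to be chosen measurably. The space is separable, since a sigma-finite measure charges
  only countably many disjoint open sets; geodesics are coded by their values at rational times, which
  makes the relevant conditions closed, and a closed set of pairs has a measurable selection on a
  closed part of its projection that carries almost the whole outer measure (\<open>flow_selection\<close>).
\<close>

section \<open>Separable metric spaces\<close>

text \<open>
  For fixed \<open>e\<close> and \<open>k\<close>, the balls of radius \<open>e/2\<close> around an \<open>e\<close>-separated set are disjoint, so a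
  finite measure admits boundedly many of them of measure more than \<open>1/(k+1)\<close>. A separated set of maximal
  cardinality is then an \<open>e\<close>-net, and full support lets \<open>k\<close> exhaust the space.
\<close>

lemma separable_from_packing_bound:
  fixes \<mu> :: "'a::metric_space measure"
  assumes "finite_measure \<mu>" "sets \<mu> = sets borel" "measure_support \<mu> = UNIV"
  obtains D :: "'a set" where "countable D" "closure D = UNIV"
proof -
  interpret finite_measure \<mu> by fact
  have pos: "0 < emeasure \<mu> (ball x e)" if "e > 0" for x e
    using assms(3) that unfolding measure_support_def
    by (metis (mono_tags, lifting) UNIV_I centre_in_ball mem_Collect_eq open_ball)
  have meas: "ball x e \<in> sets \<mu>" for x e
    using assms(2) by simp
  define X where "X e k = {x. measure \<mu> (ball x (e/2)) > inverse (real (Suc k))}" for e k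
  define sep where "sep e k S \<longleftrightarrow> finite S \<and> S \<subseteq> X e k \<and> (\<forall>x\<in>S. \<forall>y\<in>S. x \<noteq> y \<longrightarrow> e \<le> dist x y)" for e k S
  have bound: "real (card S) \<le> real (Suc k) * measure \<mu> (space \<mu>)" if "sep e k S" for e k S
  proof -
    have disj: "disjoint_family_on (\<lambda>x. ball x (e/2)) S"
      unfolding disjoint_family_on_def
    proof (intro ballI impI)
      fix x y assume "x \<in> S" "y \<in> S" "x \<noteq> y"
      then have "e \<le> dist x y" using that by (auto simp: sep_def)
      then show "ball x (e/2) \<inter> ball y (e/2) = {}"
        by (simp add: disjoint_ballI)
    qed
    have "real (card S) * inverse (real (Suc k)) \<le> (\<Sum>x\<in>S. measure \<mu> (ball x (e/2)))"
      using sum_bounded_below[of S "inverse (real (Suc k))" "\<lambda>x. measure \<mu> (ball x (e/2))"] that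
      unfolding sep_def X_def by (force simp: less_imp_le)
    also have "\<dots> = measure \<mu> (\<Union>x\<in>S. ball x (e/2))"
      using that meas disj by (intro finite_measure_finite_Union[symmetric]) (auto simp: sep_def)
    also have "\<dots> \<le> measure \<mu> (space \<mu>)" by (rule bounded_measure)
    finally show ?thesis by (simp add: field_simps)
  qed
  have "\<exists>S. sep e k S \<and> (\<forall>x\<in>X e k. \<exists>y\<in>S. dist x y < e)" if "e > 0" for e k
  proof -
    have "sep e k {}" by (simp add: sep_def)
    moreover have "\<forall>S. sep e k S \<longrightarrow> card S \<le> nat \<lfloor>real (Suc k) * measure \<mu> (space \<mu>)\<rfloor>"
      using bound le_nat_floor by blast
    ultimately obtain S where S: "sep e k S" "\<And>S'. sep e k S' \<Longrightarrow> card S' \<le> card S"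
      using ex_has_greatest_nat[of "sep e k" "{}" card] by (metis less_Suc_eq_le)
    have "\<exists>y\<in>S. dist x y < e" if x: "x \<in> X e k" for x
    proof (rule ccontr)
      assume neg: "\<not> ?thesis"
      then have "x \<notin> S" using \<open>e > 0\<close> by force
      moreover have "sep e k (insert x S)"
        using S(1) x neg by (auto simp: sep_def dist_commute not_less)
      ultimately show False using S(2)[of "insert x S"] S(1) by (auto simp: sep_def)
    qed
    then show ?thesis using S(1) by blast
  qed
  then obtain S where S: "\<And>e k. e > 0 \<Longrightarrow> sep e k (S e k)"
      "\<And>e k x. e > 0 \<Longrightarrow> x \<in> X e k \<Longrightarrow> \<exists>y\<in>S e k. dist x y < e"
    by metis
  define D where "D = (\<Union>n k. S (inverse (real (Suc n))) k)"
  have "countable D" unfolding D_def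
    using S(1) by (intro countable_UN countableI_type) (auto simp: sep_def intro: countable_finite)
  moreover have "x \<in> closure D" for x
  proof (rule closure_approachable[THEN iffD2], intro allI impI)
    fix e :: real assume "e > 0"
    then obtain n where n: "inverse (real (Suc n)) < e" using reals_Archimedean by blast
    let ?e = "inverse (real (Suc n))"
    have "0 < measure \<mu> (ball x (?e/2))"
      using pos[of "?e/2" x] by (simp add: emeasure_eq_measure)
    then obtain k where "inverse (real (Suc k)) < measure \<mu> (ball x (?e/2))"
      using reals_Archimedean by blast
    then have "x \<in> X ?e k" by (simp add: X_def)
    then obtain y where "y \<in> S ?e k" "dist x y < ?e" using S(2)[of ?e] by auto
    then show "\<exists>y\<in>D. dist y x < e" using n unfolding D_def
      by (metis UN_I UNIV_I dist_commute order_less_trans)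
  qed
  ultimately show ?thesis using that by blast
qed

text \<open>
  An integrable positive density replaces the measure by a finite one with the same null sets, hence
  with the same support.
\<close>

lemma separable_if_sigma_finite_full_support:
  fixes m :: "'a::metric_space measure"
  assumes "sigma_finite_measure m" and sets: "sets m = sets borel" and supp: "measure_support m = UNIV"
  obtains D :: "'a set" where "countable D" "closure D = UNIV"
proof -
  interpret sigma_finite_measure m by fact
  obtain h :: "'a \<Rightarrow> real" where h: "h \<in> borel_measurable m" "\<And>w. 0 < h w" "\<And>w. h w \<le> 1" "integrable m h"
    using obtain_positive_integrable_function by metis
  define \<mu> where "\<mu> = density m (\<lambda>w. ennreal (h w))"
  have "finite_measure \<mu>"
  proof (rule finite_measureI)
    have "emeasure \<mu> (space \<mu>) = (\<integral>\<^sup>+w. ennreal (h w) \<partial>m)"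
      unfolding \<mu>_def using h(1) by (simp add: emeasure_density cong: nn_integral_cong)
    also have "\<dots> \<noteq> \<infinity>" using integrableD(2)[OF h(4)] h(2) by (simp add: less_imp_le)
    finally show "emeasure \<mu> (space \<mu>) \<noteq> \<infinity>" .
  qed
  moreover have "sets \<mu> = sets borel" using sets by (simp add: \<mu>_def)
  moreover have "measure_support \<mu> = UNIV"
  proof -
    have "0 < emeasure \<mu> U" if "open U" "w \<in> U" for U w
    proof (rule ccontr)
      assume "\<not> ?thesis"
      then have "U \<in> null_sets \<mu>" using that(1) sets by (simp add: null_sets_def \<mu>_def)
      then have "AE v in m. v \<in> U \<longrightarrow> ennreal (h v) = 0"
        unfolding \<mu>_def using h(1) by (subst (asm) null_sets_density_iff) auto
      then have "AE v in m. v \<notin> U"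
        by (rule eventually_mono) (use h(2) in \<open>auto simp: ennreal_eq_0_iff not_le[symmetric]\<close>)
      then have "U \<in> null_sets m" using that(1) sets by (subst (asm) AE_iff_null_sets[symmetric]) auto
      moreover have "w \<in> measure_support m" using supp by simp
      then have "0 < emeasure m U" using that by (simp add: measure_support_def)
      ultimately show False by auto
    qed
    then show ?thesis unfolding measure_support_def by blast
  qed
  ultimately show ?thesis using separable_from_packing_bound that by blast
qed

lemma open_contains_ball_from_dense:
  fixes D :: "'a::metric_space set"
  assumes "closure D = UNIV" "open U" "u \<in> U"
  obtains d r where "d \<in> D" "r \<in> \<rat>" "u \<in> ball d r" "ball d r \<subseteq> U"
proof -
  obtain e where e: "e > 0" "ball u e \<subseteq> U" using assms(2,3) open_contains_ball by blast
  obtain r where r: "r \<in> \<rat>" "e/4 < r" "r < e/2" using Rats_dense_in_real[of "e/4" "e/2"] e by auto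
  have "0 < r" using r e by linarith
  then obtain d where d: "d \<in> D" "dist d u < r"
    using assms(1) closure_approachable[of u D] by blast
  have "ball d r \<subseteq> ball u e"
  proof
    fix z assume "z \<in> ball d r"
    then show "z \<in> ball u e" using d(2) r(3) dist_triangle[of u z d] by (simp add: dist_commute)
  qed
  then show ?thesis using that[of d r] d r(1) e(2) by auto
qed

lemma dense_separating_balls:
  fixes u v :: "'a::metric_space"
  assumes "closure D = UNIV" "u \<noteq> v"
  shows "\<exists>p\<in>D. \<exists>q\<in>D. \<exists>n::nat. dist u p \<le> 1 / Suc n \<and> dist v q \<le> 1 / Suc n \<and> 2 / Suc n < dist p q"
proof -
  have "0 < dist u v / 4" using assms(2) by simp
  then obtain n where n: "inverse (real (Suc n)) < dist u v / 4" using reals_Archimedean by blast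
  let ?e = "1 / real (Suc n)"
  have e: "?e < dist u v / 4" "0 < ?e" using n by (simp_all add: inverse_eq_divide)
  have near: "\<exists>p\<in>D. dist p w < ?e" for w
  proof -
    have "w \<in> closure D" using assms(1) by simp
    then show ?thesis using e(2) unfolding closure_approachable by blast
  qed
  obtain p where p: "p \<in> D" "dist p u < ?e" using near[of u] by blast
  obtain q where q: "q \<in> D" "dist q v < ?e" using near[of v] by blast
  have "dist u v \<le> dist u p + dist p q + dist q v"
    using dist_triangle[of u v p] dist_triangle[of p v q] by linarith
  then have "2 * ?e < dist p q" using e p(2) q(2) by (simp add: dist_commute)
  then show ?thesis using p q by (intro bexI[of _ p] bexI[of _ q] exI[of _ n]) (auto simp: dist_commute)
qed

text \<open>
  Separability enters as a hypothesis on dense sets, not as a type class, because it is a property of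
  the space that is derived from the measure.
\<close>

lemma open_prod_in_pair_sets:
  fixes D :: "'a::metric_space set" and D' :: "'b::metric_space set"
  assumes "countable D" "closure D = UNIV" "countable D'" "closure D' = UNIV"
    and "open (U :: ('a \<times> 'b) set)"
  shows "U \<in> sets (borel \<Otimes>\<^sub>M borel)"
proof -
  define I where "I = {(d,r,d',r'). d \<in> D \<and> r \<in> \<rat> \<and> d' \<in> D' \<and> r' \<in> \<rat> \<and> ball d r \<times> ball d' r' \<subseteq> U}"
  have "I \<subseteq> D \<times> \<rat> \<times> D' \<times> \<rat>" by (auto simp: I_def)
  then have "countable I"
    using assms countable_rat by (meson countable_SIGMA countable_subset)
  have "U = (\<Union>(d,r,d',r')\<in>I. ball d r \<times> ball d' r')"
  proof (intro equalityI subsetI)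
    fix u assume "u \<in> U"
    then obtain A B where AB: "open A" "open B" "u \<in> A \<times> B" "A \<times> B \<subseteq> U"
      using assms(5) open_prod_elim by blast
    moreover have "fst u \<in> A" "snd u \<in> B" using AB(3) by auto
    moreover obtain d r where "d \<in> D" "r \<in> \<rat>" "fst u \<in> ball d r" "ball d r \<subseteq> A"
      using open_contains_ball_from_dense[OF assms(2) AB(1) \<open>fst u \<in> A\<close>] .
    moreover obtain d' r' where "d' \<in> D'" "r' \<in> \<rat>" "snd u \<in> ball d' r'" "ball d' r' \<subseteq> B"
      using open_contains_ball_from_dense[OF assms(4) AB(2) \<open>snd u \<in> B\<close>] .
    ultimately have "(d,r,d',r') \<in> I" "u \<in> ball d r \<times> ball d' r'"
      using AB(4) by (auto simp: I_def mem_Times_iff)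
    then show "u \<in> (\<Union>(d,r,d',r')\<in>I. ball d r \<times> ball d' r')" by blast
  qed (auto simp: I_def)
  also have "\<dots> \<in> sets (borel \<Otimes>\<^sub>M borel)"
    using \<open>countable I\<close> by (intro sets.countable_UN') auto
  finally show ?thesis .
qed

lemma borel_measurable_Pair_separable:
  fixes f g :: "'b \<Rightarrow> 'a::metric_space"
  assumes "countable D" "closure D = (UNIV::'a set)"
    and "f \<in> borel_measurable M" "g \<in> borel_measurable M"
  shows "(\<lambda>w. (f w, g w)) \<in> borel_measurable M"
proof (rule borel_measurableI)
  fix S :: "('a \<times> 'a) set" assume "open S"
  have "(\<lambda>w. (f w, g w)) \<in> measurable M (borel \<Otimes>\<^sub>M borel)"
    using assms by measurable
  then show "(\<lambda>w. (f w, g w)) -` S \<inter> space M \<in> sets M"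
    using open_prod_in_pair_sets[OF assms(1,2,1,2) \<open>open S\<close>] by (rule measurable_sets)
qed

text \<open>
  Finite lists over a countable dense set, extended by a default value, approximate every function
  in the metric of pointwise convergence.
\<close>

lemma separable_fun:
  fixes D :: "'a::metric_space set"
  assumes "countable D" "closure D = UNIV"
  obtains Q :: "('i::countable \<Rightarrow> 'a) set" where "countable Q" "closure Q = UNIV"
proof -
  define F :: "'a list \<Rightarrow> 'i \<Rightarrow> 'a" where
    "F l i = (if to_nat i < length l then l ! to_nat i else undefined)" for l i
  define Q where "Q = F ` lists (insert undefined D)"
  have "countable Q" unfolding Q_def using assms(1) by simp
  moreover have "g \<in> closure Q" for g
  proof (rule closure_approachable[THEN iffD2], intro allI impI)
    fix e :: real assume "e > 0"
    obtain N where N: "(1/2::real)^N < e/2"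
      using real_arch_pow_inv[of "e/2" "1/2"] \<open>e > 0\<close> by auto
    have "\<exists>d\<in>D. dist d (g i) < e/8" for i
      using assms(2) closure_approachable[of "g i" D] \<open>e > 0\<close> by (metis UNIV_I divide_pos_pos zero_less_numeral)
    then obtain d where d: "\<And>i. d i \<in> D" "\<And>i. dist (d i) (g i) < e/8" by metis
    define K where "K = Suc (Max (insert 0 ((\<lambda>n. to_nat (from_nat n :: 'i)) ` {..N})))"
    define l where "l = map (\<lambda>n. d (from_nat n)) [0..<K]"
    have Fl: "F l (from_nat n) = d (from_nat n)" if "n \<le> N" for n
    proof -
      have "to_nat (from_nat n :: 'i) < K"
        unfolding K_def less_Suc_eq_le using that by (intro Max_ge) auto
      then show ?thesis by (simp add: F_def l_def)
    qed
    have "dist (F l) g \<le> 2 * Max {dist (F l (from_nat n)) (g (from_nat n))|n. n \<le> N} + (1/2)^N"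
      by (rule dist_fun_le_dist_first_terms)
    also have "Max {dist (F l (from_nat n)) (g (from_nat n))|n. n \<le> N} \<le> e/8"
      using d(2) by (subst Max_le_iff) (auto simp: Fl less_imp_le)
    finally have "dist (F l) g < e" using N \<open>e > 0\<close> by simp
    moreover have "F l \<in> Q" unfolding Q_def l_def using d(1) by (intro imageI) auto
    ultimately show "\<exists>y\<in>Q. dist y g < e" by blast
  qed
  ultimately show ?thesis using that by blast
qed

section \<open>Regularity, projections of closed sets and measurable selections\<close>

text \<open>
  The sets that can be approximated from both sides form a sigma-algebra; it contains the closed sets,
  which are decreasing intersections of the open sets \<open>{y. infdist y F < 1/(n+1)}\<close>.
\<close>

lemma finite_borel_measure_closed_open_approx:
  fixes \<mu> :: "'a::metric_space measure"
  assumes "finite_measure \<mu>" "sets \<mu> = sets borel" "B \<in> sets borel" "0 < e"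
  shows "\<exists>F U. closed F \<and> open U \<and> F \<subseteq> B \<and> B \<subseteq> U \<and> measure \<mu> (U - F) \<le> e"
proof -
  interpret finite_measure \<mu> by fact
  define G where "G B \<longleftrightarrow> (\<forall>e>0. \<exists>F U. closed F \<and> open U \<and> F \<subseteq> B \<and> B \<subseteq> U \<and> measure \<mu> (U - F) \<le> e)" for B
  have sb [simp]: "A \<in> sets \<mu>" if "A \<in> sets borel" for A using assms(2) that by simp
  have "B \<in> sigma_sets UNIV (Collect closed)"
    using assms(3) unfolding borel_eq_closed by simp
  then have "G B"
  proof induction
    case (Basic F)
    then have F: "closed F" by simp
    show ?case
    proof (cases "F = {}")
      case True
      then show ?thesis unfolding G_def by (intro allI impI exI[of _ "{}"]) auto
    next
      case False
      define U where "U n = {y. infdist y F < inverse (real (Suc n))}" for n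
      have oU: "open (U n)" for n unfolding U_def
        by (intro open_Collect_less continuous_intros)
      have "decseq U" unfolding U_def
        by (intro decseq_SucI Collect_mono impI, erule less_le_trans) (simp add: field_simps)
      moreover have "(\<Inter>n. U n) = F"
      proof (intro equalityI subsetI)
        fix y assume y: "y \<in> (\<Inter>n. U n)"
        have "infdist y F = 0"
        proof (rule ccontr)
          assume "infdist y F \<noteq> 0"
          then obtain n where "inverse (real (Suc n)) < infdist y F"
            using reals_Archimedean infdist_nonneg by (metis less_eq_real_def)
          moreover have "y \<in> U n" using y by blast
          ultimately show False by (simp add: U_def)
        qed
        then show "y \<in> F" using F False in_closed_iff_infdist_zero by blast
      next
        fix y assume "y \<in> F"
        then show "y \<in> (\<Inter>n. U n)" by (simp add: U_def)
      qed
      ultimately have "(\<lambda>n. measure \<mu> (U n)) \<longlonglongrightarrow> measure \<mu> F"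
        using finite_Lim_measure_decseq[of U] oU sb borel_open by (metis image_subsetI)
      moreover have "measure \<mu> (U n - F) = measure \<mu> (U n) - measure \<mu> F" for n
        using F oU[of n] by (intro finite_measure_Diff) (auto simp: U_def)
      ultimately have lim: "(\<lambda>n. measure \<mu> (U n - F)) \<longlonglongrightarrow> 0"
        using LIM_zero by simp
      show ?thesis unfolding G_def
      proof (intro allI impI)
        fix e :: real assume "e > 0"
        then obtain n where "measure \<mu> (U n - F) < e"
          using order_tendstoD(2)[OF lim] by (auto simp: eventually_sequentially)
        then show "\<exists>Fa U. closed Fa \<and> open U \<and> Fa \<subseteq> F \<and> F \<subseteq> U \<and> measure \<mu> (U - Fa) \<le> e"
          using F oU[of n] by (intro exI[of _ F] exI[of _ "U n"]) (auto simp: U_def)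
      qed
    qed
  next
    case Empty
    then show ?case unfolding G_def by (intro allI impI exI[of _ "{}"]) auto
  next
    case (Compl A)
    show ?case unfolding G_def
    proof (intro allI impI)
      fix e :: real assume "e > 0"
      obtain F U where *: "closed F" "open U" "F \<subseteq> A" "A \<subseteq> U" "measure \<mu> (U - F) \<le> e"
        using Compl.IH[unfolded G_def, rule_format, OF \<open>e > 0\<close>] by (elim exE conjE)
      have "(- F) - (- U) = U - F" by auto
      then show "\<exists>F U. closed F \<and> open U \<and> F \<subseteq> UNIV - A \<and> UNIV - A \<subseteq> U \<and> measure \<mu> (U - F) \<le> e"
        using * by (intro exI[of _ "-U"] exI[of _ "-F"]) auto
    qed
  next
    case (Union A)
    show ?case unfolding G_def
    proof (intro allI impI)
      fix e :: real assume "e > 0"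
      then have "\<forall>i. \<exists>F U. closed F \<and> open U \<and> F \<subseteq> A i \<and> A i \<subseteq> U \<and> measure \<mu> (U - F) \<le> (e/2) * (1/2)^Suc i"
        by (intro allI Union.IH[unfolded G_def, rule_format]) simp
      then obtain F U where FU: "\<And>i. closed (F i)" "\<And>i. open (U i)" "\<And>i. F i \<subseteq> A i" "\<And>i. A i \<subseteq> U i"
          "\<And>i. measure \<mu> (U i - F i) \<le> (e/2) * (1/2)^Suc i"
        by metis
      \<comment> \<open>A finite union of the closed sets is closed; by continuity from above it loses little
        compared with the countable union.\<close>
      define V where "V = (\<Union>i. U i)"
      define W where "W n = V - (\<Union>i<n. F i)" for n
      have meas: "V \<in> sets borel" "\<And>n. W n \<in> sets borel" "\<And>i. U i - F i \<in> sets borel"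
        "(\<Union>i. F i) \<in> sets borel"
        unfolding W_def V_def using FU(1,2) by (auto intro!: sets.Diff sets.finite_UN borel_open borel_closed)
      have sm: "summable (\<lambda>i. (e/2) * (1/2::real)^Suc i)"
        using summable_mult[OF summable_Suc_iff[THEN iffD2, OF summable_geometric[of "1/2::real"]]] by simp
      have "measure \<mu> (V - (\<Union>i. F i)) \<le> measure \<mu> (\<Union>i. U i - F i)"
        using meas by (intro finite_measure_mono) (auto simp: V_def)
      also have "\<dots> \<le> (\<Sum>i. measure \<mu> (U i - F i))"
        using meas FU(5) by (intro finite_measure_subadditive_countably summable_comparison_test'[OF sm])
          (auto simp del: power_Suc)
      also have "\<dots> \<le> (\<Sum>i. (e/2) * (1/2)^Suc i)"
        using FU(5) by (intro suminf_le summable_comparison_test'[OF sm] sm) (auto simp del: power_Suc)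
      also have "\<dots> = e/2"
        using power_half_series sums_unique[OF sums_mult[of _ _ "e/2"]] by force
      finally have half: "measure \<mu> (V - (\<Union>i. F i)) \<le> e/2" .
      have "decseq W" unfolding W_def decseq_def by (auto intro: less_le_trans)
      moreover have "(\<Inter>n. W n) = V - (\<Union>i. F i)" unfolding W_def by auto
      ultimately have lim: "(\<lambda>n. measure \<mu> (W n)) \<longlonglongrightarrow> measure \<mu> (V - (\<Union>i. F i))"
        using finite_Lim_measure_decseq[of W] meas(2) sb by (metis image_subsetI)
      have "measure \<mu> (V - (\<Union>i. F i)) < e" using half \<open>e > 0\<close> by simp
      with lim have "\<forall>\<^sub>F n in sequentially. measure \<mu> (W n) < e" by (rule order_tendstoD(2))
      then obtain n where "measure \<mu> (W n) < e" by (auto simp: eventually_sequentially)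
      moreover have "closed (\<Union>i<n. F i)" using FU(1) by (intro closed_UN) auto
      moreover have "open V" using FU(2) unfolding V_def by auto
      ultimately show "\<exists>F U. closed F \<and> open U \<and> F \<subseteq> (\<Union>i. A i) \<and> (\<Union>i. A i) \<subseteq> U \<and> measure \<mu> (U - F) \<le> e"
        using FU(3,4) by (intro exI[of _ "\<Union>i<n. F i"] exI[of _ V]) (auto simp: V_def W_def, blast+)
    qed
  qed
  then show ?thesis using assms(4) unfolding G_def by blast
qed

lemma compact_if_covered_by_balls:
  fixes W :: "'b::complete_space set"
  assumes "closed W" "\<And>k. \<exists>S. finite S \<and> W \<subseteq> (\<Union>s\<in>S. cball s ((1/2)^k))"
  shows "compact W"
  unfolding compact_eq_totally_bounded
proof (intro conjI allI impI)
  show "Topological_Spaces.complete W" using assms(1) by (simp add: complete_eq_closed)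
  fix e :: real assume "0 < e"
  then obtain k where k: "(1/2)^k < e" using real_arch_pow_inv[of e "1/2"] by auto
  obtain S where "finite S" "W \<subseteq> (\<Union>s\<in>S. cball s ((1/2)^k))" using assms(2) by blast
  then show "\<exists>S. finite S \<and> W \<subseteq> (\<Union>s\<in>S. ball s e)" using k by (intro exI[of _ S]) force
qed

lemma closed_projection_compact:
  fixes E :: "('a::metric_space \<times> 'b::metric_space) set"
  assumes "closed E" "compact K"
  shows "closed (fst ` (E \<inter> UNIV \<times> K))"
  unfolding closed_sequential_limits
proof (intro allI impI, elim conjE)
  fix u l assume u: "\<forall>n. u n \<in> fst ` (E \<inter> UNIV \<times> K)" "u \<longlonglongrightarrow> l"
  then have "\<forall>n. \<exists>y. (u n, y) \<in> E \<and> y \<in> K" by force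
  then obtain y where y: "\<And>n. (u n, y n) \<in> E" "\<And>n. y n \<in> K" by metis
  obtain z r where zr: "z \<in> K" "strict_mono r" "(y \<circ> r) \<longlonglongrightarrow> z"
    using assms(2) y(2) unfolding compact_def by metis
  have "(\<lambda>n. (u (r n), y (r n))) \<longlonglongrightarrow> (l, z)"
    using zr(3) LIMSEQ_subseq_LIMSEQ[OF u(2) zr(2)] by (intro tendsto_Pair) (auto simp: o_def)
  then have "(l, z) \<in> E" using closed_sequentially[OF assms(1), of "\<lambda>n. (u (r n), y (r n))"] y(1) by blast
  then show "l \<in> fst ` (E \<inter> UNIV \<times> K)" using zr(1) by force
qed

text \<open>
  The projection of a closed set is in general not Borel, but outer measure is continuous along
  increasing sequences of arbitrary sets. So at step \<open>k\<close> the second factor can be restricted to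
  finitely many balls of radius \<open>2\<^sup>-\<^sup>k\<close> with an arbitrarily small loss. What remains in the limit is
  compact, and every point that is in the closures of all the restricted projections is already in the
  projection of the limit.
\<close>

lemma closed_projection_compact_approx:
  fixes E :: "('a::metric_space \<times> 'b::complete_space) set" and \<mu> :: "'a measure"
  assumes E: "closed E" and Q: "countable Q" "closure Q = (UNIV :: 'b set)"
    and \<mu>: "finite_measure \<mu>" "sets \<mu> = sets borel" and "0 < e"
  obtains K where "compact K"
    "outer_measure_of \<mu> (fst ` E) \<le> emeasure \<mu> (fst ` (E \<inter> UNIV \<times> K)) + ennreal e"
proof -
  interpret finite_measure \<mu> by fact
  have sp [simp]: "space \<mu> = UNIV" using sets_eq_imp_space_eq[OF \<mu>(2)] by simp
  have "Q \<noteq> {}" using Q(2) closure_empty by (metis UNIV_not_empty)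
  define q where "q = from_nat_into Q"
  have q: "range q = Q" unfolding q_def using \<open>Q \<noteq> {}\<close> Q(1) by (rule range_from_nat_into)
  have q_dense: "\<exists>n. dist (q n) y < \<delta>" if "0 < \<delta>" for y \<delta>
  proof -
    have "y \<in> closure (range q)" using Q(2) q by simp
    then show ?thesis using that unfolding closure_approachable by auto
  qed
  define P where "P V = fst ` (E \<inter> UNIV \<times> V)" for V
  let ?o = "outer_measure_of \<mu>"
  have fin: "?o A < \<top>" for A
    using outer_measure_of_mono[of A UNIV \<mu>] emeasure_finite[of UNIV] sets.top[of \<mu>]
    by (auto simp: less_top[symmetric] top_unique)
  define step where "step k V W \<longleftrightarrow> W \<subseteq> V \<and> (\<exists>S. finite S \<and> W \<subseteq> (\<Union>s\<in>S. cball s ((1/2)^k))) \<and>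
      ?o (P V) \<le> ?o (P W) + ennreal (e * (1/2)^Suc k)" for k :: nat and V W :: "'b set"
  have "\<exists>V. \<forall>k. (closed (V k) \<and> (k = 0 \<longrightarrow> V k = UNIV)) \<and> step k (V k) (V (Suc k))"
    proof (rule dependent_nat_choice)
      fix V :: "'b set" and k :: nat assume V: "closed V \<and> (k = 0 \<longrightarrow> V = UNIV)"
      define W where "W n = V \<inter> (\<Union>s\<in>q ` {..n}. cball s ((1/2)^k))" for n
      have "incseq (\<lambda>n. P (W n))" unfolding incseq_def P_def W_def by fastforce
      moreover have "(\<Union>n. P (W n)) = P V"
      proof -
        have "(\<Union>n. W n) = V"
        proof (intro equalityI subsetI)
          fix y assume "y \<in> V"
          moreover obtain n where "dist (q n) y < (1/2)^k"
            using q_dense[of "(1/2)^k" y] by auto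
          ultimately have "y \<in> W n" unfolding W_def
            by (intro IntI UN_I[of "q n"]) auto
          then show "y \<in> (\<Union>n. W n)" by blast
        qed (auto simp: W_def)
        then show ?thesis unfolding P_def by blast
      qed
      ultimately have sup: "(SUP n. ?o (P (W n))) = ?o (P V)"
        using SUP_outer_measure_of_incseq[of "\<lambda>n. P (W n)" \<mu>] by simp
      have "\<exists>n. ?o (P V) \<le> ?o (P (W n)) + ennreal (e * (1/2)^Suc k)"
      proof (rule ccontr)
        assume "\<not> ?thesis"
        then have *: "?o (P (W n)) + ennreal (e * (1/2)^Suc k) \<le> ?o (P V)" for n
          by (meson linear)
        have "(SUP n. ?o (P (W n)) + ennreal (e * (1/2)^Suc k)) \<le> ?o (P V)"
          using * by (rule SUP_least)
        then have "?o (P V) + ennreal (e * (1/2)^Suc k) \<le> ?o (P V)"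
          using ennreal_SUP_add_left[of UNIV "\<lambda>n. ?o (P (W n))" "ennreal (e * (1/2)^Suc k)"]
          by (simp add: sup del: power_Suc)
        then have "ennreal (e * (1/2)^Suc k) \<le> 0"
          using fin[of "P V"] ennreal_add_left_cancel_le[of "?o (P V)" "ennreal (e * (1/2)^Suc k)" 0]
          by (auto simp del: power_Suc)
        moreover have "0 < e * (1/2)^Suc k" using \<open>0 < e\<close> by simp
        ultimately show False by (simp add: ennreal_eq_0_iff del: power_Suc)
      qed
      then obtain n where n: "?o (P V) \<le> ?o (P (W n)) + ennreal (e * (1/2)^Suc k)" ..
      have "closed (W n)" unfolding W_def using V by (intro closed_Int closed_UN) auto
      then show "\<exists>W. (closed W \<and> (Suc k = 0 \<longrightarrow> W = UNIV)) \<and> step k V W"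
        using n unfolding step_def
        by (intro exI[of _ "W n"] conjI exI[of _ "q ` {..n}"]) (auto simp: W_def)
    qed auto
  then obtain V where V': "\<And>k. (closed (V k) \<and> (k = 0 \<longrightarrow> V k = UNIV)) \<and> step k (V k) (V (Suc k))"
    by (elim exE) (rule that, erule spec)
  have V: "\<And>k. closed (V k)" "\<And>k. V (Suc k) \<subseteq> V k"
      "\<And>k. \<exists>S. finite S \<and> V (Suc k) \<subseteq> (\<Union>s\<in>S. cball s ((1/2)^k))"
      "\<And>k. ?o (P (V k)) \<le> ?o (P (V (Suc k))) + ennreal (e * (1/2)^Suc k)" "V 0 = UNIV"
    using V' unfolding step_def by (simp_all del: power_Suc)
  have decV: "decseq V" using V(2) by (rule decseq_SucI)
  define K where "K = (\<Inter>k. V k)"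
  have "closed K" using V(1) by (auto simp: K_def)
  have "compact K"
  proof (rule compact_if_covered_by_balls[OF \<open>closed K\<close>])
    fix k show "\<exists>S. finite S \<and> K \<subseteq> (\<Union>s\<in>S. cball s ((1/2)^k))"
      using V(3)[of k] unfolding K_def by blast
  qed
  have sumbound: "?o (P UNIV) \<le> ?o (P (V k)) + ennreal (e * (1 - (1/2)^k))" for k
  proof (induction k)
    case 0
    then show ?case by (simp add: V(5))
  next
    case (Suc k)
    note Suc
    also have "?o (P (V k)) + ennreal (e * (1 - (1/2)^k))
      \<le> (?o (P (V (Suc k))) + ennreal (e * (1/2)^Suc k)) + ennreal (e * (1 - (1/2)^k))"
      using V(4) by (rule add_right_mono)
    also have "\<dots> = ?o (P (V (Suc k))) + (ennreal (e * (1/2)^Suc k) + ennreal (e * (1 - (1/2)^k)))"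
      by (simp add: add.assoc)
    also have "ennreal (e * (1/2)^Suc k) + ennreal (e * (1 - (1/2)^k)) = ennreal (e * (1 - (1/2)^Suc k))"
      using \<open>0 < e\<close> by (subst ennreal_plus[symmetric]) (auto simp: power_le_one algebra_simps)
    finally show ?case .
  qed
  have low: "?o (P UNIV) \<le> ?o (P (V k)) + ennreal e" for k
    using \<open>0 < e\<close>
    by (intro order_trans[OF sumbound[of k]] add_left_mono ennreal_leI) (simp add: algebra_simps)
  \<comment> \<open>The closures are measurable, decrease, and have measure at least \<open>?o (P UNIV) - e\<close>.\<close>
  define C where "C k = closure (P (V k))" for k
  have "(\<Inter>k. C k) \<subseteq> P K"
  proof
    fix x assume x: "x \<in> (\<Inter>k. C k)"
    have "\<exists>x' y. (x', y) \<in> E \<and> y \<in> V k \<and> dist x' x < inverse (real (Suc k))" for k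
    proof -
      have "x \<in> closure (P (V k))" using x by (auto simp: C_def)
      moreover have "0 < inverse (real (Suc k))" by simp
      ultimately obtain x' where "x' \<in> P (V k)" "dist x' x < inverse (real (Suc k))"
        unfolding closure_approachable by blast
      then obtain y where "(x', y) \<in> E" "y \<in> V k" unfolding P_def by auto
      then show ?thesis using \<open>dist x' x < inverse (real (Suc k))\<close> by blast
    qed
    then obtain u y where uy: "\<And>k. (u k, y k) \<in> E" "\<And>k. y k \<in> V k" "\<And>k. dist (u k) x < inverse (real (Suc k))"
      by metis
    have "u \<longlonglongrightarrow> x"
      by (rule tendsto_dist_iff[THEN iffD2],
          rule tendsto_sandwich[OF _ _ tendsto_const LIMSEQ_inverse_real_of_nat])
        (simp_all del: of_nat_Suc add: always_eventually less_imp_le uy(3))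
    \<comment> \<open>All but finitely many \<open>y n\<close> lie in each \<open>V (Suc k)\<close>, so their range is totally bounded.\<close>
    have "compact (closure (range y))"
    proof (rule compact_if_covered_by_balls)
      fix k
      obtain S where S: "finite S" "V (Suc k) \<subseteq> (\<Union>s\<in>S. cball s ((1/2)^k))" using V(3) by blast
      let ?S = "S \<union> y ` {..k}"
      have "range y \<subseteq> (\<Union>s\<in>?S. cball s ((1/2)^k))"
      proof (intro subsetI, elim rangeE)
        fix z n assume z: "z = y n"
        show "z \<in> (\<Union>s\<in>?S. cball s ((1/2)^k))"
        proof (cases "n \<le> k")
          case True
          then show ?thesis unfolding z by (intro UN_I[of "y n"]) auto
        next
          case False
          then have "y n \<in> V (Suc k)" using uy(2) decseqD[OF decV, of "Suc k" n] by auto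
          then have "y n \<in> (\<Union>s\<in>S. cball s ((1/2)^k))" using S(2) by blast
          then show ?thesis unfolding z by blast
        qed
      qed
      moreover have "closed (\<Union>s\<in>?S. cball s ((1/2)^k))" using S(1) by (intro closed_UN) auto
      ultimately show "\<exists>S. finite S \<and> closure (range y) \<subseteq> (\<Union>s\<in>S. cball s ((1/2)^k))"
        using S(1) by (intro exI[of _ ?S] conjI closure_minimal) auto
    qed simp
    then obtain z r where zr: "strict_mono r" "(y \<circ> r) \<longlonglongrightarrow> z"
      unfolding compact_def by (metis closure_subset rangeI subsetD)
    have "(\<lambda>n. (u (r n), y (r n))) \<longlonglongrightarrow> (x, z)"
      using zr(2) LIMSEQ_subseq_LIMSEQ[OF \<open>u \<longlonglongrightarrow> x\<close> zr(1)] by (intro tendsto_Pair) (auto simp: o_def)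
    then have "(x, z) \<in> E" using closed_sequentially[OF E, of "\<lambda>n. (u (r n), y (r n))"] uy(1) by blast
    moreover have "z \<in> V k" for k
    proof (rule Lim_in_closed_set[OF V(1) _ _ zr(2)])
      have "y (r n) \<in> V k" if "k \<le> n" for n
        using uy(2)[of "r n"] decseqD[OF decV, of k "r n"] seq_suble[OF zr(1), of n] that by auto
      then show "\<forall>\<^sub>F n in sequentially. (y \<circ> r) n \<in> V k"
        by (auto simp: eventually_sequentially)
    qed simp
    ultimately show "x \<in> P K" by (force simp: P_def K_def)
  qed
  moreover have "P K \<in> sets \<mu>"
    using closed_projection_compact[OF E \<open>compact K\<close>] by (simp add: \<mu>(2) P_def)
  ultimately have "emeasure \<mu> (\<Inter>k. C k) \<le> emeasure \<mu> (P K)" by (rule emeasure_mono)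
  moreover have "(INF k. emeasure \<mu> (C k)) = emeasure \<mu> (\<Inter>k. C k)"
  proof (rule INF_emeasure_decseq)
    show "decseq C" using decV unfolding C_def P_def decseq_def
      by (intro allI impI closure_mono) blast
  qed (auto simp: C_def \<mu>(2) emeasure_finite)
  moreover have "?o (P UNIV) \<le> (INF k. emeasure \<mu> (C k)) + ennreal e"
  proof -
    have "?o (P UNIV) - ennreal e \<le> emeasure \<mu> (C k)" for k
    proof -
      have "?o (P (V k)) \<le> emeasure \<mu> (C k)"
        using outer_measure_of_mono[of "P (V k)" "C k" \<mu>] closure_subset[of "P (V k)"] by (simp add: C_def \<mu>(2))
      then have "?o (P UNIV) \<le> ennreal e + emeasure \<mu> (C k)"
        using low[of k] by (metis add.commute add_left_mono order_trans)
      then show ?thesis by (simp add: ennreal_minus_le_iff)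
    qed
    then have "?o (P UNIV) - ennreal e \<le> (INF k. emeasure \<mu> (C k))" by (rule INF_greatest)
    then show ?thesis by (simp add: ennreal_minus_le_iff add.commute)
  qed
  ultimately have "?o (P UNIV) \<le> emeasure \<mu> (P K) + ennreal e"
    by (metis add_right_mono order_trans)
  then show ?thesis using that[OF \<open>compact K\<close>] by (simp add: P_def)
qed

text \<open>
  Fix a dense sequence \<open>q\<close>. The lists of indices \<open>l\<close> such that the section over \<open>x\<close> meets
  \<open>cball (q (l ! j)) (2\<^sup>-\<^sup>j)\<close> for all \<open>j\<close> simultaneously are tested by closed sets \<open>C l\<close>, by compactness. Extending the list each
  time by the least admissible index depends on \<open>x\<close> in a measurable way, and the chosen centres converge to a
  point of the section.
\<close>

lemma compact_sections_measurable_selection: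
  fixes E :: "('a::metric_space \<times> 'b::metric_space) set"
  assumes E: "closed E" and K: "compact K" and Q: "countable Q" "closure Q = (UNIV :: 'b set)"
  obtains f where "f \<in> borel_measurable borel" "\<And>x. x \<in> fst ` (E \<inter> UNIV \<times> K) \<Longrightarrow> (x, f x) \<in> E"
proof -
  have "Q \<noteq> {}" using Q(2) closure_empty by (metis UNIV_not_empty)
  define q where "q = from_nat_into Q"
  have q: "range q = Q" unfolding q_def using \<open>Q \<noteq> {}\<close> Q(1) by (rule range_from_nat_into)
  have q_dense: "\<exists>n. dist (q n) y < \<delta>" if "0 < \<delta>" for y \<delta>
  proof -
    have "y \<in> closure (range q)" using Q(2) q by simp
    then show ?thesis using that unfolding closure_approachable by auto
  qed
  define B where "B l = K \<inter> (\<Inter>j\<in>{..<length l}. cball (q (l ! j)) ((1/2)^j))" for l :: "nat list"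
  define C where "C l = fst ` (E \<inter> UNIV \<times> B l)" for l
  have "compact (B l)" for l unfolding B_def
    using K by (intro compact_Int_closed closed_INT) auto
  then have "closed (C l)" for l unfolding C_def by (intro closed_projection_compact E)
  then have measC: "C l \<in> sets borel" for l by simp
  have B_app: "B (l @ [i]) = B l \<inter> cball (q i) ((1/2)^length l)" for l i
    unfolding B_def by (auto simp: nth_append lessThan_Suc)
  have ext: "\<exists>i. x \<in> C (l @ [i])" if "x \<in> C l" for x l
  proof -
    from that obtain y where y: "(x, y) \<in> E" "y \<in> B l" by (auto simp: C_def)
    obtain i where "dist (q i) y < (1/2)^length l"
      using q_dense[of "(1/2)^length l" y] by auto
    then show ?thesis using y unfolding C_def B_app by (intro exI[of _ i]) force
  qed
  define p where "p x = rec_nat [] (\<lambda>k l. l @ [LEAST i. x \<in> C (l @ [i])])" for x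
  have p0: "p x 0 = []" and pS: "p x (Suc k) = p x k @ [LEAST i. x \<in> C (p x k @ [i])]" for x k
    by (simp_all add: p_def)
  have len: "length (p x k) = k" for x k by (induction k) (simp_all add: p0 pS)
  have pC: "x \<in> C (p x k)" if "x \<in> C []" for x k
    using that by (induction k) (auto simp: p0 pS intro: LeastI_ex ext)
  have measp: "(\<lambda>x. p x k) \<in> measurable borel (count_space UNIV)" for k
  proof (induction k)
    case 0
    then show ?case by (simp add: p0)
  next
    case (Suc k)
    have "(\<lambda>x. l @ [LEAST i. x \<in> C (l @ [i])]) \<in> measurable borel (count_space UNIV)" for l
    proof (rule measurable_compose[of "\<lambda>x. LEAST i. x \<in> C (l @ [i])" borel "count_space UNIV" "\<lambda>i. l @ [i]"])
      show "(\<lambda>x. LEAST i. x \<in> C (l @ [i])) \<in> measurable borel (count_space UNIV)"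
        using measC by (intro measurable_Least) (simp add: pred_def)
    qed simp
    then show ?case unfolding pS by (rule measurable_compose_countable[OF _ Suc])
  qed
  define g where "g k x = (if x \<in> C [] then q (last (p x (Suc k))) else q 0)" for k x
  have measg: "g k \<in> borel_measurable borel" for k
  proof -
    have "(\<lambda>x. q (last (p x (Suc k)))) \<in> borel_measurable borel"
      by (rule measurable_compose[OF measp]) simp
    then show ?thesis unfolding g_def using measC by (intro measurable_If_set) auto
  qed
  have wit: "\<exists>y\<in>K. (x, y) \<in> E \<and> (\<forall>j\<le>k. dist (g j x) y \<le> (1/2)^j)" if x: "x \<in> C []" for x k
  proof -
    from pC[OF x, of "Suc k"] obtain y where y: "(x, y) \<in> E" "y \<in> B (p x (Suc k))" by (auto simp: C_def)
    have "y \<in> B (p x (Suc j))" if "j \<le> k" for j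
      using that
    proof (induction rule: inc_induct)
      case (step n)
      then show ?case by (subst (asm) pS) (simp add: B_app)
    qed (rule y(2))
    then have "dist (g j x) y \<le> (1/2)^j" if "j \<le> k" for j
      using that x unfolding g_def by (auto simp: pS B_app len)
    then show ?thesis using y unfolding B_def by auto
  qed
  have lim: "\<exists>y. (\<lambda>k. g k x) \<longlonglongrightarrow> y \<and> (x \<in> C [] \<longrightarrow> (x, y) \<in> E)" for x
  proof (cases "x \<in> C []")
    case True
    then have "\<forall>k. \<exists>y. y \<in> K \<and> (x, y) \<in> E \<and> (\<forall>j\<le>k. dist (g j x) y \<le> (1/2)^j)" using wit by blast
    then obtain y where y: "\<And>k. y k \<in> K" "\<And>k. (x, y k) \<in> E" "\<And>k j. j \<le> k \<Longrightarrow> dist (g j x) (y k) \<le> (1/2)^j"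
      by metis
    obtain z r where zr: "z \<in> K" "strict_mono r" "(y \<circ> r) \<longlonglongrightarrow> z"
      using K y(1) unfolding compact_def by metis
    have "dist (g j x) z \<le> (1/2)^j" for j
    proof (rule Lim_bounded)
      show "(\<lambda>n. dist (g j x) ((y \<circ> r) n)) \<longlonglongrightarrow> dist (g j x) z"
        using zr(3) by (intro tendsto_intros)
      show "\<forall>n\<ge>j. dist (g j x) ((y \<circ> r) n) \<le> (1/2)^j"
        using y(3) order_trans[OF _ seq_suble[OF zr(2)]] by auto
    qed
    note gz = this
    have "(\<lambda>k. g k x) \<longlonglongrightarrow> z"
      by (rule tendsto_dist_iff[THEN iffD2],
          rule tendsto_sandwich[OF _ _ tendsto_const LIMSEQ_power_zero[of "1/2::real"]])
        (auto intro!: always_eventually gz)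
    moreover have "(x, z) \<in> E"
      by (rule closed_sequentially[OF E _ tendsto_Pair[OF tendsto_const zr(3)]]) (simp add: y(2))
    ultimately show ?thesis by blast
  next
    case False
    then show ?thesis by (intro exI[of _ "q 0"]) (simp add: g_def)
  qed
  then obtain f where f: "\<And>x. (\<lambda>k. g k x) \<longlonglongrightarrow> f x" "\<And>x. x \<in> C [] \<Longrightarrow> (x, f x) \<in> E" by metis
  have "f \<in> borel_measurable borel"
    by (rule borel_measurable_LIMSEQ_metric[OF measg f(1)])
  then show ?thesis using that f(2) by (simp add: C_def B_def)
qed

text \<open>
  Tightness is the case of the diagonal over a closed set in the approximation of projections.
\<close>

lemma compact_inner_approx:
  fixes \<mu> :: "'a::complete_space measure"
  assumes D: "countable D" "closure D = (UNIV :: 'a set)" and \<mu>: "finite_measure \<mu>" "sets \<mu> = sets borel"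
    and B: "B \<in> sets borel" and e: "0 < e"
  shows "\<exists>K. compact K \<and> K \<subseteq> B \<and> emeasure \<mu> B \<le> emeasure \<mu> K + ennreal e"
proof -
  interpret finite_measure \<mu> by fact
  obtain F U where F: "closed F" "open U" "F \<subseteq> B" "B \<subseteq> U" "measure \<mu> (U - F) \<le> e/2"
    using finite_borel_measure_closed_open_approx[OF \<mu> B, of "e/2"] e by auto
  define E where "E = {p::'a \<times> 'a. fst p = snd p} \<inter> F \<times> UNIV"
  have "closed E" unfolding E_def using F(1)
    by (intro closed_Int closed_Collect_eq closed_Times continuous_intros) auto
  moreover have "0 < e/2" using e by simp
  ultimately obtain K where K: "compact K" "outer_measure_of \<mu> (fst ` E) \<le> emeasure \<mu> (fst ` (E \<inter> UNIV \<times> K)) + ennreal (e/2)"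
    using closed_projection_compact_approx[OF _ D \<mu>] by blast
  have p: "fst ` E = F" "fst ` (E \<inter> UNIV \<times> K) = F \<inter> K" by (force simp: E_def)+
  have sF: "F \<in> sets \<mu>" "U \<in> sets \<mu>" "B \<in> sets \<mu>" using F B \<mu>(2) by auto
  have "emeasure \<mu> B \<le> emeasure \<mu> (F \<union> (U - F))"
    using F sF by (intro emeasure_mono) auto
  also have "\<dots> \<le> emeasure \<mu> F + emeasure \<mu> (U - F)"
    using sF by (intro emeasure_subadditive) auto
  also have "emeasure \<mu> F \<le> emeasure \<mu> (F \<inter> K) + ennreal (e/2)"
    using K(2) sF(1) unfolding p by simp
  also have "emeasure \<mu> (U - F) \<le> ennreal (e/2)"
    using F(5) by (simp add: emeasure_eq_measure ennreal_leI)
  also have "emeasure \<mu> (F \<inter> K) + ennreal (e/2) + ennreal (e/2) = emeasure \<mu> (F \<inter> K) + ennreal e"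
    using e by (simp add: add.assoc ennreal_plus[symmetric] del: ennreal_plus)
  finally have "emeasure \<mu> B \<le> emeasure \<mu> (F \<inter> K) + ennreal e" by (simp add: add_mono)
  moreover have "compact (F \<inter> K)" using F(1) K(1) by (rule closed_Int_compact)
  ultimately show ?thesis using F(3) by blast
qed

text \<open>
  If \<open>y\<^sub>k\<close> converges to \<open>y\<close>, the points that lie in infinitely many sections over the \<open>y\<^sub>k\<close> lie in the
  section over \<open>y\<close>; so the measure of the sections is upper semicontinuous.
\<close>

lemma closed_superlevel_sections:
  fixes R :: "('a::metric_space \<times> 'a) set"
  assumes R: "closed R" and m: "sets m = sets borel" and A: "A \<in> sets borel" "emeasure m A < \<top>"
  shows "closed {y. c \<le> emeasure m (A \<inter> {a. (y, a) \<in> R})}"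
  unfolding closed_sequential_limits
proof (intro allI impI, elim conjE)
  fix u l assume u: "\<forall>n. u n \<in> {y. c \<le> emeasure m (A \<inter> {a. (y, a) \<in> R})}" "u \<longlonglongrightarrow> l"
  define S where "S y = A \<inter> {a. (y, a) \<in> R}" for y
  have cS: "S y \<in> sets m" for y
  proof -
    have "closed {a. (y, a) \<in> R}"
      using continuous_closed_preimage[of UNIV "\<lambda>a. (y, a)" R] R by (simp add: vimage_def continuous_intros)
    then show ?thesis using A(1) m by (simp add: S_def)
  qed
  have le: "emeasure m X \<le> emeasure m A" if "X \<subseteq> A" for X
    using that A m by (intro emeasure_mono) auto
  define V where "V j = (\<Union>k\<in>{j..}. S (u k))" for j
  have V: "V j \<in> sets m" for j unfolding V_def using cS by (intro sets.countable_UN') auto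
  have VA: "V j \<subseteq> A" for j by (auto simp: V_def S_def)
  have "c \<le> emeasure m (V j)" for j
  proof -
    have "c \<le> emeasure m (S (u j))" using u(1) by (simp add: S_def)
    also have "\<dots> \<le> emeasure m (V j)" using V by (intro emeasure_mono) (auto simp: V_def)
    finally show ?thesis .
  qed
  then have "c \<le> (INF j. emeasure m (V j))" by (rule INF_greatest)
  also have "\<dots> = emeasure m (\<Inter>j. V j)"
  proof (rule INF_emeasure_decseq)
    show "decseq V" unfolding V_def decseq_def by fastforce
    show "emeasure m (V i) \<noteq> \<infinity>" for i using le[OF VA[of i]] A(2) by (auto simp: top_unique)
  qed (use V in auto)
  also have "\<dots> \<le> emeasure m (S l)"
  proof (rule emeasure_mono[OF _ cS])
    show "(\<Inter>j. V j) \<subseteq> S l"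
    proof
      fix a assume a: "a \<in> (\<Inter>j. V j)"
      have "(l, a) \<in> R"
      proof (rule ccontr)
        assume "(l, a) \<notin> R"
        moreover have "(\<lambda>n. (u n, a)) \<longlonglongrightarrow> (l, a)" using u(2) by (intro tendsto_intros)
        ultimately have "\<forall>\<^sub>F n in sequentially. (u n, a) \<in> - R"
          using R by (intro topological_tendstoD) auto
        then obtain j where j: "\<And>n. n \<ge> j \<Longrightarrow> (u n, a) \<notin> R" by (auto simp: eventually_sequentially)
        have "a \<in> V j" using a by blast
        then show False using j by (auto simp: V_def S_def)
      qed
      moreover have "a \<in> A" using a VA by blast
      ultimately show "a \<in> S l" by (simp add: S_def)
    qed
  qed
  finally show "l \<in> {y. c \<le> emeasure m (A \<inter> {a. (y, a) \<in> R})}" by (simp add: S_def)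
qed

lemma Baire_closed_cover_ball:
  fixes G :: "nat \<Rightarrow> 'a::complete_space set"
  assumes G: "\<And>n. closed (G n)" "(\<Union>n. G n) = UNIV"
  obtains n p r where "0 < r" "ball p r \<subseteq> G n"
proof -
  have "\<exists>n. interior (G n) \<noteq> {}"
  proof (rule ccontr)
    assume "\<not> ?thesis"
    then have "Met_TC.mtopology interior_of (\<Union>(range G)) = {}"
      using G(1) by (intro Met_TC.metric_Baire_category_alt) (auto simp: complete_UNIV)
    then show False using G(2) by simp
  qed
  then obtain n p where "p \<in> interior (G n)" by blast
  then obtain r where "0 < r" "ball p r \<subseteq> G n" unfolding mem_interior by blast
  then show ?thesis using that by blast
qed

lemma null_cover_UN:
  assumes "countable I" "\<And>i. i \<in> I \<Longrightarrow> \<exists>Z\<in>null_sets m. A i \<subseteq> Z"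
  shows "\<exists>Z\<in>null_sets m. (\<Union>i\<in>I. A i) \<subseteq> Z"
proof -
  obtain Z where Z: "\<And>i. i \<in> I \<Longrightarrow> Z i \<in> null_sets m" "\<And>i. i \<in> I \<Longrightarrow> A i \<subseteq> Z i"
    using assms(2) by metis
  show ?thesis
  proof
    show "(\<Union>i\<in>I. Z i) \<in> null_sets m" using assms(1) Z(1) by (rule null_sets_UN')
    show "(\<Union>i\<in>I. A i) \<subseteq> (\<Union>i\<in>I. Z i)" using Z(2) by (rule UN_mono[OF subset_refl])
  qed
qed

lemma measure_exhausted_null:
  assumes H: "H \<in> sets m" and C: "\<And>j::nat. C j \<in> sets m" "\<And>j. C j \<subseteq> H" "\<And>j. emeasure m (C j) < \<top>"
    and le: "\<And>j. emeasure m H \<le> emeasure m (C j) + ennreal (inverse (Suc j))"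
  shows "H - (\<Union>j. C j) \<in> null_sets m"
proof (rule null_setsI)
  show "H - (\<Union>j. C j) \<in> sets m" using H C(1) by (intro sets.Diff sets.countable_UN) auto
  have "emeasure m (H - (\<Union>j. C j)) \<le> 0 + ennreal e" if "0 < e" for e
  proof -
    obtain j where j: "inverse (real (Suc j)) < e" using reals_Archimedean[OF \<open>0 < e\<close>] by blast
    have "emeasure m (H - (\<Union>j. C j)) \<le> emeasure m (H - C j)"
      using H C(1) by (intro emeasure_mono) auto
    also have "\<dots> = emeasure m H - emeasure m (C j)"
      using H C(1,2) C(3)[of j] by (intro emeasure_Diff) auto
    also have "\<dots> \<le> ennreal (inverse (Suc j))"
      using le[of j] C(3)[of j] by (auto simp: ennreal_minus_le_iff)
    also have "\<dots> \<le> ennreal e" using j by (intro ennreal_leI) simp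
    finally show ?thesis by simp
  qed
  then show "emeasure m (H - (\<Union>j. C j)) = 0"
    using ennreal_le_epsilon[of 0 "emeasure m (H - (\<Union>j. C j))"] by (metis le_zero_eq)
qed

section \<open>Lebesgue decompositions and the Renyi integral\<close>

lemma emeasure_density_indicator_set:
  assumes "X \<in> sets M" "A \<in> sets M"
  shows "emeasure (density M (indicator X)) A = emeasure M (A \<inter> X)"
proof -
  have "emeasure (density M (indicator X)) A = (\<integral>\<^sup>+x. indicator X x * indicator A x \<partial>M)"
    using assms by (subst emeasure_density) auto
  also have "\<dots> = (\<integral>\<^sup>+x. indicator (A \<inter> X) x \<partial>M)"
    by (intro nn_integral_cong) (auto split: split_indicator)
  finally show ?thesis using assms by simp
qed

text \<open>
  Among the null sets of \<open>m\<close> there is one of maximal \<open>\<mu>\<close>-measure; outside of it \<open>\<mu>\<close> is absolutely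
  continuous by maximality, and Radon-Nikodym applies.
\<close>

lemma lebesgue_decomposition_exists:
  assumes m: "sigma_finite_measure m" and fin: "finite_measure \<mu>" and sets: "sets \<mu> = sets m"
  obtains \<rho> \<nu> where "lebesgue_decomposition m \<mu> \<rho> \<nu>"
proof -
  interpret m: sigma_finite_measure m by fact
  interpret finite_measure \<mu> by fact
  \<comment> \<open>The supremum is attained at a countable union of null sets.\<close>
  define s where "s = (SUP S\<in>null_sets m. emeasure \<mu> S)"
  obtain f :: "nat \<Rightarrow> ennreal" where f: "range f \<subseteq> emeasure \<mu> ` null_sets m" "s = (SUP i. f i)"
    using ennreal_Sup_countable_SUP[of "emeasure \<mu> ` null_sets m"] unfolding s_def by auto
  have "\<forall>i. \<exists>S\<in>null_sets m. f i = emeasure \<mu> S" using f(1) by auto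
  then obtain S' where S': "\<And>i. S' i \<in> null_sets m" "\<And>i. f i = emeasure \<mu> (S' i)" by metis
  define S where "S = (\<Union>i. S' i)"
  have Snull: "S \<in> null_sets m" unfolding S_def using S'(1) by auto
  then have Sm [measurable]: "S \<in> sets m" "S \<in> sets \<mu>" using sets by auto
  have "s \<le> emeasure \<mu> S"
    unfolding f(2) S'(2) S_def using S'(1) sets by (intro SUP_least emeasure_mono) auto
  have zero: "emeasure \<mu> (A - S) = 0" if A: "A \<in> null_sets m" for A
  proof -
    have [measurable]: "A \<in> sets \<mu>" using A sets by auto
    have "emeasure \<mu> S + emeasure \<mu> (A - S) = emeasure \<mu> (S \<union> A)"
      by (subst plus_emeasure) (auto intro: arg_cong[where f="emeasure \<mu>"])
    also have "\<dots> \<le> s" unfolding s_def using A Snull by (intro SUP_upper) auto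
    also note \<open>s \<le> emeasure \<mu> S\<close>
    finally show ?thesis
      using ennreal_add_left_cancel_le[of "emeasure \<mu> S" "emeasure \<mu> (A - S)" 0] by auto
  qed
  define \<mu>1 where "\<mu>1 = density \<mu> (indicator (space m - S))"
  define \<nu> where "\<nu> = density \<mu> (indicator S)"
  have [simp]: "space \<mu> = space m" by (rule sets_eq_imp_space_eq) fact
  have e1: "emeasure \<mu>1 A = emeasure \<mu> (A - S)" if "A \<in> sets m" for A
    using that sets.sets_into_space[OF that] sets unfolding \<mu>1_def
    by (subst emeasure_density_indicator_set) (auto intro!: arg_cong[where f="emeasure \<mu>"])
  have e2: "emeasure \<nu> A = emeasure \<mu> (A \<inter> S)" if "A \<in> sets m" for A
    using that sets unfolding \<nu>_def by (subst emeasure_density_indicator_set) auto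
  have sets1: "sets \<mu>1 = sets m" using sets by (simp add: \<mu>1_def)
  moreover have "absolutely_continuous m \<mu>1"
    unfolding absolutely_continuous_def
    by (intro subsetI null_setsI) (simp_all add: sets1 e1 zero null_setsD2)
  ultimately obtain g where g: "g \<in> borel_measurable m" "density m g = \<mu>1"
    using m.Radon_Nikodym by blast
  have "(\<integral>\<^sup>+x. g x \<partial>m) = emeasure \<mu>1 (space m)"
    unfolding g(2)[symmetric] using g(1) by (subst emeasure_density) (auto intro!: nn_integral_cong)
  also have "\<dots> \<noteq> \<infinity>" by (simp add: e1)
  finally have "AE x in m. g x \<noteq> \<infinity>" using g(1) by (intro nn_integral_PInf_AE)
  then have "density m (\<lambda>x. ennreal (enn2real (g x))) = density m g"
    using g(1) by (intro density_cong) (auto elim!: eventually_mono simp: less_top)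
  then have d: "density m (\<lambda>x. ennreal (enn2real (g x))) = \<mu>1" using g(2) by simp
  have "lebesgue_decomposition m \<mu> (\<lambda>x. enn2real (g x)) \<nu>"
    unfolding lebesgue_decomposition_def
  proof (intro conjI ballI)
    show "mutually_singular m \<nu>"
      unfolding mutually_singular_def using Snull
      by (intro bexI[of _ S]) (auto simp: e2 Diff_Int_distrib2)
    fix A assume A: "A \<in> sets m"
    then have [measurable]: "A \<in> sets \<mu>" using sets by simp
    have "emeasure \<mu> (A - S) + emeasure \<mu> (A \<inter> S) = emeasure \<mu> A"
      by (subst plus_emeasure) (auto intro: arg_cong[where f="emeasure \<mu>"])
    then show "emeasure \<mu> A = emeasure (density m (\<lambda>x. ennreal (enn2real (g x)))) A + emeasure \<nu> A"
      by (simp add: d e1 e2 A)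
  qed (use g sets in \<open>auto simp: \<nu>_def\<close>)
  then show ?thesis using that by blast
qed

text \<open>
  The density on a set is determined by the values of the measure on the subsets of that set, because
  the singular parts disappear outside a null set. With \<open>c = 1\<close> this is uniqueness of the density; with
  \<open>c = 1/2\<close> it computes the density of a mixture where only one component is present.
\<close>

lemma lebesgue_decomposition_density_local:
  assumes m: "sigma_finite_measure m"
    and dec: "lebesgue_decomposition m \<mu> \<rho> \<nu>" "lebesgue_decomposition m \<mu>' \<rho>' \<nu>'"
    and X: "X \<in> sets m" and c: "0 \<le> c"
    and eq: "\<And>A. A \<in> sets m \<Longrightarrow> A \<subseteq> X \<Longrightarrow> emeasure \<mu> A = ennreal c * emeasure \<mu>' A"
  shows "AE x in m. x \<in> X \<longrightarrow> \<rho> x = c * \<rho>' x"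
proof -
  interpret sigma_finite_measure m by fact
  note d = dec[unfolded lebesgue_decomposition_def mutually_singular_def]
  have [measurable]: "\<rho> \<in> borel_measurable m" "\<rho>' \<in> borel_measurable m" using d by auto
  obtain S where S: "S \<in> null_sets m" "emeasure \<nu> (space m - S) = 0" "sets \<nu> = sets m" using d(1) by auto
  obtain S' where S': "S' \<in> null_sets m" "emeasure \<nu>' (space m - S') = 0" "sets \<nu>' = sets m" using d(2) by auto
  define Y where "Y = X - (S \<union> S')"
  have Y [measurable]: "Y \<in> sets m" unfolding Y_def using X S S' by auto
  have 1: "emeasure \<mu> A = emeasure (density m \<rho>) A" if "A \<in> sets m" "A \<subseteq> Y" for A
  proof -
    have "emeasure \<nu> A \<le> emeasure \<nu> (space m - S)"
      using that S sets.sets_into_space[OF that(1)] by (intro emeasure_mono) (auto simp: Y_def)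
    then show ?thesis using d(1) that S(2) by simp
  qed
  have 2: "emeasure \<mu>' A = emeasure (density m \<rho>') A" if "A \<in> sets m" "A \<subseteq> Y" for A
  proof -
    have "emeasure \<nu>' A \<le> emeasure \<nu>' (space m - S')"
      using that S' sets.sets_into_space[OF that(1)] by (intro emeasure_mono) (auto simp: Y_def)
    then show ?thesis using d(2) that S'(2) by simp
  qed
  have "density m (\<lambda>x. ennreal (\<rho> x) * indicator Y x) = density m (\<lambda>x. ennreal (c * \<rho>' x) * indicator Y x)"
  proof (rule measure_eqI)
    fix A assume "A \<in> sets (density m (\<lambda>x. ennreal (\<rho> x) * indicator Y x))"
    then have A [measurable]: "A \<in> sets m" by simp
    have "emeasure (density m (\<lambda>x. ennreal (\<rho> x) * indicator Y x)) A = emeasure (density m \<rho>) (A \<inter> Y)"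
      by (simp add: emeasure_density) (auto intro!: nn_integral_cong split: split_indicator)
    also have "\<dots> = emeasure \<mu> (A \<inter> Y)" by (subst 1) auto
    also have "\<dots> = ennreal c * emeasure \<mu>' (A \<inter> Y)" by (subst eq) (auto simp: Y_def[symmetric], auto simp: Y_def)
    also have "\<dots> = ennreal c * emeasure (density m \<rho>') (A \<inter> Y)" by (subst 2) auto
    also have "\<dots> = emeasure (density m (\<lambda>x. ennreal (c * \<rho>' x) * indicator Y x)) A"
      using c by (simp add: emeasure_density nn_integral_cmult[symmetric] ennreal_mult' del: nn_integral_cmult)
        (auto intro!: nn_integral_cong split: split_indicator)
    finally show "emeasure (density m (\<lambda>x. ennreal (\<rho> x) * indicator Y x)) A
      = emeasure (density m (\<lambda>x. ennreal (c * \<rho>' x) * indicator Y x)) A" .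
  qed simp
  then have "AE x in m. ennreal (\<rho> x) * indicator Y x = ennreal (c * \<rho>' x) * indicator Y x"
    by (subst (asm) density_unique_iff) auto
  moreover have "AE x in m. x \<notin> S \<union> S'" using S S' by (intro AE_not_in) auto
  moreover have "AE x in m. 0 \<le> \<rho> x \<and> 0 \<le> \<rho>' x" using d by (intro AE_I2) auto
  ultimately show ?thesis
  proof eventually_elim
    case (elim x)
    then show ?case using c by (auto simp: Y_def)
  qed
qed

text \<open>
  Minus the entropy, as an extended nonnegative number: concavity can then be stated without
  differences of infinite values.
\<close>

definition renyi_integral :: "real \<Rightarrow> 'a measure \<Rightarrow> 'a measure \<Rightarrow> ennreal" where
  "renyi_integral N m \<mu> = (\<integral>\<^sup>+ x. ennreal (ac_density m \<mu> x powr (1 - 1 / N)) \<partial>m)"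

lemma renyi_entropy_eq: "renyi_entropy N m \<mu> = - enn2ereal (renyi_integral N m \<mu>)"
  by (simp add: renyi_entropy_def renyi_integral_def)

lemma renyi_integral_decomposition:
  assumes m: "sigma_finite_measure m" and dec: "lebesgue_decomposition m \<mu> \<rho> \<nu>"
  shows "renyi_integral N m \<mu> = (\<integral>\<^sup>+ x. ennreal (\<rho> x powr (1 - 1 / N)) \<partial>m)"
proof -
  have "\<exists>\<nu>. lebesgue_decomposition m \<mu> (ac_density m \<mu>) \<nu>"
    unfolding ac_density_def using someI_ex[of "\<lambda>\<rho>. \<exists>\<nu>. lebesgue_decomposition m \<mu> \<rho> \<nu>"] dec by blast
  then obtain \<nu>' where "lebesgue_decomposition m \<mu> (ac_density m \<mu>) \<nu>'" ..
  from lebesgue_decomposition_density_local[OF m this dec, of "space m" 1]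
  have "AE x in m. ac_density m \<mu> x = \<rho> x" by (auto simp: )
  then show ?thesis unfolding renyi_integral_def
    by (intro nn_integral_cong_AE) (auto elim: eventually_mono)
qed

lemma lebesgue_decomposition_density_zero:
  assumes dec: "lebesgue_decomposition m \<mu> \<rho> \<nu>" and S: "S \<in> sets m" "emeasure \<mu> (space m - S) = 0"
  shows "AE x in m. x \<notin> S \<longrightarrow> \<rho> x = 0"
proof -
  note d = dec[unfolded lebesgue_decomposition_def]
  have [measurable]: "\<rho> \<in> borel_measurable m" "S \<in> sets m" using d S by auto
  have "emeasure (density m \<rho>) (space m - S) = 0" using d S by auto
  then have "(\<integral>\<^sup>+x. ennreal (\<rho> x) * indicator (space m - S) x \<partial>m) = 0"
    by (subst (asm) emeasure_density) auto
  then have "AE x in m. ennreal (\<rho> x) * indicator (space m - S) x = 0"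
    by (subst (asm) nn_integral_0_iff_AE) auto
  with AE_space show ?thesis
  proof eventually_elim
    case (elim x)
    then show ?case using d by (auto simp: ennreal_eq_0_iff split: split_indicator_asm intro: antisym)
  qed
qed

text \<open>
  The right-hand side is the tangent at \<open>\<kappa>\<close> of the concave function \<open>u powr \<theta>\<close>.
\<close>

lemma powr_tangent_bound:
  fixes u \<kappa> \<theta> :: real
  assumes "0 \<le> u" "0 < \<kappa>" "0 \<le> \<theta>" "\<theta> \<le> 1"
  shows "u powr \<theta> \<le> \<theta> * \<kappa> powr (\<theta> - 1) * u + (1 - \<theta>) * \<kappa> powr \<theta>"
proof (cases "u = 0")
  case False
  then have "(u / \<kappa>) powr \<theta> * 1 powr (1 - \<theta>) \<le> \<theta> * (u / \<kappa>) + (1 - \<theta>) * 1"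
    using assms by (intro Youngs_inequality_0) auto
  then have "(u / \<kappa>) powr \<theta> * \<kappa> powr \<theta> \<le> (\<theta> * (u / \<kappa>) + (1 - \<theta>)) * \<kappa> powr \<theta>"
    by (intro mult_right_mono) auto
  moreover have "(u / \<kappa>) powr \<theta> * \<kappa> powr \<theta> = u powr \<theta>"
    using assms by (simp add: powr_divide)
  moreover have "\<kappa> powr (\<theta> - 1) = \<kappa> powr \<theta> / \<kappa>"
    using assms by (simp add: powr_diff)
  ultimately show ?thesis by (simp add: algebra_simps)
qed (use assms in auto)

text \<open>
  Jensen's inequality, obtained by integrating the tangent bound at the mean density \<open>1/c\<close>.
\<close>

lemma renyi_integral_le_measure_carrier:
  assumes m: "sigma_finite_measure m" and \<mu>: "prob_space \<mu>" "sets \<mu> = sets m" and N: "1 \<le> N"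
    and S: "S \<in> sets m" "emeasure \<mu> (space m - S) = 0" "emeasure m S = ennreal c" "0 \<le> c"
  shows "renyi_integral N m \<mu> \<le> ennreal (c powr (1 / N))"
proof -
  interpret prob_space \<mu> by fact
  obtain \<rho> \<nu> where dec: "lebesgue_decomposition m \<mu> \<rho> \<nu>"
    using lebesgue_decomposition_exists[OF m finite_measure_axioms \<mu>(2)] .
  note d = dec[unfolded lebesgue_decomposition_def]
  have [measurable]: "\<rho> \<in> borel_measurable m" "S \<in> sets m" using d S by auto
  define \<theta> where "\<theta> = 1 - 1 / N"
  have \<theta>: "0 \<le> \<theta>" "\<theta> \<le> 1" "1 - \<theta> = 1 / N" using N by (auto simp: \<theta>_def)
  have z: "AE x in m. x \<notin> S \<longrightarrow> \<rho> x = 0" using lebesgue_decomposition_density_zero[OF dec S(1,2)] .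
  have H: "renyi_integral N m \<mu> = (\<integral>\<^sup>+ x. ennreal (\<rho> x powr \<theta>) \<partial>m)"
    using renyi_integral_decomposition[OF m dec] by (simp add: \<theta>_def)
  show ?thesis
  proof (cases "c = 0")
    case True
    then have "AE x in m. x \<notin> S" using S by (intro AE_not_in) auto
    with z have "AE x in m. ennreal (\<rho> x powr \<theta>) = 0" by eventually_elim auto
    then have "renyi_integral N m \<mu> = 0" unfolding H by (subst nn_integral_0_iff_AE) auto
    then show ?thesis by simp
  next
    case False
    then have "0 < c" using S by simp
    \<comment> \<open>The density of the uniform distribution, for which the bound is an equality.\<close>
    define \<kappa> where "\<kappa> = 1 / c"
    have \<kappa>: "0 < \<kappa>" using \<open>0 < c\<close> by (simp add: \<kappa>_def)
    have "AE x in m. ennreal (\<rho> x powr \<theta>)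
        \<le> ennreal (\<theta> * \<kappa> powr (\<theta> - 1)) * ennreal (\<rho> x) + ennreal ((1 - \<theta>) * \<kappa> powr \<theta>) * indicator S x"
      using z AE_space
    proof eventually_elim
      case (elim x)
      have r: "0 \<le> \<rho> x" using d elim by auto
      show ?case
      proof (cases "x \<in> S")
        case True
        have "\<rho> x powr \<theta> \<le> \<theta> * \<kappa> powr (\<theta> - 1) * \<rho> x + (1 - \<theta>) * \<kappa> powr \<theta>"
          using r \<kappa> \<theta> by (intro powr_tangent_bound) auto
        then show ?thesis using True r \<theta>(1,2)
          by (simp add: ennreal_mult'[symmetric] flip: ennreal_plus)
      next
        case False
        then show ?thesis using elim by simp
      qed
    qed
    then have "renyi_integral N m \<mu> \<le> (\<integral>\<^sup>+x. ennreal (\<theta> * \<kappa> powr (\<theta> - 1)) * ennreal (\<rho> x)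
        + ennreal ((1 - \<theta>) * \<kappa> powr \<theta>) * indicator S x \<partial>m)"
      unfolding H by (rule nn_integral_mono_AE)
    also have "\<dots> = ennreal (\<theta> * \<kappa> powr (\<theta> - 1)) * (\<integral>\<^sup>+x. ennreal (\<rho> x) \<partial>m) + ennreal ((1 - \<theta>) * \<kappa> powr \<theta>) * emeasure m S"
      by (subst nn_integral_add) (auto simp: nn_integral_cmult)
    also have "(\<integral>\<^sup>+x. ennreal (\<rho> x) \<partial>m) \<le> 1"
    proof -
      have "(\<integral>\<^sup>+x. ennreal (\<rho> x) \<partial>m) = emeasure (density m \<rho>) (space m)"
        by (subst emeasure_density) (auto intro!: nn_integral_cong)
      also have "\<dots> \<le> emeasure \<mu> (space m)" using d by auto
      also have "\<dots> = 1" using emeasure_space_1 sets_eq_imp_space_eq[OF \<mu>(2)] by simp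
      finally show ?thesis .
    qed
    also have "ennreal (\<theta> * \<kappa> powr (\<theta> - 1)) * 1 + ennreal ((1 - \<theta>) * \<kappa> powr \<theta>) * emeasure m S
        = ennreal (\<theta> * \<kappa> powr (\<theta> - 1) + (1 - \<theta>) * \<kappa> powr \<theta> * c)"
      using \<theta>(1,2) S by (simp add: ennreal_mult'[symmetric] flip: ennreal_plus)
    also have "\<theta> * \<kappa> powr (\<theta> - 1) + (1 - \<theta>) * \<kappa> powr \<theta> * c = c powr (1 / N)"
    proof -
      have "\<kappa> powr (\<theta> - 1) = c powr (1 / N)"
        using \<open>0 < c\<close> by (simp add: \<kappa>_def \<theta>_def powr_divide powr_minus_divide)
      moreover have "\<kappa> powr \<theta> * c = \<kappa> powr (\<theta> - 1)"
        using \<kappa> by (simp add: \<kappa>_def powr_diff)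
      ultimately show ?thesis by (simp add: algebra_simps)
    qed
    finally show ?thesis by (simp add: add_mono mult_left_mono)
  qed
qed

lemma renyi_integral_uniform:
  assumes m: "sigma_finite_measure m" and N: "1 \<le> N"
    and C: "C \<in> sets m" "emeasure m C = ennreal c" "0 < c"
  shows "renyi_integral N m (uniform_measure m C) = ennreal (c powr (1 / N))"
proof -
  have [measurable]: "C \<in> sets m" by fact
  have "lebesgue_decomposition m (uniform_measure m C) (\<lambda>x. indicator C x / c) (null_measure m)"
    unfolding lebesgue_decomposition_def mutually_singular_def
  proof (intro conjI ballI)
    have "ennreal (indicator C x / c) = indicator C x / emeasure m C" for x
      using C divide_ennreal[of 1 c] by (simp split: split_indicator)
    then show "emeasure (uniform_measure m C) A = emeasure (density m (\<lambda>x. ennreal (indicator C x / c))) A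
      + emeasure (null_measure m) A" for A
      by (simp add: uniform_measure_def)
  qed (use C in \<open>auto\<close>)
  from renyi_integral_decomposition[OF m this]
  have "renyi_integral N m (uniform_measure m C) = (\<integral>\<^sup>+x. ennreal ((indicator C x / c) powr (1 - 1 / N)) \<partial>m)" .
  also have "\<dots> = (\<integral>\<^sup>+x. ennreal ((1 / c) powr (1 - 1 / N)) * indicator C x \<partial>m)"
    by (intro nn_integral_cong) (auto split: split_indicator)
  also have "\<dots> = ennreal ((1 / c) powr (1 - 1 / N) * c)"
    using C by (subst nn_integral_cmult_indicator) (auto simp: ennreal_mult')
  also have "(1 / c) powr (1 - 1 / N) * c = c powr (1 / N)"
    using C(3) by (simp add: powr_divide powr_diff)
  finally show ?thesis .
qed

text \<open>
  The density of the mixture is half the density of one component on \<open>S1\<close> and half that of the other on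
  \<open>S2\<close>. For two measures with the same value of the integral the factor gained is \<open>2 * (1/2)
  powr (1 - 1/N) = 2 powr (1/N)\<close>.
\<close>

lemma renyi_integral_mixture_disjoint:
  assumes m: "sigma_finite_measure m"
    and \<mu>: "finite_measure \<mu>" "finite_measure \<mu>1" "finite_measure \<mu>2"
    and sets: "sets \<mu> = sets m" "sets \<mu>1 = sets m" "sets \<mu>2 = sets m"
    and mix: "\<And>A. A \<in> sets m \<Longrightarrow> emeasure \<mu> A = ennreal (1/2) * emeasure \<mu>1 A + ennreal (1/2) * emeasure \<mu>2 A"
    and S: "S1 \<in> sets m" "S2 \<in> sets m" "S1 \<inter> S2 = {}"
    and conc: "emeasure \<mu>1 (space m - S1) = 0" "emeasure \<mu>2 (space m - S2) = 0"
  shows "ennreal ((1/2) powr (1 - 1 / N)) * (renyi_integral N m \<mu>1 + renyi_integral N m \<mu>2) \<le> renyi_integral N m \<mu>"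
proof -
  obtain \<rho> \<nu> where dec: "lebesgue_decomposition m \<mu> \<rho> \<nu>"
    using lebesgue_decomposition_exists[OF m \<mu>(1) sets(1)] .
  obtain \<rho>1 \<nu>1 where dec1: "lebesgue_decomposition m \<mu>1 \<rho>1 \<nu>1"
    using lebesgue_decomposition_exists[OF m \<mu>(2) sets(2)] .
  obtain \<rho>2 \<nu>2 where dec2: "lebesgue_decomposition m \<mu>2 \<rho>2 \<nu>2"
    using lebesgue_decomposition_exists[OF m \<mu>(3) sets(3)] .
  note ds = dec[unfolded lebesgue_decomposition_def] dec1[unfolded lebesgue_decomposition_def]
    dec2[unfolded lebesgue_decomposition_def]
  have [measurable]: "\<rho> \<in> borel_measurable m" "\<rho>1 \<in> borel_measurable m" "\<rho>2 \<in> borel_measurable m"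
    using ds by auto
  note H = renyi_integral_decomposition[OF m dec] renyi_integral_decomposition[OF m dec1]
    renyi_integral_decomposition[OF m dec2]
  let ?\<theta> = "1 - 1 / N"
  have sub0: "emeasure \<mu>' A = 0" if "emeasure \<mu>' (space m - S) = 0" "sets \<mu>' = sets m" "S \<in> sets m"
    "A \<in> sets m" "A \<inter> S = {}" for \<mu>' :: "'a measure" and S A
  proof -
    have "emeasure \<mu>' A \<le> emeasure \<mu>' (space m - S)"
      using that sets.sets_into_space[OF that(4)] by (intro emeasure_mono) auto
    then show ?thesis using that(1) by simp
  qed
  have r1: "AE x in m. x \<in> S1 \<longrightarrow> \<rho> x = (1/2) * \<rho>1 x"
  proof (rule lebesgue_decomposition_density_local[OF m dec dec1 S(1)])
    fix A assume "A \<in> sets m" "A \<subseteq> S1"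
    then show "emeasure \<mu> A = ennreal (1/2) * emeasure \<mu>1 A"
      using sub0[OF conc(2) sets(3) S(2), of A] S(3) mix by auto
  qed simp
  have r2: "AE x in m. x \<in> S2 \<longrightarrow> \<rho> x = (1/2) * \<rho>2 x"
  proof (rule lebesgue_decomposition_density_local[OF m dec dec2 S(2)])
    fix A assume "A \<in> sets m" "A \<subseteq> S2"
    then show "emeasure \<mu> A = ennreal (1/2) * emeasure \<mu>2 A"
      using sub0[OF conc(1) sets(2) S(1), of A] S(3) mix by auto
  qed simp
  have "AE x in m. ennreal ((1/2) powr ?\<theta>) * (ennreal (\<rho>1 x powr ?\<theta>) + ennreal (\<rho>2 x powr ?\<theta>)) \<le> ennreal (\<rho> x powr ?\<theta>)"
    using r1 r2 lebesgue_decomposition_density_zero[OF dec1 S(1) conc(1)]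
      lebesgue_decomposition_density_zero[OF dec2 S(2) conc(2)]
      AE_space
  proof eventually_elim
    case (elim x)
    have nn: "0 \<le> \<rho>1 x" "0 \<le> \<rho>2 x" using ds elim(5) by auto
    have mul: "ennreal ((1/2) powr ?\<theta>) * ennreal (u powr ?\<theta>) = ennreal ((1/2 * u) powr ?\<theta>)" if "0 \<le> u" for u :: real
      using that by (subst powr_mult) (auto intro!: ennreal_mult'[symmetric])
    consider "x \<in> S1" "x \<notin> S2" | "x \<in> S2" "x \<notin> S1" | "x \<notin> S1" "x \<notin> S2" using S(3) by blast
    then show ?case
    proof cases
      case 1
      then have "\<rho>2 x = 0" "\<rho> x = 1/2 * \<rho>1 x" using elim by auto
      with mul[OF nn(1)] show ?thesis by (simp only: powr_0 ennreal_0 add_0_right order_refl)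
    next
      case 2
      then have "\<rho>1 x = 0" "\<rho> x = 1/2 * \<rho>2 x" using elim by auto
      with mul[OF nn(2)] show ?thesis by (simp only: powr_0 ennreal_0 add_0_left order_refl)
    next
      case 3
      then have "\<rho>1 x = 0" "\<rho>2 x = 0" using elim by auto
      then show ?thesis by simp
    qed
  qed
  then have "(\<integral>\<^sup>+x. ennreal ((1/2) powr ?\<theta>) * (ennreal (\<rho>1 x powr ?\<theta>) + ennreal (\<rho>2 x powr ?\<theta>)) \<partial>m)
      \<le> (\<integral>\<^sup>+x. ennreal (\<rho> x powr ?\<theta>) \<partial>m)"
    by (rule nn_integral_mono_AE)
  then show ?thesis unfolding H by (simp add: nn_integral_cmult nn_integral_add)
qed

section \<open>Geodesics and transport to a point\<close>

text \<open>
  The upper bounds suffice: strict inequality for some pair of times would make the curve shorter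
  than the distance of its end points.
\<close>

lemma geodesic_betweenI:
  fixes \<gamma> :: "real \<Rightarrow> 'a::metric_space"
  assumes L: "\<And>s t. 0 \<le> s \<Longrightarrow> s \<le> t \<Longrightarrow> t \<le> 1 \<Longrightarrow> dist (\<gamma> s) (\<gamma> t) \<le> (t - s) * dist (\<gamma> 0) (\<gamma> 1)"
  shows "geodesic_between \<gamma> (\<gamma> 0) (\<gamma> 1)"
proof -
  let ?l = "dist (\<gamma> 0) (\<gamma> 1)"
  have eq: "dist (\<gamma> s) (\<gamma> t) = (t - s) * ?l" if "0 \<le> s" "s \<le> t" "t \<le> 1" for s t
  proof (rule antisym)
    have "?l \<le> dist (\<gamma> 0) (\<gamma> s) + dist (\<gamma> s) (\<gamma> t) + dist (\<gamma> t) (\<gamma> 1)"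
      using dist_triangle[of "\<gamma> 0" "\<gamma> 1" "\<gamma> s"] dist_triangle[of "\<gamma> s" "\<gamma> 1" "\<gamma> t"] by linarith
    moreover have "dist (\<gamma> 0) (\<gamma> s) \<le> s * ?l" using L[of 0 s] that by simp
    moreover have "dist (\<gamma> t) (\<gamma> 1) \<le> (1 - t) * ?l" using L[of t 1] that by simp
    ultimately show "(t - s) * ?l \<le> dist (\<gamma> s) (\<gamma> t)" by (simp add: algebra_simps)
  qed (rule L[OF that])
  have eq': "dist (\<gamma> t) (\<gamma> s) = \<bar>t - s\<bar> * ?l" if "s \<in> {0..1}" "t \<in> {0..1}" for s t
  proof (cases "s \<le> t")
    case True
    then show ?thesis using eq[of s t] that by (simp add: dist_commute[of "\<gamma> t"])
  next
    case False
    then show ?thesis using eq[of t s] that by simp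
  qed
  have "?l-lipschitz_on {0..1} \<gamma>"
  proof (rule lipschitz_onI)
    fix s t :: real assume "s \<in> {0..1}" "t \<in> {0..1}"
    then show "dist (\<gamma> s) (\<gamma> t) \<le> ?l * dist s t"
      by (subst eq') (auto simp: dist_real_def mult.commute)
  qed simp
  then have "continuous_on {0..1} \<gamma>" by (rule lipschitz_on_continuous_on)
  then show ?thesis
    unfolding geodesic_between_def by (intro conjI ballI eq' refl)
qed

lemma geodesic_betweenD:
  assumes "geodesic_between \<gamma> x y" "s \<in> {0..1}" "t \<in> {0..1}"
  shows "dist (\<gamma> s) (\<gamma> t) = \<bar>s - t\<bar> * dist x y"
  using assms unfolding geodesic_between_def by auto

text \<open>
  Two curves that meet at time \<open>\<tau>\<close> can be joined if both move at most at the speed of a geodesic from the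
  start of the first to the end of the second. This covers the splicing of two geodesics with the same ends as well as the
  concatenation of geodesics through a midpoint or a prolongation.
\<close>

lemma geodesic_join:
  fixes \<gamma>1 \<gamma>2 :: "real \<Rightarrow> 'a::metric_space"
  assumes \<tau>: "0 \<le> \<tau>" "\<tau> < 1"
    and 1: "\<And>s t. 0 \<le> s \<Longrightarrow> s \<le> t \<Longrightarrow> t \<le> \<tau> \<Longrightarrow> dist (\<gamma>1 s) (\<gamma>1 t) \<le> (t - s) * dist (\<gamma>1 0) (\<gamma>2 1)"
    and 2: "\<And>s t. \<tau> \<le> s \<Longrightarrow> s \<le> t \<Longrightarrow> t \<le> 1 \<Longrightarrow> dist (\<gamma>2 s) (\<gamma>2 t) \<le> (t - s) * dist (\<gamma>1 0) (\<gamma>2 1)"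
    and eq: "\<gamma>1 \<tau> = \<gamma>2 \<tau>"
  shows "geodesic_between (\<lambda>u. if u \<le> \<tau> then \<gamma>1 u else \<gamma>2 u) (\<gamma>1 0) (\<gamma>2 1)"
proof -
  define c where "c u = (if u \<le> \<tau> then \<gamma>1 u else \<gamma>2 u)" for u
  have c0: "c 0 = \<gamma>1 0" and c1: "c 1 = \<gamma>2 1" using \<tau> by (auto simp: c_def)
  have "geodesic_between c (c 0) (c 1)"
  proof (rule geodesic_betweenI)
    fix s t :: real assume st: "0 \<le> s" "s \<le> t" "t \<le> 1"
    consider "t \<le> \<tau>" | "\<tau> < s" | "s \<le> \<tau>" "\<tau> < t" by linarith
    then show "dist (c s) (c t) \<le> (t - s) * dist (c 0) (c 1)"
    proof cases
      case 3
      have "dist (c s) (c t) \<le> dist (\<gamma>1 s) (\<gamma>1 \<tau>) + dist (\<gamma>2 \<tau>) (\<gamma>2 t)"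
        using 3 dist_triangle[of "\<gamma>1 s" "\<gamma>2 t" "\<gamma>1 \<tau>"] by (simp add: c_def eq)
      also have "\<dots> \<le> (\<tau> - s) * dist (\<gamma>1 0) (\<gamma>2 1) + (t - \<tau>) * dist (\<gamma>1 0) (\<gamma>2 1)"
        using 3 st by (intro add_mono 1 2) auto
      finally show ?thesis unfolding c0 c1 by (simp add: algebra_simps)
    qed (use 1[of s t] 2[of s t] st c0 c1 in \<open>auto simp: c_def\<close>)
  qed
  then show ?thesis unfolding c0 c1 by (simp add: c_def[abs_def])
qed

lemma wasserstein_geodesicsI:
  assumes "\<And>t. t \<in> {0..1} \<Longrightarrow> \<Gamma> t \<in> borel_prob" "0 \<le> w"
    and W: "\<And>s t. s \<in> {0..1} \<Longrightarrow> t \<in> {0..1} \<Longrightarrow> W2 (\<Gamma> s) (\<Gamma> t) = ennreal (\<bar>s - t\<bar> * w)"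
  shows "\<Gamma> \<in> wasserstein_geodesics"
  unfolding wasserstein_geodesics_def
proof (intro CollectI conjI ballI)
  fix t :: real assume t: "t \<in> {0..1}"
  have "((\<lambda>s. \<bar>s - t\<bar> * w) \<longlongrightarrow> \<bar>t - t\<bar> * w) (at t within {0..1})"
    by (intro tendsto_intros)
  then have "((\<lambda>s. ennreal (\<bar>s - t\<bar> * w)) \<longlongrightarrow> ennreal 0) (at t within {0..1})"
    by (intro tendsto_ennrealI) simp
  moreover have "\<forall>\<^sub>F s in at t within {0..1}. W2 (\<Gamma> s) (\<Gamma> t) = ennreal (\<bar>s - t\<bar> * w)"
    unfolding eventually_at_filter using W t by (intro always_eventually) auto
  ultimately show "((\<lambda>s. W2 (\<Gamma> s) (\<Gamma> t)) \<longlongrightarrow> 0) (at t within {0..1})"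
    by (simp add: tendsto_cong)
next
  show "W2 (\<Gamma> 0) (\<Gamma> 1) < \<top>" using W[of 0 1] by simp
next
  fix s t :: real assume "s \<in> {0..1}" "t \<in> {0..1}"
  then show "W2 (\<Gamma> t) (\<Gamma> s) = ennreal \<bar>t - s\<bar> * W2 (\<Gamma> 0) (\<Gamma> 1)"
    using W[of t s] W[of 0 1] assms(2) by (simp add: ennreal_mult')
qed (use assms in auto)

lemma wasserstein_geodesics_restrict:
  assumes \<Gamma>: "\<Gamma> \<in> wasserstein_geodesics" and pr: "0 \<le> p" "p \<le> r" "r \<le> 1"
  shows "(\<lambda>u. \<Gamma> (p + u * (r - p))) \<in> wasserstein_geodesics"
proof (rule wasserstein_geodesicsI)
  have g: "\<And>t. t \<in> {0..1} \<Longrightarrow> \<Gamma> t \<in> borel_prob" "W2 (\<Gamma> 0) (\<Gamma> 1) < \<top>"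
    "\<And>s t. s \<in> {0..1} \<Longrightarrow> t \<in> {0..1} \<Longrightarrow> W2 (\<Gamma> t) (\<Gamma> s) = ennreal \<bar>t - s\<bar> * W2 (\<Gamma> 0) (\<Gamma> 1)"
    using \<Gamma> unfolding wasserstein_geodesics_def by blast+
  define w where "w = enn2real (W2 (\<Gamma> 0) (\<Gamma> 1))"
  have w: "W2 (\<Gamma> 0) (\<Gamma> 1) = ennreal w" "0 \<le> w" using g(2) by (auto simp: w_def)
  have time: "p + u * (r - p) \<in> {0..1}" if "u \<in> {0..1}" for u
  proof -
    have "u * (r - p) \<le> 1 * (r - p)" using that pr by (intro mult_right_mono) auto
    moreover have "0 \<le> u * (r - p)" using that pr by simp
    ultimately show ?thesis using pr by auto
  qed
  show "\<Gamma> (p + t * (r - p)) \<in> borel_prob" if "t \<in> {0..1}" for t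
    using g(1) time[OF that] by blast
  show "0 \<le> (r - p) * w" using pr w by simp
  fix s t :: real assume st: "s \<in> {0..1}" "t \<in> {0..1}"
  have "W2 (\<Gamma> (p + s * (r - p))) (\<Gamma> (p + t * (r - p)))
      = ennreal \<bar>(p + s * (r - p)) - (p + t * (r - p))\<bar> * ennreal w"
    using g(3)[OF time[OF st(2)] time[OF st(1)]] w(1) by simp
  also have "(p + s * (r - p)) - (p + t * (r - p)) = (s - t) * (r - p)" by (simp add: algebra_simps)
  finally show "W2 (\<Gamma> (p + s * (r - p))) (\<Gamma> (p + t * (r - p))) = ennreal (\<bar>s - t\<bar> * ((r - p) * w))"
    using pr w by (simp add: ennreal_mult'[symmetric] abs_mult mult.assoc)
qed

lemma renyi_integral_concave_along:
  assumes conv: "strongly_displacement_convex (renyi_entropy N m)"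
    and \<Gamma>: "\<Gamma> \<in> wasserstein_geodesics" and pr: "0 \<le> p" "p \<le> r" "r \<le> 1" and u: "0 \<le> u" "u \<le> 1"
  shows "ennreal (1 - u) * renyi_integral N m (\<Gamma> p) + ennreal u * renyi_integral N m (\<Gamma> r)
    \<le> renyi_integral N m (\<Gamma> (p + u * (r - p)))"
proof -
  let ?H = "\<lambda>t. renyi_integral N m (\<Gamma> t)"
  have *: "ereal c * - enn2ereal A = - enn2ereal (ennreal c * A)" if "0 \<le> c" for c A
    using that by (simp add: times_ennreal.rep_eq enn2ereal_ennreal)
  have **: "- enn2ereal A + - enn2ereal B = - enn2ereal (A + B)" for A B
    by (cases A; cases B) (auto simp: plus_ennreal.rep_eq enn2ereal_ennreal)
  have "renyi_entropy N m (\<Gamma> (p + u * (r - p)))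
      \<le> ereal (1 - u) * renyi_entropy N m (\<Gamma> (p + 0 * (r - p))) + ereal u * renyi_entropy N m (\<Gamma> (p + 1 * (r - p)))"
    using conv wasserstein_geodesics_restrict[OF \<Gamma> pr] u
    unfolding strongly_displacement_convex_def by (metis (no_types, lifting) atLeastAtMost_iff)
  then have "- enn2ereal (?H (p + u * (r - p))) \<le> - enn2ereal (ennreal (1 - u) * ?H p + ennreal u * ?H r)"
    using u unfolding renyi_entropy_eq by (simp only: * ** diff_ge_0_iff_ge mult_zero_left add_0_right mult_1 add_diff_cancel_left' diff_add_cancel add.commute[of p])
  then show ?thesis by (simp only: ereal_minus_le_minus less_eq_ennreal.rep_eq)
qed

text \<open>
  Moving each particle from time \<open>s\<close> to time \<open>t\<close> gives the upper bound for the cost. For the lower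
  bound, every coupling of the two laws satisfies
  \<open>dist p q \<ge> \<bar>dist p x - dist q x\<bar>\<close>; after squaring, the cross term is controlled by the Cauchy-Schwarz
  inequality, and the resulting bound \<open>(s - t)\<^sup>2 K\<close>, where \<open>K\<close> is the mean square distance from \<open>x\<close> at time
  \<open>0\<close>, agrees with the upper one.
\<close>

lemma flow_wasserstein_geodesic:
  fixes T :: "real \<Rightarrow> 'b \<Rightarrow> 'a::metric_space" and M :: "'b measure"
  assumes D: "countable D" "closure D = (UNIV :: 'a set)" and M: "prob_space M"
    and meas: "\<And>s. s \<in> {0..1} \<Longrightarrow> T s \<in> borel_measurable M"
    and geo: "\<And>w. w \<in> space M \<Longrightarrow> geodesic_between (\<lambda>s. T s w) (T 0 w) x"
    and bdd: "\<And>w. w \<in> space M \<Longrightarrow> dist (T 0 w) x \<le> R"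
  shows "(\<lambda>s. distr M borel (T s)) \<in> wasserstein_geodesics"
proof -
  interpret prob_space M by fact
  define \<Gamma> where "\<Gamma> s = distr M borel (T s)" for s
  define d where "d w = dist (T 0 w) x" for w
  have cont_m [measurable]: "(\<lambda>p::'a. dist p x) \<in> borel_measurable borel"
    by (intro borel_measurable_continuous_onI continuous_intros)
  have [measurable]: "T 0 \<in> borel_measurable M" using meas by simp
  have d_meas [measurable]: "d \<in> borel_measurable M"
    unfolding d_def by measurable
  have dist_T: "dist (T s w) (T t w) = \<bar>s - t\<bar> * d w" if "s \<in> {0..1}" "t \<in> {0..1}" "w \<in> space M" for s t w
    using geodesic_betweenD[OF geo[OF that(3)] that(1,2)] by (simp add: d_def)
  have T1: "T 1 w = x" if "w \<in> space M" for w
    using geo[OF that] by (simp add: geodesic_between_def)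
  define K where "K = enn2real (\<integral>\<^sup>+w. ennreal ((d w)\<^sup>2) \<partial>M)"
  have "(\<integral>\<^sup>+w. ennreal ((d w)\<^sup>2) \<partial>M) \<le> (\<integral>\<^sup>+w. ennreal (R\<^sup>2) \<partial>M)"
    using bdd by (intro nn_integral_mono ennreal_leI power_mono) (auto simp: d_def)
  also have "\<dots> < \<top>" by (simp add: emeasure_space_1)
  finally have K: "(\<integral>\<^sup>+w. ennreal ((d w)\<^sup>2) \<partial>M) = ennreal K" "0 \<le> K"
    unfolding K_def by auto
  have K_scale: "(\<integral>\<^sup>+w. ennreal ((c * d w)\<^sup>2) \<partial>M) = ennreal (c\<^sup>2 * K)" for c
    using K by (simp add: power_mult_distrib ennreal_mult' nn_integral_cmult)
  have \<Gamma>: "\<Gamma> t \<in> borel_prob" if "t \<in> {0..1}" for t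
    unfolding borel_prob_def \<Gamma>_def using meas[OF that] by (auto intro: prob_space_distr)
  have cost: "transport_cost (\<Gamma> s) (\<Gamma> t) = ennreal ((s - t)\<^sup>2 * K)" if st: "s \<in> {0..1}" "t \<in> {0..1}" for s t
  proof (rule antisym)
    note ms [measurable] = meas[OF st(1)] meas[OF st(2)]
    define \<sigma> where "\<sigma> = distr M borel (\<lambda>w. (T s w, T t w))"
    have P [measurable]: "(\<lambda>w. (T s w, T t w)) \<in> borel_measurable M"
      by (rule borel_measurable_Pair_separable[OF D ms])
    have "distr \<sigma> borel fst = \<Gamma> s" "distr \<sigma> borel snd = \<Gamma> t"
      unfolding \<sigma>_def \<Gamma>_def using P
      by (subst distr_distr; auto simp: o_def intro!: borel_measurable_continuous_onI continuous_intros)+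
    moreover have "\<sigma> \<in> borel_prob"
      unfolding borel_prob_def \<sigma>_def by (auto intro: prob_space_distr)
    ultimately have "\<sigma> \<in> couplings (\<Gamma> s) (\<Gamma> t)" by (simp add: couplings_def)
    then have "transport_cost (\<Gamma> s) (\<Gamma> t) \<le> (\<integral>\<^sup>+ p. ennreal ((dist (fst p) (snd p))\<^sup>2) \<partial>\<sigma>)"
      unfolding transport_cost_def by (rule INF_lower)
    also have "\<dots> = (\<integral>\<^sup>+w. ennreal ((dist (T s w) (T t w))\<^sup>2) \<partial>M)"
      unfolding \<sigma>_def
      by (subst nn_integral_distr) (auto intro!: borel_measurable_continuous_onI continuous_intros)
    also have "\<dots> = (\<integral>\<^sup>+w. ennreal (((s - t) * d w)\<^sup>2) \<partial>M)"
      using dist_T[OF st] by (intro nn_integral_cong) (simp add: power_mult_distrib)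
    finally show "transport_cost (\<Gamma> s) (\<Gamma> t) \<le> ennreal ((s - t)\<^sup>2 * K)" by (simp add: K_scale)
  next
    show "ennreal ((s - t)\<^sup>2 * K) \<le> transport_cost (\<Gamma> s) (\<Gamma> t)"
      unfolding transport_cost_def
    proof (rule INF_greatest)
      fix \<sigma> assume "\<sigma> \<in> couplings (\<Gamma> s) (\<Gamma> t)"
      then have \<sigma>: "sets \<sigma> = sets borel" "distr \<sigma> borel fst = \<Gamma> s" "distr \<sigma> borel snd = \<Gamma> t"
        by (auto simp: couplings_def borel_prob_def)
      have meas_cont: "f \<in> borel_measurable \<sigma>" if "continuous_on UNIV f" for f :: "'a \<times> 'a \<Rightarrow> 'c::topological_space"
        using borel_measurable_continuous_onI[OF that] measurable_cong_sets[OF \<sigma>(1) refl] by blast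
      have [measurable]: "fst \<in> borel_measurable \<sigma>" "snd \<in> borel_measurable \<sigma>"
        by (auto intro!: meas_cont continuous_intros)
      define u where "u p = dist (fst p) x" for p :: "'a \<times> 'a"
      define v where "v p = dist (snd p) x" for p :: "'a \<times> 'a"
      define e where "e p = dist (fst p) (snd p)" for p :: "'a \<times> 'a"
      have [measurable]: "u \<in> borel_measurable \<sigma>" "v \<in> borel_measurable \<sigma>" "e \<in> borel_measurable \<sigma>"
        unfolding u_def v_def e_def by (auto intro!: meas_cont continuous_intros)
      have marg: "(\<integral>\<^sup>+p. ennreal ((dist p x)\<^sup>2) \<partial>\<Gamma> r) = ennreal ((1 - r)\<^sup>2 * K)" if r: "r \<in> {0..1}" for r
      proof -
        have [measurable]: "T r \<in> borel_measurable M" using meas r by simp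
        have "(\<integral>\<^sup>+p. ennreal ((dist p x)\<^sup>2) \<partial>\<Gamma> r) = (\<integral>\<^sup>+w. ennreal ((dist (T r w) x)\<^sup>2) \<partial>M)"
          unfolding \<Gamma>_def by (subst nn_integral_distr) auto
        also have "\<dots> = (\<integral>\<^sup>+w. ennreal (((1 - r) * d w)\<^sup>2) \<partial>M)"
          using dist_T[OF r, of 1] T1 by (intro nn_integral_cong) (simp add: power_mult_distrib power2_commute)
        finally show ?thesis by (simp add: K_scale)
      qed
      have A: "(\<integral>\<^sup>+p. ennreal (u p) ^ 2 \<partial>\<sigma>) = ennreal ((1 - s)\<^sup>2 * K)"
        using marg[OF st(1)] \<sigma>(2)[symmetric] by (simp add: nn_integral_distr u_def ennreal_power)
      have B: "(\<integral>\<^sup>+p. ennreal (v p) ^ 2 \<partial>\<sigma>) = ennreal ((1 - t)\<^sup>2 * K)"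
        using marg[OF st(2)] \<sigma>(3)[symmetric] by (simp add: nn_integral_distr v_def ennreal_power)
      \<comment> \<open>The marginals of \<open>\<sigma>\<close> determine the integrals of \<open>u\<^sup>2\<close> and \<open>v\<^sup>2\<close>; only \<open>P\<close> depends on \<open>\<sigma>\<close>.\<close>
      define P where "P = (\<integral>\<^sup>+p. ennreal (u p) * ennreal (v p) \<partial>\<sigma>)"
      have "P\<^sup>2 \<le> ennreal ((1 - s)\<^sup>2 * K) * ennreal ((1 - t)\<^sup>2 * K)"
        unfolding P_def A[symmetric] B[symmetric] by (intro Cauchy_Schwarz_nn_integral) auto
      also have "\<dots> = (ennreal ((1 - s) * (1 - t) * K))\<^sup>2"
        using K st by (simp add: ennreal_mult'[symmetric] ennreal_power power2_eq_square ac_simps)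
      finally have P2: "P\<^sup>2 \<le> (ennreal ((1 - s) * (1 - t) * K))\<^sup>2" .
      have nn: "0 \<le> (1 - s) * (1 - t) * K" using K(2) st by simp
      have P: "P \<le> ennreal ((1 - s) * (1 - t) * K)"
      proof (cases P)
        case (real p)
        then have "p\<^sup>2 \<le> ((1 - s) * (1 - t) * K)\<^sup>2"
          using P2 nn by (simp add: ennreal_power del: ennreal_mult')
        then have "p \<le> (1 - s) * (1 - t) * K" using nn by (rule power2_le_imp_le)
        then show ?thesis using real by (simp add: ennreal_leI)
      qed (use P2 nn in \<open>simp add: ennreal_power top_unique\<close>)
      define J where "J = (\<integral>\<^sup>+p. ennreal ((e p)\<^sup>2) \<partial>\<sigma>)"
      have "(\<integral>\<^sup>+p. ennreal (u p) ^ 2 + ennreal (v p) ^ 2 \<partial>\<sigma>)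
          \<le> (\<integral>\<^sup>+p. ennreal ((e p)\<^sup>2) + 2 * (ennreal (u p) * ennreal (v p)) \<partial>\<sigma>)"
      proof (rule nn_integral_mono)
        fix p :: "'a \<times> 'a"
        have "\<bar>u p - v p\<bar> \<le> \<bar>e p\<bar>" unfolding u_def v_def e_def
          using abs_dist_diff_le[of "fst p" x "snd p"] by (simp add: dist_commute[of x])
        then have "(u p - v p)\<^sup>2 \<le> (e p)\<^sup>2" by (simp add: abs_le_square_iff)
        then have "(u p)\<^sup>2 + (v p)\<^sup>2 \<le> (e p)\<^sup>2 + 2 * (u p * v p)" by (simp add: power2_diff algebra_simps)
        then have "ennreal ((u p)\<^sup>2 + (v p)\<^sup>2) \<le> ennreal ((e p)\<^sup>2 + 2 * (u p * v p))" by (rule ennreal_leI)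
        moreover have "0 \<le> u p" "0 \<le> v p" by (auto simp: u_def v_def)
        ultimately show "ennreal (u p) ^ 2 + ennreal (v p) ^ 2 \<le> ennreal ((e p)\<^sup>2) + 2 * (ennreal (u p) * ennreal (v p))"
          by (simp add: ennreal_power ennreal_mult')
      qed
      then have ineq: "ennreal ((1 - s)\<^sup>2 * K) + ennreal ((1 - t)\<^sup>2 * K) \<le> J + 2 * P"
        unfolding J_def P_def A[symmetric] B[symmetric] by (simp add: nn_integral_add nn_integral_cmult)
      also have "\<dots> \<le> J + 2 * ennreal ((1 - s) * (1 - t) * K)"
        using P by (intro add_left_mono mult_left_mono) auto
      finally have fin: "ennreal ((1 - s)\<^sup>2 * K + (1 - t)\<^sup>2 * K) \<le> J + ennreal (2 * ((1 - s) * (1 - t) * K))"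
        using K(2) by (simp add: ennreal_mult' ennreal_plus)
      show "ennreal ((s - t)\<^sup>2 * K) \<le> (\<integral>\<^sup>+ p. ennreal ((dist (fst p) (snd p))\<^sup>2) \<partial>\<sigma>)"
      proof (cases J)
        case (real j)
        have nn: "0 \<le> 2 * ((1 - s) * (1 - t) * K)" using nn by simp
        from fin have "(1 - s)\<^sup>2 * K + (1 - t)\<^sup>2 * K \<le> j + 2 * ((1 - s) * (1 - t) * K)"
          using real nn by (simp add: ennreal_plus[symmetric] del: ennreal_plus)
        then have "(s - t)\<^sup>2 * K \<le> j" by (simp add: power2_eq_square algebra_simps)
        then show ?thesis using real by (auto simp: J_def e_def intro: ennreal_leI)
      qed (simp add: J_def e_def)
    qed
  qed
  have W: "W2 (\<Gamma> s) (\<Gamma> t) = ennreal (\<bar>s - t\<bar> * sqrt K)" if "s \<in> {0..1}" "t \<in> {0..1}" for s t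
    using cost[OF that] K(2) by (simp add: W2_def real_sqrt_mult)
  have "\<Gamma> \<in> wasserstein_geodesics"
    by (rule wasserstein_geodesicsI[OF \<Gamma> _ W]) (simp_all add: K(2))
  then show ?thesis by (simp add: \<Gamma>_def[abs_def])
qed

section \<open>Geodesics coded by rational times\<close>

text \<open>
  Countably many times make the space of codes a countable power of the original space, hence metrizable and separable;
  the conditions on a code are closed. By completeness a code determines a geodesic.
\<close>

definition rat_geodesic_to :: "'a::metric_space \<Rightarrow> (rat \<Rightarrow> 'a) \<Rightarrow> bool" where
  "rat_geodesic_to x g \<longleftrightarrow> g 1 = x \<and>
     (\<forall>r\<in>{0..1}. \<forall>r'\<in>{0..1}. dist (g r) (g r') = \<bar>of_rat r - of_rat r'\<bar> * dist (g 0) (g 1))"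

definition dyadic_below :: "nat \<Rightarrow> real \<Rightarrow> rat" where
  "dyadic_below n t = of_int \<lfloor>t * 2 ^ n\<rfloor> / 2 ^ n"

text \<open>
  The dyadic times \<open>dyadic_below n t\<close> depend on \<open>n\<close> and \<open>t\<close> only, so that the extension is a pointwise
  limit of coordinates and inherits their measurability.
\<close>

definition extend_rat :: "(rat \<Rightarrow> 'a::metric_space) \<Rightarrow> real \<Rightarrow> 'a" where
  "extend_rat g t = lim (\<lambda>n. g (dyadic_below n t))"

lemma of_rat_dyadic_below: "real_of_rat (dyadic_below n t) = of_int \<lfloor>t * 2 ^ n\<rfloor> / 2 ^ n"
  by (simp add: dyadic_below_def of_rat_divide of_rat_power)

lemma dyadic_below_bounds:
  assumes "t \<in> {0..1}"
  shows "dyadic_below n t \<in> {0..1}" "\<bar>of_rat (dyadic_below n t) - t\<bar> \<le> (1/2) ^ n"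
proof -
  have "of_int \<lfloor>t * 2 ^ n\<rfloor> \<le> t * 2 ^ n" "t * 2 ^ n \<le> of_int \<lfloor>t * 2 ^ n\<rfloor> + 1" by linarith+
  then have le: "real_of_rat (dyadic_below n t) \<le> t" "t \<le> of_rat (dyadic_below n t) + (1/2)^n"
    unfolding of_rat_dyadic_below by (simp_all add: field_simps)
  then show "\<bar>of_rat (dyadic_below n t) - t\<bar> \<le> (1/2) ^ n" by simp
  have "0 \<le> \<lfloor>t * 2 ^ n\<rfloor>" using assms by simp
  then have "0 \<le> dyadic_below n t" by (simp add: dyadic_below_def)
  moreover have "t \<le> 1" using assms by simp
  with le(1) have "real_of_rat (dyadic_below n t) \<le> 1" by (rule order_trans)
  then have "dyadic_below n t \<le> 1" by simp
  ultimately show "dyadic_below n t \<in> {0..1}" by simp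
qed

lemma tendsto_dyadic_below:
  assumes "t \<in> {0..1}"
  shows "(\<lambda>n. real_of_rat (dyadic_below n t)) \<longlonglongrightarrow> t"
proof (rule LIM_zero_cancel, rule Lim_null_comparison)
  show "\<forall>\<^sub>F n in sequentially. norm (real_of_rat (dyadic_below n t) - t) \<le> (1/2) ^ n"
    using dyadic_below_bounds(2)[OF assms] by simp
  show "(\<lambda>n. (1/2::real) ^ n) \<longlonglongrightarrow> 0" by (rule LIMSEQ_power_zero) simp
qed

lemma extend_rat_tendsto:
  fixes g :: "rat \<Rightarrow> 'a::complete_space"
  assumes g: "rat_geodesic_to x g" and t: "t \<in> {0..1}"
  shows "(\<lambda>n. g (dyadic_below n t)) \<longlonglongrightarrow> extend_rat g t"
proof -
  let ?l = "dist (g 0) (g 1)"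
  have "Cauchy (\<lambda>n. g (dyadic_below n t))"
  proof (rule metric_CauchyI)
    fix e :: real assume "0 < e"
    have "Cauchy (\<lambda>n. real_of_rat (dyadic_below n t))"
      using tendsto_dyadic_below[OF t] by (rule LIMSEQ_imp_Cauchy)
    then obtain n0 where n0: "\<And>m n. m \<ge> n0 \<Longrightarrow> n \<ge> n0 \<Longrightarrow>
        dist (real_of_rat (dyadic_below m t)) (of_rat (dyadic_below n t)) < e / (?l + 1)"
      using metric_CauchyD[of _ "e / (?l + 1)"] \<open>0 < e\<close> by (metis add_nonneg_pos divide_pos_pos zero_le_dist zero_less_one)
    have "dist (g (dyadic_below m t)) (g (dyadic_below n t)) < e" if "m \<ge> n0" "n \<ge> n0" for m n
    proof -
      have "dist (g (dyadic_below m t)) (g (dyadic_below n t))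
          = dist (real_of_rat (dyadic_below m t)) (of_rat (dyadic_below n t)) * ?l"
        using g dyadic_below_bounds(1)[OF t] unfolding rat_geodesic_to_def dist_real_def by blast
      also have "\<dots> \<le> dist (real_of_rat (dyadic_below m t)) (of_rat (dyadic_below n t)) * (?l + 1)"
        by (intro mult_left_mono) auto
      also have "\<dots> < e / (?l + 1) * (?l + 1)"
        using n0[OF that] by (intro mult_strict_right_mono) (auto simp: add_nonneg_pos)
      also have "\<dots> = e" by (simp add: add_nonneg_eq_0_iff)
      finally show ?thesis .
    qed
    then show "\<exists>M. \<forall>m\<ge>M. \<forall>n\<ge>M. dist (g (dyadic_below m t)) (g (dyadic_below n t)) < e" by blast
  qed
  then have "convergent (\<lambda>n. g (dyadic_below n t))" by (rule Cauchy_convergent)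
  then show ?thesis unfolding extend_rat_def by (simp add: convergent_LIMSEQ_iff)
qed

lemma extend_rat_geodesic:
  fixes g :: "rat \<Rightarrow> 'a::complete_space"
  assumes g: "rat_geodesic_to x g"
  shows extend_rat_of_rat: "\<And>r. r \<in> {0..1} \<Longrightarrow> extend_rat g (of_rat r) = g r"
    and geodesic_between_extend_rat: "geodesic_between (extend_rat g) (g 0) x"
proof -
  let ?l = "dist (g 0) (g 1)"
  have d: "dist (extend_rat g s) (extend_rat g t) = \<bar>s - t\<bar> * ?l" if "s \<in> {0..1}" "t \<in> {0..1}" for s t
  proof (rule LIMSEQ_unique)
    show "(\<lambda>n. dist (g (dyadic_below n s)) (g (dyadic_below n t))) \<longlonglongrightarrow> dist (extend_rat g s) (extend_rat g t)"
      using extend_rat_tendsto[OF g] that by (intro tendsto_dist)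
    have eq: "dist (g (dyadic_below n s)) (g (dyadic_below n t)) = \<bar>real_of_rat (dyadic_below n s) - of_rat (dyadic_below n t)\<bar> * ?l" for n
      using g dyadic_below_bounds(1)[OF that(1)] dyadic_below_bounds(1)[OF that(2)] unfolding rat_geodesic_to_def by blast
    show "(\<lambda>n. dist (g (dyadic_below n s)) (g (dyadic_below n t))) \<longlonglongrightarrow> \<bar>s - t\<bar> * ?l"
      unfolding eq using tendsto_dyadic_below that by (intro tendsto_intros)
  qed
  show r: "extend_rat g (of_rat r) = g r" if "r \<in> {0..1}" for r
  proof (rule LIMSEQ_unique)
    have rr: "real_of_rat r \<in> {0..1}" using that by simp
    show "(\<lambda>n. g (dyadic_below n (of_rat r))) \<longlonglongrightarrow> extend_rat g (of_rat r)"
      by (rule extend_rat_tendsto[OF g rr])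
    have eq: "dist (g (dyadic_below n (of_rat r))) (g r) = \<bar>real_of_rat (dyadic_below n (of_rat r)) - of_rat r\<bar> * ?l" for n
      using g dyadic_below_bounds(1)[OF rr] that unfolding rat_geodesic_to_def by blast
    have lim: "(\<lambda>n. \<bar>real_of_rat (dyadic_below n (of_rat r)) - of_rat r\<bar> * ?l) \<longlonglongrightarrow> \<bar>of_rat r - of_rat r\<bar> * ?l"
      using tendsto_dyadic_below[OF rr] by (intro tendsto_intros)
    show "(\<lambda>n. g (dyadic_below n (of_rat r))) \<longlonglongrightarrow> g r"
      by (rule tendsto_dist_iff[THEN iffD2]) (use lim in \<open>simp add: eq\<close>)
  qed
  have e0: "extend_rat g 0 = g 0" "extend_rat g 1 = g 1" using r[of 0] r[of 1] by simp_all
  have "geodesic_between (extend_rat g) (extend_rat g 0) (extend_rat g 1)"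
  proof (rule geodesic_betweenI)
    fix s t :: real assume "0 \<le> s" "s \<le> t" "t \<le> 1"
    then show "dist (extend_rat g s) (extend_rat g t) \<le> (t - s) * dist (extend_rat g 0) (extend_rat g 1)"
      unfolding e0 using d[of s t] by simp
  qed
  then show "geodesic_between (extend_rat g) (g 0) x"
    using g by (simp add: e0 rat_geodesic_to_def)
qed

lemma rat_geodesic_to_of_geodesic:
  assumes "geodesic_between \<gamma> y x"
  shows "rat_geodesic_to x (\<lambda>r. \<gamma> (of_rat r))"
  using assms geodesic_betweenD[OF assms] unfolding rat_geodesic_to_def geodesic_between_def
  by (auto simp del: of_rat_less_eq)

text \<open>
  A code carries two geodesics, indexed by a Boolean; arguments about a single geodesic use the one with
  index \<open>True\<close>.
\<close>

type_synonym 'a geodesic_code = "bool \<times> rat \<Rightarrow> 'a"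

definition code_pair_to :: "'a::metric_space \<Rightarrow> 'a geodesic_code \<Rightarrow> bool" where
  "code_pair_to x g \<longleftrightarrow> (\<forall>i. rat_geodesic_to x (\<lambda>r. g (i, r)))"

lemma code_pair_to_of_geodesics:
  assumes "geodesic_between \<gamma>1 y1 x" "geodesic_between \<gamma>2 y2 x"
  shows "code_pair_to x (\<lambda>(i, r). if i then \<gamma>1 (of_rat r) else \<gamma>2 (of_rat r))"
  unfolding code_pair_to_def
proof
  fix i
  show "rat_geodesic_to x (\<lambda>r. case (i, r) of (i, r) \<Rightarrow> if i then \<gamma>1 (of_rat r) else \<gamma>2 (of_rat r))"
    using assms by (cases i) (simp_all add: rat_geodesic_to_of_geodesic)
qed

lemma continuous_on_code_coordinate [continuous_intros]:
  "continuous_on UNIV (\<lambda>p::'a::metric_space \<times> 'a geodesic_code. snd p j)"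
  by (rule continuous_on_product_then_coordinatewise) (intro continuous_intros)

lemma closed_code_pair_to: "closed {p::'a::metric_space \<times> 'a geodesic_code. code_pair_to x (snd p)}"
  unfolding code_pair_to_def rat_geodesic_to_def Ball_def
  by (intro closed_Collect_all closed_Collect_conj closed_Collect_imp open_Collect_const closed_Collect_eq continuous_intros)

lemma closed_code_conditions:
  shows closed_code_eq_fst: "closed {p::'a::metric_space \<times> 'a geodesic_code. snd p j = fst p}"
    and closed_code_eq: "closed {p::'a::metric_space \<times> 'a geodesic_code. snd p j = snd p k}"
    and closed_code_cball: "closed {p::'a::metric_space \<times> 'a geodesic_code. dist (snd p j) q \<le> c}"
    and closed_code_mem: "closed F \<Longrightarrow> closed {p::'a::metric_space \<times> 'a geodesic_code. snd p j \<in> F}"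
proof -
  note continuous_on_code_coordinate[continuous_intros]
  show "closed {p::'a \<times> 'a geodesic_code. snd p j = fst p}"
    "closed {p::'a \<times> 'a geodesic_code. snd p j = snd p k}"
    by (intro closed_Collect_eq continuous_intros)+
  show "closed {p::'a \<times> 'a geodesic_code. dist (snd p j) q \<le> c}"
    by (intro closed_Collect_le continuous_intros)
  assume "closed F"
  then have "closed ((\<lambda>p::'a \<times> 'a geodesic_code. snd p j) -` F)"
    using continuous_closed_preimage[OF continuous_on_code_coordinate[of j], of F] by simp
  then show "closed {p::'a \<times> 'a geodesic_code. snd p j \<in> F}" by (simp add: vimage_def)
qed

section \<open>Measurable flows of geodesics to a point\<close>

text \<open>
  The target \<open>x\<close> is a parameter of the locale because the proof of finiteness on bounded sets uses
  contraction towards all points (\<open>contraction_to\<close>). The countable dense set \<open>D\<close> stands for separability.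
\<close>

locale geodesic_flow_space =
  fixes m :: "'a::complete_space measure" and N :: real and x :: 'a and D :: "'a set"
  assumes sigma_fin: "sigma_finite_measure m" and sets_m [measurable_cong]: "sets m = sets borel"
    and N: "1 \<le> N" and conv: "strongly_displacement_convex (renyi_entropy N m)"
    and D: "countable D" "closure D = UNIV"
    and ex_geodesic: "\<And>y z :: 'a. \<exists>\<gamma>. geodesic_between \<gamma> y z"
    and nonzero: "emeasure m UNIV \<noteq> 0"
begin

lemma space_m [simp]: "space m = UNIV"
  using sets_eq_imp_space_eq[OF sets_m] by simp

text \<open>
  Outside \<open>C\<close> a flow rests at the target; this keeps it measurable and bounded on the whole space.
\<close>

definition flow_on :: "'a set \<Rightarrow> (real \<Rightarrow> 'a \<Rightarrow> 'a) \<Rightarrow> bool" where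
  "flow_on C T \<longleftrightarrow> (\<forall>s\<in>{0..1}. T s \<in> borel_measurable borel) \<and>
     (\<forall>w. geodesic_between (\<lambda>s. T s w) (T 0 w) x) \<and> (\<forall>w. w \<notin> C \<longrightarrow> T 0 w = x)"

definition flow_pair_in :: "('a \<times> 'a geodesic_code) set \<Rightarrow> 'a set \<Rightarrow> (bool \<Rightarrow> real \<Rightarrow> 'a \<Rightarrow> 'a) \<Rightarrow> bool" where
  "flow_pair_in E C T \<longleftrightarrow> (\<forall>i. flow_on C (T i)) \<and>
     (\<forall>w\<in>C. \<exists>g. (w, g) \<in> E \<and> (\<forall>i. \<forall>r\<in>{0..1}. T i (of_rat r) w = g (i, r)))"

lemma flow_pair_inD:
  assumes "flow_pair_in E C T" "w \<in> C"
  shows "\<exists>g. (w, g) \<in> E \<and> (\<forall>i r. r \<in> {0..1} \<longrightarrow> T i (of_rat r) w = g (i, r))"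
  using assms unfolding flow_pair_in_def by blast

lemma flow_pair_geodesic:
  assumes "flow_pair_in E C T"
  shows "geodesic_between (\<lambda>s. T i s w) (T i 0 w) x"
  using assms by (simp add: flow_pair_in_def flow_on_def)

text \<open>
  The selection theorem on a set \<open>S\<close> of finite measure, with the selected codes extended from
  rational to real times.
\<close>

lemma flow_selection:
  fixes E :: "('a \<times> 'a geodesic_code) set"
  assumes E: "closed E" "\<forall>p\<in>E. code_pair_to x (snd p)"
    and S: "S \<in> sets borel" "emeasure m S < \<top>" and e: "0 < e"
  shows "\<exists>C T. C \<in> sets borel \<and> C \<subseteq> S \<inter> fst ` E \<and>
    outer_measure_of m (S \<inter> fst ` E) \<le> emeasure m C + ennreal e \<and> flow_pair_in E C T"
proof -
  define \<mu> where "\<mu> = density m (indicator S)"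
  have S' [measurable]: "S \<in> sets m" using S(1) sets_m by simp
  have e\<mu>: "emeasure \<mu> A = emeasure m (A \<inter> S)" if "A \<in> sets borel" for A
    unfolding \<mu>_def by (rule emeasure_density_indicator_set[OF S']) (simp add: sets_m that)
  have sets\<mu>: "sets \<mu> = sets borel" using sets_m by (simp add: \<mu>_def)
  have sp: "space \<mu> = UNIV" by (simp add: \<mu>_def)
  have fin: "finite_measure \<mu>"
    by (rule finite_measureI) (use S in \<open>simp add: e\<mu> sp\<close>)
  obtain Q :: "'a geodesic_code set" where Q: "countable Q" "closure Q = UNIV"
    using separable_fun[OF D] by blast
  obtain K where K: "compact K"
      "outer_measure_of \<mu> (fst ` E) \<le> emeasure \<mu> (fst ` (E \<inter> UNIV \<times> K)) + ennreal e"
    using closed_projection_compact_approx[OF E(1) Q fin sets\<mu> e] .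
  obtain f where f: "f \<in> borel_measurable borel" "\<And>w. w \<in> fst ` (E \<inter> UNIV \<times> K) \<Longrightarrow> (w, f w) \<in> E"
    using compact_sections_measurable_selection[OF E(1) K(1) Q] by blast
  define C where "C = S \<inter> fst ` (E \<inter> UNIV \<times> K)"
  have clo: "fst ` (E \<inter> UNIV \<times> K) \<in> sets borel"
    using closed_projection_compact[OF E(1) K(1)] by simp
  have C: "C \<in> sets borel" unfolding C_def using clo S(1) by simp
  have "outer_measure_of m (S \<inter> fst ` E) \<le> outer_measure_of \<mu> (fst ` E)"
  proof -
    obtain A where A: "A \<in> sets \<mu>" "fst ` E \<subseteq> A" "outer_measure_of \<mu> (fst ` E) = emeasure \<mu> A"
      using outer_measure_of_attain[of "fst ` E" \<mu>] sp by auto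
    have "outer_measure_of m (S \<inter> fst ` E) \<le> outer_measure_of m (A \<inter> S)"
      using A(2) by (intro outer_measure_of_mono) auto
    also have "\<dots> = emeasure \<mu> A" using A(1) sets\<mu> sets_m e\<mu> S(1) by (subst outer_measure_of_eq) auto
    finally show ?thesis using A(3) by simp
  qed
  also note K(2)
  also have "emeasure \<mu> (fst ` (E \<inter> UNIV \<times> K)) = emeasure m C"
    using e\<mu>[OF clo] by (simp add: C_def Int_commute)
  finally have outer: "outer_measure_of m (S \<inter> fst ` E) \<le> emeasure m C + ennreal e" .
  define f' where "f' w = (if w \<in> C then f w else (\<lambda>_. x))" for w
  have code: "code_pair_to x (f' w)" for w
  proof (cases "w \<in> C")
    case True
    then have "(w, f w) \<in> E" using f(2) by (simp add: C_def)
    then show ?thesis using E(2) True by (force simp: f'_def)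
  next
    case False
    then show ?thesis by (simp add: f'_def code_pair_to_def rat_geodesic_to_def)
  qed
  then have rg: "rat_geodesic_to x (\<lambda>r. f' w (i, r))" for w i by (simp add: code_pair_to_def)
  have f'_meas: "(\<lambda>w. f' w j) \<in> borel_measurable borel" for j
  proof -
    have "(\<lambda>g::'a geodesic_code. g j) \<in> borel_measurable borel"
      by (intro borel_measurable_continuous_onI) simp
    from measurable_compose[OF f(1) this] have "(\<lambda>w. f w j) \<in> borel_measurable borel" .
    then have "(\<lambda>w. if w \<in> C then f w j else x) \<in> borel_measurable borel"
      using C by (intro measurable_If_set) auto
    moreover have "(\<lambda>w. f' w j) = (\<lambda>w. if w \<in> C then f w j else x)" by (auto simp: f'_def)
    ultimately show ?thesis by simp
  qed
  define T where "T i s w = extend_rat (\<lambda>r. f' w (i, r)) s" for i s w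
  have T_rat: "T i (of_rat r) w = f' w (i, r)" if "r \<in> {0..1}" for i r w
    unfolding T_def by (rule extend_rat_of_rat[OF rg that])
  have "flow_on C (T i)" for i
    unfolding flow_on_def
  proof (intro conjI ballI allI impI)
    fix s :: real assume s: "s \<in> {0..1}"
    show "T i s \<in> borel_measurable borel"
      unfolding T_def
      by (rule borel_measurable_LIMSEQ_metric[OF f'_meas extend_rat_tendsto[OF rg s]])
  next
    fix w
    have T0: "T i 0 w = f' w (i, 0)" using T_rat[of 0 i w] by simp
    show "geodesic_between (\<lambda>s. T i s w) (T i 0 w) x"
      using geodesic_between_extend_rat[OF rg[of w i]] unfolding T0 by (simp add: T_def[abs_def])
    show "T i 0 w = x" if "w \<notin> C" using that T0 by (simp add: f'_def)
  qed
  moreover have "\<exists>g. (w, g) \<in> E \<and> (\<forall>i. \<forall>r\<in>{0..1}. T i (of_rat r) w = g (i, r))" if "w \<in> C" for w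
    using that f(2)[of w] T_rat by (intro exI[of _ "f w"]) (auto simp: C_def f'_def)
  ultimately have "flow_pair_in E C T" unfolding flow_pair_in_def by blast
  moreover have "C \<subseteq> S \<inter> fst ` E" unfolding C_def by blast
  ultimately show ?thesis using C outer by blast
qed

lemma incseq_bounded_finite_cover:
  obtains B :: "nat \<Rightarrow> 'a set" where "incseq B" "\<And>n. B n \<in> sets borel" "\<And>n. B n \<subseteq> cball x (real n)"
    "\<And>n. emeasure m (B n) < \<top>" "(\<Union>n. B n) = UNIV"
proof -
  interpret sigma_finite_measure m by (rule sigma_fin)
  obtain A :: "nat \<Rightarrow> 'a set" where A: "range A \<subseteq> sets m" "(\<Union>i. A i) = space m" "\<And>i. emeasure m (A i) \<noteq> \<infinity>" "incseq A"
    using sigma_finite_incseq by blast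
  show ?thesis
  proof (rule that[of "\<lambda>n. A n \<inter> cball x (real n)"])
    show "incseq (\<lambda>n. A n \<inter> cball x (real n))"
      using A(4) unfolding incseq_def by (auto intro: order_trans)
    show "A n \<inter> cball x (real n) \<in> sets borel" for n using A(1) sets_m by auto
    show "emeasure m (A n \<inter> cball x (real n)) < \<top>" for n
      using A(1,3) emeasure_mono[of "A n \<inter> cball x (real n)" "A n" m]
      by (auto simp: less_top[symmetric] top_unique)
    show "(\<Union>n. A n \<inter> cball x (real n)) = UNIV"
    proof (intro equalityI subsetI)
      fix w
      obtain i where "w \<in> A i" using A(2) by auto
      moreover obtain n where "dist x w \<le> real n" using real_arch_simple by blast
      ultimately have "w \<in> A (max i n) \<inter> cball x (real (max i n))"
        using incseqD[OF A(4), of i "max i n"] by auto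
      then show "w \<in> (\<Union>n. A n \<inter> cball x (real n))" by blast
    qed simp
  qed auto
qed

text \<open>
  Selections with smaller and smaller errors on the pieces of a countable cover leave out only a null set, as
  comparison with measurable hulls shows.
\<close>

lemma flow_exhaustion:
  fixes E :: "('a \<times> 'a geodesic_code) set"
  assumes E: "closed E" "\<forall>p\<in>E. code_pair_to x (snd p)"
  shows "\<exists>C T Z. (\<forall>i::nat \<times> nat. C i \<in> sets borel \<and> C i \<subseteq> cball x (real (fst i)) \<and> emeasure m (C i) < \<top> \<and>
    C i \<subseteq> fst ` E \<and> flow_pair_in E (C i) (T i)) \<and> Z \<in> null_sets m \<and> fst ` E \<subseteq> (\<Union>i. C i) \<union> Z"
proof -
  obtain B where B: "incseq B" "\<And>n. B n \<in> sets borel" "\<And>n. B n \<subseteq> cball x (real n)"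
    "\<And>n. emeasure m (B n) < \<top>" "(\<Union>n. B n) = UNIV"
    using incseq_bounded_finite_cover by blast
  let ?o = "\<lambda>n. outer_measure_of m (B n \<inter> fst ` E)"
  have "\<forall>i. \<exists>C T. C \<in> sets borel \<and> C \<subseteq> B (fst i) \<inter> fst ` E \<and>
    ?o (fst i) \<le> emeasure m C + ennreal (inverse (Suc (snd i))) \<and> flow_pair_in E C T"
    by (intro allI flow_selection[OF E B(2) B(4)]) simp
  then obtain C T where C: "\<And>i. C i \<in> sets borel" "\<And>i. C i \<subseteq> B (fst i) \<inter> fst ` E"
    "\<And>i. ?o (fst i) \<le> emeasure m (C i) + ennreal (inverse (Suc (snd i)))" "\<And>i. flow_pair_in E (C i) (T i)"
    by metis
  have "\<exists>H. H \<in> sets m \<and> B n \<inter> fst ` E \<subseteq> H \<and> ?o n = emeasure m H" for n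
    using outer_measure_of_attain[of "B n \<inter> fst ` E" m] by auto
  then obtain H where H: "\<And>n. H n \<in> sets m" "\<And>n. B n \<inter> fst ` E \<subseteq> H n" "\<And>n. ?o n = emeasure m (H n)" by metis
  have Bm: "B n \<in> sets m" and Cm: "C i \<in> sets m" for n i using B(2) C(1) sets_m by auto
  have CB: "C i \<subseteq> B (fst i)" and CE: "C i \<subseteq> fst ` E" for i using C(2)[of i] by auto
  have fin: "emeasure m (C i) < \<top>" for i
    by (rule order_le_less_trans[OF emeasure_mono[OF CB Bm] B(4)])
  have "H n - (\<Union>j. C (n, j)) \<in> null_sets m" for n
  proof (rule measure_exhausted_null[OF H(1) Cm _ fin])
    show "C (n, j) \<subseteq> H n" for j using C(2)[of "(n, j)"] H(2)[of n] by auto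
    show "emeasure m (H n) \<le> emeasure m (C (n, j)) + ennreal (inverse (Suc j))" for j
      using C(3)[of "(n, j)"] H(3)[of n] by simp
  qed
  then have "(\<Union>n. H n - (\<Union>j. C (n, j))) \<in> null_sets m" by (rule null_sets_UN)
  moreover have "fst ` E \<subseteq> (\<Union>i. C i) \<union> (\<Union>n. H n - (\<Union>j. C (n, j)))"
  proof
    fix w assume w: "w \<in> fst ` E"
    have "w \<in> (\<Union>n. B n)" by (simp add: B(5))
    then obtain n where "w \<in> B n" by (rule UN_E)
    then have "w \<in> H n" using H(2)[of n] w by blast
    then show "w \<in> (\<Union>i. C i) \<union> (\<Union>n. H n - (\<Union>j. C (n, j)))" by blast
  qed
  moreover have "C i \<subseteq> cball x (real (fst i))" for i using CB[of i] B(3)[of "fst i"] by (rule subset_trans)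
  ultimately show ?thesis using C(1,4) CE fin
    by (intro exI[of _ C] exI[of _ T] exI[of _ "\<Union>n. H n - (\<Union>j. C (n, j))"] conjI allI)
qed

lemma null_if_no_flow:
  fixes E :: "('a \<times> 'a geodesic_code) set"
  assumes E: "closed E" "\<forall>p\<in>E. code_pair_to x (snd p)"
    and no: "\<And>C T R. \<lbrakk>C \<in> sets borel; C \<subseteq> cball x R; 0 < emeasure m C; emeasure m C < \<top>; flow_pair_in E C T\<rbrakk> \<Longrightarrow> False"
  shows "\<exists>Z\<in>null_sets m. fst ` E \<subseteq> Z"
proof -
  obtain C T Z where C': "\<forall>i::nat \<times> nat. C i \<in> sets borel \<and> C i \<subseteq> cball x (real (fst i)) \<and> emeasure m (C i) < \<top> \<and>
      C i \<subseteq> fst ` E \<and> flow_pair_in E (C i) (T i)" and Z: "Z \<in> null_sets m" "fst ` E \<subseteq> (\<Union>i. C i) \<union> Z"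
    using flow_exhaustion[OF E] by (elim exE conjE)
  note C = C'[rule_format]
  have "C i \<in> null_sets m" for i
  proof (rule ccontr)
    assume "C i \<notin> null_sets m"
    then have "0 < emeasure m (C i)" using C[of i] sets_m by (auto simp: null_sets_def zero_less_iff_neq_zero)
    then show False using no[of "C i" "real (fst i)" "T i"] C[of i] by blast
  qed
  then have "(\<Union>i. C i) \<union> Z \<in> null_sets m" using Z(1) by (intro null_sets.Un null_sets_UN)
  then show ?thesis using Z(2) by blast
qed

text \<open>
  Different positions at time \<open>b\<close> lie in disjoint closed balls with centres in \<open>D\<close>, so countably
  many closed conditions cover all cases.
\<close>

lemma null_if_no_separating_flow:
  fixes E :: "('a \<times> 'a geodesic_code) set"
  assumes E: "closed E" "\<forall>p\<in>E. code_pair_to x (snd p)" and b: "b \<in> {0..1}"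
    and no: "\<And>C T R B1 B2. \<lbrakk>C \<in> sets borel; C \<subseteq> cball x R; 0 < emeasure m C; emeasure m C < \<top>; flow_pair_in E C T;
      B1 \<in> sets borel; B2 \<in> sets borel; B1 \<inter> B2 = {};
      \<And>w. w \<in> C \<Longrightarrow> T True (of_rat b) w \<in> B1; \<And>w. w \<in> C \<Longrightarrow> T False (of_rat b) w \<in> B2\<rbrakk> \<Longrightarrow> False"
  shows "\<exists>Z\<in>null_sets m. fst ` {p \<in> E. snd p (True, b) \<noteq> snd p (False, b)} \<subseteq> Z"
proof -
  define I where "I = {(p, q, n::nat). p \<in> D \<and> q \<in> D \<and> 2 / Suc n < dist p q}"
  define F where "F = (\<lambda>(p, q, n::nat). E \<inter> {z. dist (snd z (True, b)) p \<le> 1 / Suc n} \<inter>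
    {z. dist (snd z (False, b)) q \<le> 1 / Suc n})"
  have "countable I"
    by (rule countable_subset[of _ "D \<times> D \<times> UNIV"]) (auto simp: I_def D(1))
  moreover have "\<exists>Z\<in>null_sets m. fst ` F i \<subseteq> Z" if "i \<in> I" for i
  proof -
    obtain p q n where i: "i = (p, q, n)" by (cases i) auto
    have pq: "2 / Suc n < dist p q" using that by (simp add: I_def i)
    show ?thesis
    proof (rule null_if_no_flow)
      show "closed (F i)" unfolding F_def i
        by (simp del: of_nat_Suc) (intro closed_Int E(1) closed_code_cball)
      show "\<forall>z\<in>F i. code_pair_to x (snd z)" using E(2) by (auto simp: F_def i)
      fix C T R assume C: "C \<in> sets borel" "C \<subseteq> cball x R" "0 < emeasure m C" "emeasure m C < \<top>"
        and T: "flow_pair_in (F i) C T"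
      have "flow_pair_in E C T" using T unfolding flow_pair_in_def F_def i by auto
      moreover have code: "T True (of_rat b) w \<in> cball p (1 / Suc n)" "T False (of_rat b) w \<in> cball q (1 / Suc n)"
        if "w \<in> C" for w
      proof -
        obtain g where g: "(w, g) \<in> F i" "\<And>i r. r \<in> {0..1} \<Longrightarrow> T i (of_rat r) w = g (i, r)"
          using flow_pair_inD[OF T \<open>w \<in> C\<close>] by blast
        show "T True (of_rat b) w \<in> cball p (1 / Suc n)" "T False (of_rat b) w \<in> cball q (1 / Suc n)"
          using g(1) g(2)[OF b] by (auto simp: F_def i dist_commute)
      qed
      moreover have "cball p (1 / Suc n) \<inter> cball q (1 / Suc n) = {}"
        using pq by (intro disjoint_cballI) simp
      ultimately show False
        by (intro no[OF C, of T "cball p (1 / Suc n)" "cball q (1 / Suc n)"]) auto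
    qed
  qed
  ultimately obtain Z where Z: "Z \<in> null_sets m" "(\<Union>i\<in>I. fst ` F i) \<subseteq> Z"
    using null_cover_UN[of I m "\<lambda>i. fst ` F i"] by blast
  have "fst ` {p \<in> E. snd p (True, b) \<noteq> snd p (False, b)} \<subseteq> (\<Union>i\<in>I. fst ` F i)"
  proof
    fix z assume "z \<in> fst ` {p \<in> E. snd p (True, b) \<noteq> snd p (False, b)}"
    then obtain g where g: "(z, g) \<in> E" "g (True, b) \<noteq> g (False, b)" by auto
    obtain p q n where pq: "p \<in> D" "q \<in> D" "dist (g (True, b)) p \<le> 1 / Suc n" "dist (g (False, b)) q \<le> 1 / Suc n"
      "2 / Suc n < dist p q"
      using dense_separating_balls[OF D(2) g(2)] by blast
    then have "(z, g) \<in> F (p, q, n)" "(p, q, n) \<in> I" using g by (simp_all add: F_def I_def)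
    then show "z \<in> (\<Union>i\<in>I. fst ` F i)" by (force intro!: UN_I[of "(p, q, n)"])
  qed
  then show ?thesis using Z by blast
qed

lemma projection_measurable_up_to_null:
  fixes E :: "('a \<times> 'a geodesic_code) set"
  assumes E: "closed E" "\<forall>p\<in>E. code_pair_to x (snd p)"
  shows "\<exists>V Z. V \<in> sets borel \<and> V \<subseteq> fst ` E \<and> Z \<in> null_sets m \<and> fst ` E \<subseteq> V \<union> Z"
proof -
  obtain C T Z where C': "\<forall>i::nat \<times> nat. C i \<in> sets borel \<and> C i \<subseteq> cball x (real (fst i)) \<and> emeasure m (C i) < \<top> \<and>
      C i \<subseteq> fst ` E \<and> flow_pair_in E (C i) (T i)" and Z: "Z \<in> null_sets m" "fst ` E \<subseteq> (\<Union>i. C i) \<union> Z"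
    using flow_exhaustion[OF E] by (elim exE conjE)
  note C = C'[rule_format]
  have "(\<Union>i. C i) \<in> sets borel" using C by (intro sets.countable_UN) auto
  moreover have "(\<Union>i. C i) \<subseteq> fst ` E" using C by (intro UN_least) simp
  ultimately show ?thesis using Z by (intro exI[of _ "\<Union>i. C i"] exI[of _ Z]) simp
qed

section \<open>The contraction estimate\<close>

lemma flow_bound:
  assumes T: "flow_on C T" and C: "C \<subseteq> cball x R" and w0: "\<And>w. w \<in> C \<Longrightarrow> T a w = w" and a: "a \<in> {0..<1}"
  shows "dist (T 0 w) x \<le> \<bar>R\<bar> / (1 - a)"
proof (cases "w \<in> C")
  case True
  have g: "geodesic_between (\<lambda>s. T s w) (T 0 w) x" using T by (simp add: flow_on_def)
  have "T 1 w = x" using g by (simp add: geodesic_between_def)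
  then have "dist w x = (1 - a) * dist (T 0 w) x"
    using geodesic_betweenD[OF g, of a 1] a w0[OF True] by simp
  moreover have "dist w x \<le> \<bar>R\<bar>" using C True by (force simp: dist_commute)
  ultimately show ?thesis using a by (simp add: field_simps)
qed (use T a in \<open>simp add: flow_on_def\<close>)

lemma prob_uniform:
  assumes "C \<in> sets borel" "emeasure m C = ennreal c" "0 < c"
  shows "prob_space (uniform_measure m C)" "sets (uniform_measure m C) = sets borel"
  using assms sets_m by (auto intro!: prob_space_uniform_measure)

lemma emeasure_flow_null:
  assumes C: "C \<in> sets borel" "emeasure m C = ennreal c" "0 < c"
    and T: "T \<in> borel_measurable borel" and K: "K \<in> sets borel" "\<And>w. w \<in> C \<Longrightarrow> T w \<in> K"
  shows "emeasure (distr (uniform_measure m C) borel T) (UNIV - K) = 0"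
proof -
  have T' [measurable]: "T \<in> borel_measurable (uniform_measure m C)"
    using T prob_uniform(2)[OF C] measurable_cong_sets[of "uniform_measure m C" borel] by simp
  have S: "T -` (UNIV - K) \<in> sets borel"
    using measurable_sets[OF T, of "UNIV - K"] K(1) by simp
  have e: "C \<inter> T -` (UNIV - K) = {}" using K(2) by auto
  have "emeasure (distr (uniform_measure m C) borel T) (UNIV - K) = emeasure (uniform_measure m C) (T -` (UNIV - K))"
    using K(1) by (subst emeasure_distr) auto
  also have "\<dots> = emeasure m (C \<inter> T -` (UNIV - K)) / emeasure m C"
    using C(1) S sets_m by (intro emeasure_uniform_measure) auto
  finally show ?thesis by (simp add: e)
qed

lemma distr_uniform_fixed:
  assumes C: "C \<in> sets borel" "emeasure m C = ennreal c" "0 < c"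
    and T: "T \<in> borel_measurable borel" and fixed: "\<And>w. w \<in> C \<Longrightarrow> T w = w"
  shows "distr (uniform_measure m C) borel T = uniform_measure m C"
proof -
  let ?M = "uniform_measure m C"
  have T': "T \<in> borel_measurable ?M"
    using T prob_uniform(2)[OF C] measurable_cong_sets[of ?M borel] by simp
  have "distr ?M borel T = distr ?M borel (\<lambda>w. w)"
  proof (rule distr_cong_AE[OF refl refl _ T'])
    show "AE w in ?M. T w = w"
      using C(1) sets_m fixed by (intro AE_uniform_measureI) auto
    show "(\<lambda>w. w) \<in> borel_measurable ?M"
      using prob_uniform(2)[OF C] by (simp add: measurable_ident_sets)
  qed
  also have "\<dots> = ?M" using prob_uniform(2)[OF C] by (intro distr_id2) simp
  finally show ?thesis .
qed

text \<open>
  Concavity, the value of the integral for the uniform distribution on \<open>C\<close> at time \<open>0\<close>, and the bound for measures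
  carried by \<open>K\<close> at time \<open>s\<close> give \<open>(1 - s) m(C)\<^bsup>1/N\<^esup> \<le> m(K)\<^bsup>1/N\<^esup>\<close>.
\<close>

lemma flow_contraction:
  assumes C: "C \<in> sets borel" "C \<subseteq> cball x R" "emeasure m C < \<top>"
    and T: "flow_on C T" "\<And>w. w \<in> C \<Longrightarrow> T 0 w = w"
    and s: "s \<in> {0..<1}" and K: "K \<in> sets borel" "\<And>w. w \<in> C \<Longrightarrow> T s w \<in> K"
  shows "ennreal ((1 - s) powr N) * emeasure m C \<le> emeasure m K"
proof (cases "emeasure m C = 0 \<or> emeasure m K = \<top>")
  case False
  then obtain c where c: "emeasure m C = ennreal c" "0 < c"
    using C(3) by (cases "emeasure m C") auto
  obtain k where k: "emeasure m K = ennreal k" "0 \<le> k"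
    using False by (cases "emeasure m K") auto
  let ?M = "uniform_measure m C"
  let ?\<Gamma> = "\<lambda>t. distr ?M borel (T t)"
  note M = prob_uniform[OF C(1) c]
  have meas: "T t \<in> borel_measurable borel" if "t \<in> {0..1}" for t
    using T(1) that by (simp add: flow_on_def)
  have meas': "T t \<in> borel_measurable ?M" if "t \<in> {0..1}" for t
    using meas[OF that] M(2) measurable_cong_sets[of ?M borel] by simp
  have \<Gamma>: "?\<Gamma> \<in> wasserstein_geodesics"
    using T(1) flow_bound[OF T(1) C(2), of 0] T(2)
    by (intro flow_wasserstein_geodesic[OF D M(1) meas', where x = x and R = "\<bar>R\<bar>"]) (auto simp: flow_on_def)
  have "?\<Gamma> 0 = ?M"
    using meas T(2) by (intro distr_uniform_fixed[OF C(1) c]) auto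
  then have H0: "renyi_integral N m (?\<Gamma> 0) = ennreal (c powr (1 / N))"
    using renyi_integral_uniform[OF sigma_fin N _ c] C(1) sets_m by simp
  have "ennreal (1 - s) * renyi_integral N m (?\<Gamma> 0) \<le> ennreal (1 - s) * renyi_integral N m (?\<Gamma> 0) + ennreal s * renyi_integral N m (?\<Gamma> 1)"
    by simp
  also have "\<dots> \<le> renyi_integral N m (?\<Gamma> s)"
    using renyi_integral_concave_along[OF conv \<Gamma>, of 0 1 s] s by simp
  also have "\<dots> \<le> ennreal (k powr (1 / N))"
  proof (rule renyi_integral_le_measure_carrier[OF sigma_fin _ _ N _ _ k])
    show "prob_space (?\<Gamma> s)" using s by (intro prob_space.prob_space_distr[OF M(1)] meas') auto
    show "emeasure (?\<Gamma> s) (space m - K) = 0"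
      using emeasure_flow_null[OF C(1) c meas K] s by simp
  qed (use K(1) sets_m in auto)
  finally have "(1 - s) * c powr (1 / N) \<le> k powr (1 / N)"
    unfolding H0 using s by (simp add: ennreal_mult'[symmetric])
  then have "((1 - s) * c powr (1 / N)) powr N \<le> (k powr (1 / N)) powr N"
    using s N by (intro powr_mono2) auto
  then have "(1 - s) powr N * c \<le> k"
    using s N c(2) k(2) by (simp add: powr_mult powr_powr)
  then show ?thesis
    unfolding c(1) k(1) using c(2) by (simp add: ennreal_mult'[symmetric] ennreal_leI)
qed (auto simp: top_unique)

text \<open>
  The closed set \<open>F\<close> restricts the geodesics that may be chosen; the Borel set \<open>K\<close> only has to contain the positions
  of those. Both are needed separately because a selection can be forced into a closed set but
  not into an arbitrary Borel set.
\<close>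

lemma contraction:
  assumes S: "S \<in> sets borel" and K: "K \<in> sets borel" and F: "closed F" and r: "r \<in> {0..<1}"
    and ex: "\<And>y. y \<in> S \<Longrightarrow> \<exists>\<gamma>. geodesic_between \<gamma> y x \<and> \<gamma> (of_rat r) \<in> F"
    and into: "\<And>y \<gamma>. y \<in> S \<Longrightarrow> geodesic_between \<gamma> y x \<Longrightarrow> \<gamma> (of_rat r) \<in> F \<Longrightarrow> \<gamma> (of_rat r) \<in> K"
  shows "ennreal ((1 - of_rat r) powr N) * emeasure m S \<le> emeasure m K"
proof -
  let ?c = "ennreal ((1 - of_rat r) powr N)"
  define E where "E = {p::'a \<times> 'a geodesic_code. code_pair_to x (snd p)} \<inter> {p. snd p (True, 0) = fst p} \<inter> {p. snd p (True, r) \<in> F}"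
  have cE: "closed E"
    unfolding E_def using F by (intro closed_Int closed_code_pair_to closed_code_eq_fst closed_code_mem)
  have codeE: "\<forall>p\<in>E. code_pair_to x (snd p)" by (auto simp: E_def)
  have SE: "S \<subseteq> fst ` E"
  proof
    fix y assume "y \<in> S"
    then obtain \<gamma> where \<gamma>: "geodesic_between \<gamma> y x" "\<gamma> (of_rat r) \<in> F" using ex by blast
    then have "(y, \<lambda>(i, r). \<gamma> (of_rat r)) \<in> E"
      using rat_geodesic_to_of_geodesic[OF \<gamma>(1)] by (auto simp: E_def code_pair_to_def geodesic_between_def)
    then show "y \<in> fst ` E" by force
  qed
  have bounded: "?c * emeasure m S' \<le> emeasure m K"
    if S': "S' \<in> sets borel" "S' \<subseteq> S" "emeasure m S' < \<top>" "S' \<subseteq> cball x R" for S' R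
  proof (rule ennreal_le_epsilon)
    fix e :: real assume "0 < e"
    obtain C T where C: "C \<in> sets borel" "C \<subseteq> S' \<inter> fst ` E"
        "outer_measure_of m (S' \<inter> fst ` E) \<le> emeasure m C + ennreal e" "flow_pair_in E C T"
      using flow_selection[OF cE codeE S'(1,3) \<open>0 < e\<close>] by blast
    have flow: "flow_on C (T True)" using C(4) by (simp add: flow_pair_in_def)
    have code: "T True 0 w = w \<and> T True (of_rat r) w \<in> F" if "w \<in> C" for w
    proof -
      obtain g where g: "(w, g) \<in> E" "\<And>i r. r \<in> {0..1} \<Longrightarrow> T i (of_rat r) w = g (i, r)"
        using flow_pair_inD[OF C(4) \<open>w \<in> C\<close>] by blast
      have "T True 0 w = g (True, 0)" using g(2)[of 0 True] by simp
      moreover have "T True (of_rat r) w = g (True, r)" using g(2)[of r True] r by simp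
      ultimately show ?thesis using g(1) by (simp add: E_def)
    qed
    have inK: "T True (of_rat r) w \<in> K" if "w \<in> C" for w
    proof (rule into)
      show "w \<in> S" using that C(2) S'(2) by blast
      have "geodesic_between (\<lambda>s. T True s w) (T True 0 w) x" using flow by (simp add: flow_on_def)
      then show "geodesic_between (\<lambda>s. T True s w) w x" using code[OF that] by simp
    qed (use code[OF that] in simp)
    have "emeasure m C \<le> emeasure m S'" using C(2) S' sets_m by (intro emeasure_mono) auto
    then have fin: "emeasure m C < \<top>" using S'(3) by simp
    have "emeasure m S' \<le> emeasure m C + ennreal e"
    proof -
      have "S' \<inter> fst ` E = S'" using subset_trans[OF S'(2) SE] by (rule Int_absorb2)
      moreover have "S' \<in> sets m" using S'(1) sets_m by simp
      ultimately show ?thesis using C(3) by simp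
    qed
    then have "?c * emeasure m S' \<le> ?c * (emeasure m C + ennreal e)" by (intro mult_left_mono) auto
    also have "\<dots> = ?c * emeasure m C + ?c * ennreal e" by (simp add: distrib_left)
    also have "?c * emeasure m C \<le> emeasure m K"
    proof (rule flow_contraction[OF C(1) _ fin flow])
      show "C \<subseteq> cball x R" using C(2) S'(4) by blast
    qed (use code inK K r in auto)
    also have "?c * ennreal e \<le> 1 * ennreal e"
      using r N by (intro mult_right_mono) (auto simp: powr_le_one_le intro!: powr_le1)
    finally show "?c * emeasure m S' \<le> emeasure m K + ennreal e" by (simp add: add_mono)
  qed
  obtain B where B: "incseq B" "\<And>n. B n \<in> sets borel" "\<And>n. B n \<subseteq> cball x (real n)"
    "\<And>n. emeasure m (B n) < \<top>" "(\<Union>n. B n) = UNIV"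
    using incseq_bounded_finite_cover by blast
  have "emeasure m S = (SUP n. emeasure m (S \<inter> B n))"
  proof -
    have "(SUP n. emeasure m (S \<inter> B n)) = emeasure m (\<Union>n. S \<inter> B n)"
      using B(1,2) S sets_m by (intro SUP_emeasure_incseq) (auto simp: incseq_def)
    also have "(\<Union>n. S \<inter> B n) = S" using B(5) by blast
    finally show ?thesis by simp
  qed
  then have "?c * emeasure m S = (SUP n. ?c * emeasure m (S \<inter> B n))"
    by (simp add: SUP_mult_left_ennreal)
  also have "\<dots> \<le> emeasure m K"
  proof (rule SUP_least)
    fix n
    have "emeasure m (S \<inter> B n) \<le> emeasure m (B n)"
      using B(2) S sets_m by (intro emeasure_mono) auto
    then have "emeasure m (S \<inter> B n) < \<top>" using B(4)[of n] by simp
    then show "?c * emeasure m (S \<inter> B n) \<le> emeasure m K"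
      using B(2,3) S by (intro bounded[of _ "real n"]) auto
  qed
  finally show ?thesis .
qed

lemmas contraction_to = geodesic_flow_space.contraction[OF geodesic_flow_space_axioms]

section \<open>Forking geodesics\<close>

text \<open>
  Let \<open>h\<close> be the value of the integral for the uniform distribution on \<open>C\<close>, which is the law of both flows and
  of their mixture at time \<open>a\<close>. Concavity on \<open>[a,1]\<close> gives each flow at least \<open>q h\<close> at time \<open>b\<close>, with
  \<open>q = (1-b)/(1-a)\<close>; the disjoint carriers give the mixture at least \<open>2\<^bsup>1/N\<^esup> q h\<close> there; and concavity
  on \<open>[0,b]\<close> gives it at least \<open>(a/b) 2\<^bsup>1/N\<^esup> q h\<close> at time \<open>a\<close>. The last hypothesis says that this
  exceeds \<open>h\<close>.
\<close>

lemma two_flows_contradiction: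
  fixes T :: "bool \<Rightarrow> real \<Rightarrow> 'a \<Rightarrow> 'a" and a b :: real
  assumes C: "C \<in> sets borel" "C \<subseteq> cball x R" "0 < emeasure m C" "emeasure m C < \<top>"
    and T: "\<And>i. flow_on C (T i)" "\<And>i w. w \<in> C \<Longrightarrow> T i a w = w"
    and S: "S1 \<in> sets borel" "S2 \<in> sets borel" "S1 \<inter> S2 = {}"
      "\<And>w. w \<in> C \<Longrightarrow> T True b w \<in> S1" "\<And>w. w \<in> C \<Longrightarrow> T False b w \<in> S2"
    and ab: "0 < a" "a < b" "b < 1" "b * (1 - a) < 2 powr (1 / N) * (a * (1 - b))"
  shows False
proof -
  obtain c where c: "emeasure m C = ennreal c" "0 < c"
    using C(3,4) by (cases "emeasure m C") auto
  let ?M = "uniform_measure m C"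
  note M = prob_uniform[OF C(1) c]
  interpret M: prob_space ?M by (rule M(1))
  have meas: "T i t \<in> borel_measurable borel" if "t \<in> {0..1}" for i t
    using T(1)[of i] that by (simp add: flow_on_def)
  have meas': "T i t \<in> borel_measurable ?M" if "t \<in> {0..1}" for i t
    using meas[OF that] M(2) measurable_cong_sets[of ?M borel] by simp
  have geo: "geodesic_between (\<lambda>s. T i s w) (T i 0 w) x" for i w
    using T(1)[of i] by (simp add: flow_on_def)
  have bdd: "dist (T i 0 w) x \<le> \<bar>R\<bar> / (1 - a)" for i w
    using flow_bound[OF T(1) C(2) T(2)] ab by simp
  define \<Gamma> where "\<Gamma> i t = distr ?M borel (T i t)" for i t
  have \<Gamma>: "\<Gamma> i \<in> wasserstein_geodesics" for i
    unfolding \<Gamma>_def[abs_def]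
    by (rule flow_wasserstein_geodesic[OF D M(1) meas' geo bdd])
  have fixed: "\<Gamma> i a = ?M" for i
    unfolding \<Gamma>_def using meas T(2) ab by (intro distr_uniform_fixed[OF C(1) c]) auto
  have HM: "renyi_integral N m ?M = ennreal (c powr (1 / N))"
    using renyi_integral_uniform[OF sigma_fin N _ c] C(1) sets_m by simp
  define h where "h = c powr (1 / N)"
  have h: "0 < h" using c(2) by (simp add: h_def)
  define q where "q = (1 - b) / (1 - a)"
  have q: "0 \<le> q" using ab by (simp add: q_def)
  have low: "ennreal (q * h) \<le> renyi_integral N m (\<Gamma> i b)" for i
  proof -
    define u where "u = (b - a) / (1 - a)"
    have u: "0 \<le> u" "u \<le> 1" "1 - u = q" "a + u * (1 - a) = b"
      using ab by (auto simp: u_def q_def field_simps)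
    have "ennreal q * ennreal h \<le> ennreal (1 - u) * renyi_integral N m (\<Gamma> i a) + ennreal u * renyi_integral N m (\<Gamma> i 1)"
      by (simp add: fixed HM h_def u(3))
    also have "\<dots> \<le> renyi_integral N m (\<Gamma> i b)"
      using renyi_integral_concave_along[OF conv \<Gamma>[of i], of a 1 u] ab u by simp
    finally show ?thesis using q by (simp add: ennreal_mult')
  qed
  \<comment> \<open>A fair coin, independent of the point of \<open>C\<close>, decides which of the two flows is followed.\<close>
  define M2 where "M2 = measure_pmf (bernoulli_pmf (1/2)) \<Otimes>\<^sub>M ?M"
  define T2 where "T2 t p = T (fst p) t (snd p)" for t and p :: "bool \<times> 'a"
  interpret P: pair_prob_space "measure_pmf (bernoulli_pmf (1/2))" ?M ..
  have T2m: "T2 t \<in> borel_measurable M2" if "t \<in> {0..1}" for t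
  proof -
    have "(\<lambda>p. T (fst p) t (snd p)) \<in> measurable (count_space UNIV \<Otimes>\<^sub>M ?M) borel"
      by (rule measurable_pair_measure_countable1) (simp_all add: meas'[OF that])
    moreover have "sets M2 = sets (count_space UNIV \<Otimes>\<^sub>M ?M)"
      unfolding M2_def by (intro sets_pair_measure_cong) auto
    ultimately show ?thesis unfolding T2_def[abs_def] by (simp cong: measurable_cong_sets)
  qed
  define \<Gamma>2 where "\<Gamma>2 t = distr M2 borel (T2 t)" for t
  have \<Gamma>2: "\<Gamma>2 \<in> wasserstein_geodesics"
    unfolding \<Gamma>2_def[abs_def]
  proof (rule flow_wasserstein_geodesic[OF D _ T2m])
    show "prob_space M2" unfolding M2_def by (rule P.prob_space_axioms)
    show "geodesic_between (\<lambda>s. T2 s w) (T2 0 w) x" for w unfolding T2_def by (rule geo)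
    show "dist (T2 0 w) x \<le> \<bar>R\<bar> / (1 - a)" for w unfolding T2_def by (rule bdd)
  qed
  have mix: "emeasure (\<Gamma>2 t) A = ennreal (1/2) * emeasure (\<Gamma> True t) A + ennreal (1/2) * emeasure (\<Gamma> False t) A"
    if t: "t \<in> {0..1}" and A: "A \<in> sets borel" for t A
  proof -
    have X: "T2 t -` A \<inter> space M2 \<in> sets M2" using measurable_sets[OF T2m[OF t] A] .
    have sp: "space M2 = UNIV" unfolding M2_def space_pair_measure by simp
    have "emeasure (\<Gamma>2 t) A = emeasure M2 (T2 t -` A)"
      unfolding \<Gamma>2_def using emeasure_distr[OF T2m[OF t] A] sp by simp
    also have "\<dots> = (\<integral>\<^sup>+i. emeasure ?M (Pair i -` (T2 t -` A)) \<partial>measure_pmf (bernoulli_pmf (1/2)))"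
      using X sp unfolding M2_def by (intro M.emeasure_pair_measure_alt) simp
    also have "\<dots> = (\<integral>\<^sup>+i. emeasure (\<Gamma> i t) A \<partial>measure_pmf (bernoulli_pmf (1/2)))"
    proof (rule nn_integral_cong)
      fix i
      have "Pair i -` (T2 t -` A) = T i t -` A" by (auto simp: T2_def)
      then show "emeasure ?M (Pair i -` (T2 t -` A)) = emeasure (\<Gamma> i t) A"
        unfolding \<Gamma>_def using emeasure_distr[OF meas'[OF t] A] by simp
    qed
    finally show ?thesis by (simp add: mult.commute)
  qed
  have fixed2: "\<Gamma>2 a = ?M"
  proof (rule measure_eqI)
    show "sets (\<Gamma>2 a) = sets ?M" using M(2) by (simp add: \<Gamma>2_def)
    fix A assume "A \<in> sets (\<Gamma>2 a)"
    then have A: "A \<in> sets borel" by (simp add: \<Gamma>2_def)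
    have "emeasure (\<Gamma>2 a) A = (ennreal (1/2) + ennreal (1/2)) * emeasure ?M A"
      using mix[of a A] A ab fixed by (simp add: distrib_right)
    also have "ennreal (1/2) + ennreal (1/2) = 1"
      by (subst ennreal_plus[symmetric]) auto
    finally show "emeasure (\<Gamma>2 a) A = emeasure ?M A" by simp
  qed
  have b01: "b \<in> {0..1}" using ab by simp
  define \<theta> where "\<theta> = 1 - 1 / N"
  have "ennreal ((1/2) powr \<theta>) * (renyi_integral N m (\<Gamma> True b) + renyi_integral N m (\<Gamma> False b)) \<le> renyi_integral N m (\<Gamma>2 b)"
    unfolding \<theta>_def
  proof (rule renyi_integral_mixture_disjoint[OF sigma_fin, where ?S1.0 = S1 and ?S2.0 = S2])
    have p: "prob_space (\<Gamma> i b)" for i unfolding \<Gamma>_def by (intro M.prob_space_distr meas' b01)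
    show "finite_measure (\<Gamma> True b)" "finite_measure (\<Gamma> False b)" using p by (auto simp: prob_space_def)
    have "prob_space (\<Gamma>2 b)" unfolding \<Gamma>2_def
      using P.prob_space_distr[of "T2 b" borel] T2m[OF b01] by (simp add: M2_def)
    then show "finite_measure (\<Gamma>2 b)" by (simp add: prob_space_def)
    show "emeasure (\<Gamma> True b) (space m - S1) = 0"
      unfolding \<Gamma>_def using emeasure_flow_null[OF C(1) c meas[OF b01] S(1)] S(4) by simp
    show "emeasure (\<Gamma> False b) (space m - S2) = 0"
      unfolding \<Gamma>_def using emeasure_flow_null[OF C(1) c meas[OF b01] S(2)] S(5) by simp
    show "emeasure (\<Gamma>2 b) A = ennreal (1/2) * emeasure (\<Gamma> True b) A + ennreal (1/2) * emeasure (\<Gamma> False b) A"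
      if "A \<in> sets m" for A using mix[OF b01, of A] that sets_m by simp
  qed (use S sets_m in \<open>auto simp: \<Gamma>_def \<Gamma>2_def\<close>)
  moreover have "ennreal ((1/2) powr \<theta>) * (ennreal (q * h) + ennreal (q * h))
      \<le> ennreal ((1/2) powr \<theta>) * (renyi_integral N m (\<Gamma> True b) + renyi_integral N m (\<Gamma> False b))"
    by (intro mult_left_mono add_mono low) auto
  ultimately have up: "ennreal ((1/2) powr \<theta>) * (ennreal (q * h) + ennreal (q * h)) \<le> renyi_integral N m (\<Gamma>2 b)"
    by (rule order_trans[rotated])
  define v where "v = a / b"
  have v: "0 \<le> v" "v \<le> 1" "v * b = a" using ab by (auto simp: v_def)
  have "ennreal v * renyi_integral N m (\<Gamma>2 b) \<le> ennreal (1 - v) * renyi_integral N m (\<Gamma>2 0) + ennreal v * renyi_integral N m (\<Gamma>2 b)"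
    by simp
  also have "\<dots> \<le> renyi_integral N m (\<Gamma>2 a)"
    using renyi_integral_concave_along[OF conv \<Gamma>2, of 0 b v] ab v by simp
  also have "\<dots> = ennreal h" by (simp add: fixed2 HM h_def)
  finally have "ennreal v * renyi_integral N m (\<Gamma>2 b) \<le> ennreal h" .
  moreover have "ennreal v * (ennreal ((1/2) powr \<theta>) * (ennreal (q * h) + ennreal (q * h)))
      \<le> ennreal v * renyi_integral N m (\<Gamma>2 b)"
    using up by (intro mult_left_mono) auto
  ultimately have "ennreal v * (ennreal ((1/2) powr \<theta>) * (ennreal (q * h) + ennreal (q * h))) \<le> ennreal h"
    by (rule order_trans[rotated])
  moreover have "ennreal v * (ennreal ((1/2) powr \<theta>) * (ennreal (q * h) + ennreal (q * h)))
    = ennreal (v * ((1/2) powr \<theta> * (q * h + q * h)))"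
  proof -
    have "ennreal (q * h) + ennreal (q * h) = ennreal (q * h + q * h)"
      using q h by (intro ennreal_plus[symmetric]) auto
    then show ?thesis
      by (simp only: ennreal_mult'[OF v(1)] ennreal_mult'[OF powr_ge_zero])
  qed
  ultimately have "v * ((1/2) powr \<theta> * (q * h + q * h)) \<le> h" using h by simp
  then have "(v * q * ((1/2) powr \<theta> * 2)) * h \<le> 1 * h" by (simp add: algebra_simps)
  then have "v * q * ((1/2) powr \<theta> * 2) \<le> 1" using h by (simp only: mult_le_cancel_right_pos)
  moreover have "(1/2) powr \<theta> * 2 = 2 powr (1 / N)"
    by (simp add: \<theta>_def powr_divide powr_diff)
  ultimately have "v * q * 2 powr (1 / N) \<le> 1" by simp
  then have "2 powr (1 / N) * (a * (1 - b)) \<le> b * (1 - a)"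
    using ab by (simp add: v_def q_def field_simps)
  then show False using ab(4) by simp
qed

text \<open>
  The inequality is the one that makes the two-flow argument a contradiction; it holds for all pairs of
  times sufficiently near a given interior time.
\<close>

definition close_times :: "rat \<Rightarrow> rat \<Rightarrow> bool" where
  "close_times a b \<longleftrightarrow> 0 < a \<and> a < b \<and> b < 1 \<and>
     real_of_rat b * (1 - of_rat a) < 2 powr (1 / N) * (of_rat a * (1 - of_rat b))"

lemma close_times_near:
  fixes \<tau> \<delta> :: real
  assumes "0 < \<tau>" "\<tau> < 1" "0 < \<delta>"
  shows "\<exists>\<epsilon>>0. \<epsilon> \<le> \<delta> \<and> (\<forall>a b. \<tau> - \<epsilon> < of_rat a \<and> of_rat a \<le> \<tau> \<and> \<tau> < of_rat b \<and> of_rat b < \<tau> + \<epsilon> \<longrightarrow> close_times a b)"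
proof -
  let ?q = "2 powr (1 / N)"
  have q: "1 < ?q" using N by simp
  have "((\<lambda>e. ?q * ((\<tau> - e) * (1 - (\<tau> + e))) - (\<tau> + e) * (1 - (\<tau> - e))) \<longlongrightarrow>
      ?q * ((\<tau> - 0) * (1 - (\<tau> + 0))) - (\<tau> + 0) * (1 - (\<tau> - 0))) (at_right 0)"
    by (intro tendsto_intros)
  moreover have "0 < ?q * ((\<tau> - 0) * (1 - (\<tau> + 0))) - (\<tau> + 0) * (1 - (\<tau> - 0))"
    using q assms by simp
  ultimately have "\<forall>\<^sub>F e in at_right 0. 0 < ?q * ((\<tau> - e) * (1 - (\<tau> + e))) - (\<tau> + e) * (1 - (\<tau> - e))"
    by (rule order_tendstoD(1))
  moreover have "\<forall>\<^sub>F e in at_right 0. e \<in> {0<..<min \<delta> (min \<tau> (1 - \<tau>))}"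
    using assms by (intro eventually_at_right_real) auto
  ultimately have "\<forall>\<^sub>F e in at_right (0::real). e \<in> {0<..<min \<delta> (min \<tau> (1 - \<tau>))} \<and>
      0 < ?q * ((\<tau> - e) * (1 - (\<tau> + e))) - (\<tau> + e) * (1 - (\<tau> - e))" by eventually_elim auto
  then obtain e where "e \<in> {0<..<min \<delta> (min \<tau> (1 - \<tau>))} \<and>
      0 < ?q * ((\<tau> - e) * (1 - (\<tau> + e))) - (\<tau> + e) * (1 - (\<tau> - e))"
    using eventually_happens'[OF trivial_limit_at_right_real] by blast
  then have e: "0 < e" "e < \<delta>" "e < \<tau>" "e < 1 - \<tau>"
      "(\<tau> + e) * (1 - (\<tau> - e)) < ?q * ((\<tau> - e) * (1 - (\<tau> + e)))"
    by simp_all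
  have "close_times a b" if ab: "\<tau> - e < of_rat a" "of_rat a \<le> \<tau>" "\<tau> < of_rat b" "of_rat b < \<tau> + e" for a b
  proof -
    have "0 < real_of_rat a" "real_of_rat a < of_rat b" "real_of_rat b < 1" using ab e by linarith+
    then have p: "0 < a" "a < b" "b < 1" by (simp_all add: of_rat_less)
    moreover have "real_of_rat b * (1 - of_rat a) \<le> (\<tau> + e) * (1 - (\<tau> - e))"
      using ab e p by (intro mult_mono) auto
    moreover have "?q * ((\<tau> - e) * (1 - (\<tau> + e))) \<le> ?q * (of_rat a * (1 - of_rat b))"
      using ab e p by (intro mult_left_mono mult_mono) auto
    ultimately show ?thesis using e(5) unfolding close_times_def by linarith
  qed
  then show ?thesis using e by (intro exI[of _ e]) auto
qed

text \<open>
  The two geodesics may start at different points: the mixture of the two flows only has to have a known law at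
  time \<open>a\<close>.
\<close>

definition fork_points :: "rat \<Rightarrow> rat \<Rightarrow> 'a set" where
  "fork_points a b = {z. \<exists>\<gamma>1 \<gamma>2 y1 y2. geodesic_between \<gamma>1 y1 x \<and> geodesic_between \<gamma>2 y2 x \<and>
    \<gamma>1 (of_rat a) = z \<and> \<gamma>2 (of_rat a) = z \<and> \<gamma>1 (of_rat b) \<noteq> \<gamma>2 (of_rat b)}"

definition splitting_starts :: "rat \<Rightarrow> rat \<Rightarrow> 'a set" where
  "splitting_starts a b = {y. \<exists>\<gamma>1 \<gamma>2. geodesic_between \<gamma>1 y x \<and> geodesic_between \<gamma>2 y x \<and>
    \<gamma>1 (of_rat a) = \<gamma>2 (of_rat a) \<and> \<gamma>1 (of_rat b) \<noteq> \<gamma>2 (of_rat b)}"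

lemma fork_points_null:
  assumes ab: "close_times a b"
  shows "\<exists>Z\<in>null_sets m. fork_points a b \<subseteq> Z"
proof -
  have ab01: "a \<in> {0..1}" "b \<in> {0..1}" "0 < a" "a < b" "b < 1" using ab by (auto simp: close_times_def)
  define E where "E = {z::'a \<times> 'a geodesic_code. code_pair_to x (snd z)} \<inter>
    {z. snd z (True, a) = fst z} \<inter> {z. snd z (False, a) = fst z}"
  have "\<exists>Z\<in>null_sets m. fst ` {p \<in> E. snd p (True, b) \<noteq> snd p (False, b)} \<subseteq> Z"
  proof (rule null_if_no_separating_flow[OF _ _ ab01(2)])
    show "closed E" unfolding E_def by (intro closed_Int closed_code_pair_to closed_code_eq_fst)
    show "\<forall>z\<in>E. code_pair_to x (snd z)" by (auto simp: E_def)
    fix C T R B1 B2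
    assume C: "C \<in> sets borel" "C \<subseteq> cball x R" "0 < emeasure m C" "emeasure m C < \<top>" and T: "flow_pair_in E C T"
      and B: "B1 \<in> sets borel" "B2 \<in> sets borel" "B1 \<inter> B2 = {}"
        "\<And>w. w \<in> C \<Longrightarrow> T True (of_rat b) w \<in> B1" "\<And>w. w \<in> C \<Longrightarrow> T False (of_rat b) w \<in> B2"
    have "T j (of_rat a) w = w" if "w \<in> C" for w j
    proof -
      obtain g where "(w, g) \<in> E" "\<And>i r. r \<in> {0..1} \<Longrightarrow> T i (of_rat r) w = g (i, r)"
        using flow_pair_inD[OF T \<open>w \<in> C\<close>] by blast
      then show ?thesis using ab01(1) by (cases j) (simp_all add: E_def)
    qed
    then show False
      using ab ab01 T B
      by (intro two_flows_contradiction[OF C, of T "of_rat a" B1 B2 "of_rat b"])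
        (auto simp: close_times_def flow_pair_in_def of_rat_less)
  qed
  moreover have "fork_points a b \<subseteq> fst ` {p \<in> E. snd p (True, b) \<noteq> snd p (False, b)}"
  proof
    fix z assume "z \<in> fork_points a b"
    then obtain \<gamma>1 \<gamma>2 y1 y2 where g: "geodesic_between \<gamma>1 y1 x" "geodesic_between \<gamma>2 y2 x"
      "\<gamma>1 (of_rat a) = z" "\<gamma>2 (of_rat a) = z" "\<gamma>1 (of_rat b) \<noteq> \<gamma>2 (of_rat b)"
      unfolding fork_points_def by blast
    have "(z, \<lambda>(i, r). if i then \<gamma>1 (of_rat r) else \<gamma>2 (of_rat r)) \<in> {p \<in> E. snd p (True, b) \<noteq> snd p (False, b)}"
      using g code_pair_to_of_geodesics[OF g(1,2)] by (simp add: E_def)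
    then show "z \<in> fst ` {p \<in> E. snd p (True, b) \<noteq> snd p (False, b)}" by force
  qed
  ultimately show ?thesis by blast
qed

text \<open>
  Otherwise a flow would move a set of positive measure, at time \<open>a\<close>, into the null set of fork points,
  which the contraction estimate forbids.
\<close>

lemma splitting_starts_null:
  assumes ab: "close_times a b"
  shows "\<exists>Z\<in>null_sets m. splitting_starts a b \<subseteq> Z"
proof -
  have ab01: "a \<in> {0..1}" "b \<in> {0..1}" "0 < a" "a < b" "b < 1" using ab by (auto simp: close_times_def)
  obtain Z0 where Z0: "Z0 \<in> null_sets m" "fork_points a b \<subseteq> Z0"
    using fork_points_null[OF ab] by blast
  define E where "E = {z::'a \<times> 'a geodesic_code. code_pair_to x (snd z)} \<inter>
    {z. snd z (True, 0) = fst z} \<inter> {z. snd z (False, 0) = fst z} \<inter> {z. snd z (True, a) = snd z (False, a)}"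
  have "\<exists>Z\<in>null_sets m. fst ` {p \<in> E. snd p (True, b) \<noteq> snd p (False, b)} \<subseteq> Z"
  proof (rule null_if_no_separating_flow[OF _ _ ab01(2)])
    show "closed E" unfolding E_def by (intro closed_Int closed_code_pair_to closed_code_eq_fst closed_code_eq)
    show "\<forall>z\<in>E. code_pair_to x (snd z)" by (auto simp: E_def)
    fix C T R B1 B2
    assume C: "C \<in> sets borel" "C \<subseteq> cball x R" "0 < emeasure m C" "emeasure m C < \<top>" and T: "flow_pair_in E C T"
      and B: "B1 \<in> sets borel" "B2 \<in> sets borel" "B1 \<inter> B2 = {}"
        "\<And>w. w \<in> C \<Longrightarrow> T True (of_rat b) w \<in> B1" "\<And>w. w \<in> C \<Longrightarrow> T False (of_rat b) w \<in> B2"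
    have code: "T True 0 w = w" "T True (of_rat a) w = T False (of_rat a) w" if "w \<in> C" for w
    proof -
      obtain g where g: "(w, g) \<in> E" "\<And>i r. r \<in> {0..1} \<Longrightarrow> T i (of_rat r) w = g (i, r)"
        using flow_pair_inD[OF T \<open>w \<in> C\<close>] by blast
      show "T True 0 w = w" using g(1) g(2)[of 0 True] by (simp add: E_def)
      show "T True (of_rat a) w = T False (of_rat a) w" using g(1) g(2)[OF ab01(1)] by (simp add: E_def)
    qed
    have "T True (of_rat a) w \<in> Z0" if "w \<in> C" for w
    proof -
      have "T True (of_rat b) w \<noteq> T False (of_rat b) w" using B(3) B(4,5)[OF that] by auto
      then have "T True (of_rat a) w \<in> fork_points a b"
        using code(2)[OF that] flow_pair_geodesic[OF T] unfolding fork_points_def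
        by (intro CollectI exI[of _ "\<lambda>s. T True s w"] exI[of _ "\<lambda>s. T False s w"]
            exI[of _ "T True 0 w"] exI[of _ "T False 0 w"]) auto
      then show ?thesis using Z0(2) by blast
    qed
    then have "ennreal ((1 - of_rat a) powr N) * emeasure m C \<le> emeasure m Z0"
      using Z0(1) sets_m code(1) T ab01
      by (intro flow_contraction[OF C(1,2,4), of "T True"]) (auto simp: flow_pair_in_def)
    then have "ennreal ((1 - of_rat a) powr N) * emeasure m C = 0" using null_setsD1[OF Z0(1)] by simp
    moreover have "emeasure m C \<noteq> 0" using C(3) by (rule less_imp_neq[THEN not_sym])
    ultimately have "ennreal ((1 - of_rat a) powr N) = 0" by simp
    moreover have "real_of_rat a < 1" using ab01 by simp
    then have "0 < (1 - real_of_rat a) powr N" by simp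
    ultimately show False by (simp add: ennreal_eq_0_iff)
  qed
  moreover have "splitting_starts a b \<subseteq> fst ` {p \<in> E. snd p (True, b) \<noteq> snd p (False, b)}"
  proof
    fix y assume "y \<in> splitting_starts a b"
    then obtain \<gamma>1 \<gamma>2 where g: "geodesic_between \<gamma>1 y x" "geodesic_between \<gamma>2 y x"
      "\<gamma>1 (of_rat a) = \<gamma>2 (of_rat a)" "\<gamma>1 (of_rat b) \<noteq> \<gamma>2 (of_rat b)"
      unfolding splitting_starts_def by blast
    have "\<gamma>1 0 = y" "\<gamma>2 0 = y" using g(1,2) by (auto simp: geodesic_between_def)
    then have "(y, \<lambda>(i, r). if i then \<gamma>1 (of_rat r) else \<gamma>2 (of_rat r)) \<in> {p \<in> E. snd p (True, b) \<noteq> snd p (False, b)}"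
      using g code_pair_to_of_geodesics[OF g(1,2)] by (simp add: E_def)
    then show "y \<in> fst ` {p \<in> E. snd p (True, b) \<noteq> snd p (False, b)}" by force
  qed
  ultimately show ?thesis by blast
qed

section \<open>Finiteness on bounded sets\<close>

lemma finite_restriction:
  assumes "B \<in> sets borel" "emeasure m B < \<top>"
  shows "finite_measure (density m (indicator B))" "sets (density m (indicator B)) = sets borel"
    "A \<in> sets borel \<Longrightarrow> emeasure (density m (indicator B)) A = emeasure m (A \<inter> B)"
proof -
  have e: "emeasure (density m (indicator B)) A = emeasure m (A \<inter> B)" if "A \<in> sets borel" for A
    using that assms(1) sets_m by (intro emeasure_density_indicator_set) auto
  then show "A \<in> sets borel \<Longrightarrow> emeasure (density m (indicator B)) A = emeasure m (A \<inter> B)" .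
  show "finite_measure (density m (indicator B))"
    by (rule finite_measureI) (use assms e[of UNIV] in simp)
  show "sets (density m (indicator B)) = sets borel" by (simp add: sets_m)
qed

lemma compact_inner_regular:
  assumes B: "B \<in> sets borel" "emeasure m B < \<top>" and e: "0 < e"
  shows "\<exists>K. compact K \<and> K \<subseteq> B \<and> emeasure m B \<le> emeasure m K + ennreal e"
proof -
  note r = finite_restriction[OF B]
  obtain K where K: "compact K" "K \<subseteq> B"
    "emeasure (density m (indicator B)) B \<le> emeasure (density m (indicator B)) K + ennreal e"
    using compact_inner_approx[OF D r(1,2) B(1) e] by blast
  have "K \<in> sets borel" using K(1) by (simp add: compact_imp_closed)
  then have "emeasure m B \<le> emeasure m K + ennreal e"
    using K(2,3) r(3)[of K] r(3)[OF B(1)] by (simp add: Int_absorb2)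
  then show ?thesis using K by blast
qed

text \<open>
  Compactness of the pieces is what makes the midpoint relation below closed.
\<close>

lemma compact_exhaustion:
  obtains K :: "nat \<Rightarrow> 'a set" where "\<And>n. compact (K n)" "incseq K" "\<And>n. emeasure m (K n) < \<top>"
    "emeasure m (UNIV - (\<Union>n. K n)) = 0"
proof -
  obtain B where B: "incseq B" "\<And>n. B n \<in> sets borel" "\<And>n. B n \<subseteq> cball x (real n)"
    "\<And>n. emeasure m (B n) < \<top>" "(\<Union>n. B n) = UNIV"
    using incseq_bounded_finite_cover by blast
  have "\<exists>K. compact K \<and> K \<subseteq> B n \<and> emeasure m (B n) \<le> emeasure m K + ennreal (inverse (Suc j))" for n j
    by (rule compact_inner_regular[OF B(2,4)]) simp
  then obtain L where L: "\<And>n j. compact (L n j)" "\<And>n j. L n j \<subseteq> B n"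
    "\<And>n j. emeasure m (B n) \<le> emeasure m (L n j) + ennreal (inverse (Suc j))" by metis
  define K where "K k = (\<Union>n\<in>{..k}. \<Union>j\<in>{..k}. L n j)" for k
  have cK: "compact (K k)" for k unfolding K_def using L(1) by (intro compact_UN) auto
  have LB: "L n j \<in> sets m" for n j using L(1)[of n j] sets_m by (simp add: compact_imp_closed)
  have KB: "K k \<subseteq> B k" for k
  proof
    fix w assume "w \<in> K k"
    then obtain n j where "n \<le> k" "w \<in> L n j" by (auto simp: K_def)
    then show "w \<in> B k" using L(2)[of n j] incseqD[OF B(1), of n k] by blast
  qed
  have Bs: "B n \<in> sets m" for n using B(2) sets_m by simp
  have fin: "emeasure m (K k) < \<top>" for k
    by (rule order_le_less_trans[OF emeasure_mono[OF KB Bs] B(4)])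
  have null: "B n - (\<Union>j. L n j) \<in> null_sets m" for n
    by (rule measure_exhausted_null[OF Bs LB L(2) order_le_less_trans[OF emeasure_mono[OF L(2) Bs] B(4)] L(3)])
  have sub: "UNIV - (\<Union>k. K k) \<subseteq> (\<Union>n. B n - (\<Union>j. L n j))"
  proof
    fix w assume w: "w \<in> UNIV - (\<Union>k. K k)"
    have "w \<in> (\<Union>n. B n)" using B(5) by simp
    then obtain n where n: "w \<in> B n" by (rule UN_E)
    have "w \<notin> L n j" for j
      using w by (auto simp: K_def dest: spec[of _ "max n j"])
    then show "w \<in> (\<Union>n. B n - (\<Union>j. L n j))" using n by blast
  qed
  have meas: "UNIV - (\<Union>k. K k) \<in> sets m"
  proof -
    have "K k \<in> sets m" for k using cK[of k] sets_m by (simp add: compact_imp_closed)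
    then show ?thesis using sets_m by auto
  qed
  have "UNIV - (\<Union>k. K k) \<in> null_sets m"
    by (rule null_sets_subset[OF null_sets_UN[OF null] meas sub])
  then have nullK: "emeasure m (UNIV - (\<Union>n. K n)) = 0" by (rule null_setsD1)
  have incK: "incseq K" unfolding K_def incseq_def by (auto intro: order_trans)
  show ?thesis by (rule that[OF cK incK fin nullK])
qed

lemma geodesic_through_midpoint:
  fixes y z a :: 'a
  assumes "dist y z = dist y a / 2" "dist z a = dist y a / 2"
  shows "\<exists>\<gamma>. geodesic_between \<gamma> y a \<and> \<gamma> (of_rat (1/2)) = z"
proof -
  obtain \<gamma>1 where g1: "geodesic_between \<gamma>1 y z" using ex_geodesic[of y z] by blast
  obtain \<gamma>2 where g2: "geodesic_between \<gamma>2 z a" using ex_geodesic[of z a] by blast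
  define \<alpha> where "\<alpha> u = \<gamma>1 (2 * u)" for u
  define \<beta> where "\<beta> u = \<gamma>2 (2 * u - 1)" for u
  have e: "\<alpha> 0 = y" "\<beta> 1 = a" "\<alpha> (1/2) = z" "\<beta> (1/2) = z"
    using g1 g2 by (auto simp: \<alpha>_def \<beta>_def geodesic_between_def)
  have "geodesic_between (\<lambda>u. if u \<le> 1/2 then \<alpha> u else \<beta> u) (\<alpha> 0) (\<beta> 1)"
  proof (rule geodesic_join)
    fix s t :: real assume st: "0 \<le> s" "s \<le> t" "t \<le> 1/2"
    have "dist (\<alpha> s) (\<alpha> t) = \<bar>2 * s - 2 * t\<bar> * dist y z"
      unfolding \<alpha>_def using st by (intro geodesic_betweenD[OF g1]) auto
    also have "\<bar>2 * s - 2 * t\<bar> = 2 * (t - s)" using st by simp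
    finally have "dist (\<alpha> s) (\<alpha> t) = 2 * (t - s) * (dist y a / 2)" by (simp only: assms(1))
    then show "dist (\<alpha> s) (\<alpha> t) \<le> (t - s) * dist (\<alpha> 0) (\<beta> 1)"
      by (simp add: e algebra_simps)
  next
    fix s t :: real assume st: "1/2 \<le> s" "s \<le> t" "t \<le> 1"
    have "dist (\<beta> s) (\<beta> t) = \<bar>(2 * s - 1) - (2 * t - 1)\<bar> * dist z a"
      unfolding \<beta>_def using st by (intro geodesic_betweenD[OF g2]) auto
    also have "\<bar>(2 * s - 1) - (2 * t - 1)\<bar> = 2 * (t - s)" using st by simp
    finally have "dist (\<beta> s) (\<beta> t) = 2 * (t - s) * (dist y a / 2)" by (simp only: assms(2))
    then show "dist (\<beta> s) (\<beta> t) \<le> (t - s) * dist (\<alpha> 0) (\<beta> 1)"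
      by (simp add: e algebra_simps)
  qed (auto simp: e)
  then show ?thesis
    by (intro exI[of _ "\<lambda>u. if u \<le> 1/2 then \<alpha> u else \<beta> u"]) (simp add: e of_rat_divide)
qed

text \<open>
  Let \<open>R n\<close> relate two points that have a midpoint in the compact set \<open>K n\<close>. For a fixed \<open>A\<close> of positive finite
  measure, contraction towards \<open>y\<close> shows that the sections of \<open>R n\<close> over \<open>y\<close> exhaust almost all of \<open>A\<close>, because the
  complement of the \<open>K n\<close> is null. By upper semicontinuity the points \<open>y\<close> for which the section of \<open>R n\<close> has at least
  half the measure of \<open>A\<close> form a closed set, and by Baire's theorem one of these sets contains a ball \<open>B\<close>. Contraction
  towards a point \<open>a\<close> bounds the measure of \<open>{y. (y, a) \<in> R n}\<close> by a multiple of the measure of \<open>K n\<close>.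
  Integrating over \<open>B \<times> A\<close> in both orders and dividing by the measure of \<open>A\<close> yields \<open>m(B) / 2 \<le> 2\<^sup>N m(K n)\<close>.
\<close>

lemma exists_finite_ball: "\<exists>p r. 0 < r \<and> emeasure m (ball p r) < \<top>"
proof -
  interpret sigma_finite_measure m by (rule sigma_fin)
  obtain K where K: "\<And>n. compact (K n)" "incseq K" "\<And>n. emeasure m (K n) < \<top>"
    "emeasure m (UNIV - (\<Union>n. K n)) = 0"
    using compact_exhaustion by blast
  have Ks: "K n \<in> sets borel" for n using K(1)[of n] by (simp add: compact_imp_closed)
  have half: "(1 - real_of_rat (1/2)) powr N = (1/2) powr N" by (simp add: of_rat_divide)
  define c where "c = (1/2::real) powr N"
  have c: "0 < c" by (simp add: c_def)
  define R where "R n = {p. \<exists>z\<in>K n. dist (fst p) z = dist (fst p) (snd p) / 2 \<and> dist z (snd p) = dist (fst p) (snd p) / 2}"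
    for n :: nat
  have cR: "closed (R n :: ('a \<times> 'a) set)" for n
  proof -
    let ?E = "{q :: ('a \<times> 'a) \<times> 'a. dist (fst (fst q)) (snd q) = dist (fst (fst q)) (snd (fst q)) / 2} \<inter>
      {q. dist (snd q) (snd (fst q)) = dist (fst (fst q)) (snd (fst q)) / 2}"
    have "closed ?E" by (intro closed_Int closed_Collect_eq continuous_intros) auto
    then have "closed (fst ` (?E \<inter> UNIV \<times> K n))" by (rule closed_projection_compact[OF _ K(1)])
    also have "fst ` (?E \<inter> UNIV \<times> K n) = R n" by (force simp: R_def)
    finally show ?thesis .
  qed
  have incR: "R n \<subseteq> R n'" if "n \<le> n'" for n n'
    using incseqD[OF K(2) that] unfolding R_def by blast
  obtain B where B: "incseq B" "\<And>n. B n \<in> sets borel" "\<And>n. B n \<subseteq> cball x (real n)"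
    "\<And>n. emeasure m (B n) < \<top>" "(\<Union>n. B n) = UNIV"
    using incseq_bounded_finite_cover by blast
  have "\<exists>n. emeasure m (B n) \<noteq> 0"
  proof (rule ccontr)
    assume "\<not> ?thesis"
    then have "(\<Union>n. B n) \<in> null_sets m" using B(2) sets_m by (intro null_sets_UN) auto
    then show False using B(5) nonzero by auto
  qed
  then obtain A where A: "A \<in> sets borel" "emeasure m A \<noteq> 0" "emeasure m A < \<top>" using B(2,4) by blast
  obtain \<alpha> where \<alpha>: "emeasure m A = ennreal \<alpha>" "0 < \<alpha>" using A(2,3) by (cases "emeasure m A") auto
  define S where "S n y = A \<inter> {a. (y, a) \<in> R n}" for n and y :: 'a
  have sec: "{a. (y, a) \<in> R n} \<in> sets borel" "{y. (y, a) \<in> R n} \<in> sets borel" for n and y a :: 'a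
    using continuous_closed_preimage[of UNIV "\<lambda>a. (y, a)" "R n"] continuous_closed_preimage[of UNIV "\<lambda>y. (y, a)" "R n"] cR
    by (simp_all add: vimage_def continuous_intros)
  have Ss: "S n y \<in> sets borel" for n y using A(1) sec by (simp add: S_def)
  \<comment> \<open>Here \<open>S n y\<close> consists of the points of \<open>A\<close> that have a midpoint with \<open>y\<close> in \<open>K n\<close>.\<close>
  define G where "G n = {y. ennreal (\<alpha>/2) \<le> emeasure m (S n y)}" for n
  have "closed (G n)" for n
    unfolding G_def S_def by (rule closed_superlevel_sections[OF cR sets_m A(1,3)])
  moreover have "(\<Union>n. G n) = UNIV"
  proof (intro equalityI subsetI)
    fix y :: 'a
    define A' where "A' = A - (\<Union>n. S n y)"
    have Us: "(\<Union>n. S n y) \<in> sets borel" using Ss by (intro sets.countable_UN) auto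
    have A's: "A' \<in> sets borel" unfolding A'_def using A(1) Us by (intro sets.Diff)
    have "ennreal ((1 - of_rat (1/2)) powr N) * emeasure m A' \<le> emeasure m (UNIV - (\<Union>n. K n))"
    proof (rule contraction_to[OF A's, where F = UNIV and x = y])
      show "UNIV - (\<Union>n. K n) \<in> sets borel" using Ks by auto
      fix a assume a: "a \<in> A'"
      show "\<exists>\<gamma>. geodesic_between \<gamma> a y \<and> \<gamma> (of_rat (1/2)) \<in> UNIV" using ex_geodesic by blast
      fix \<gamma> assume g: "geodesic_between \<gamma> a y"
      let ?z = "\<gamma> (of_rat (1/2))"
      have ends: "\<gamma> 0 = a" "\<gamma> 1 = y" using g by (auto simp: geodesic_between_def)
      have "dist y ?z = dist y a / 2" "dist ?z a = dist y a / 2"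
        using geodesic_betweenD[OF g, of 1 "of_rat (1/2)"] geodesic_betweenD[OF g, of "of_rat (1/2)" 0]
        by (auto simp: ends of_rat_divide dist_commute)
      then have "?z \<notin> K n" for n using a by (auto simp: A'_def S_def R_def)
      then show "?z \<in> UNIV - (\<Union>n. K n)" by blast
    qed auto
    then have "emeasure m A' = 0" using K(4) c unfolding half c_def[symmetric] by (simp add: ennreal_eq_0_iff)
    then have "emeasure m A \<le> emeasure m (\<Union>n. S n y)"
    proof -
      assume z: "emeasure m A' = 0"
      have "emeasure m A \<le> emeasure m (A' \<union> (\<Union>n. S n y))"
        using A's Us sets_m by (intro emeasure_mono sets.Un) (auto simp: A'_def)
      also have "\<dots> \<le> emeasure m A' + emeasure m (\<Union>n. S n y)"
        using A's Us sets_m by (intro emeasure_subadditive) auto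
      finally show ?thesis using z by simp
    qed
    also have "emeasure m (\<Union>n. S n y) = (SUP n. emeasure m (S n y))"
    proof (rule SUP_emeasure_incseq[symmetric])
      show "incseq (\<lambda>n. S n y)"
        unfolding incseq_def S_def using incR by blast
    qed (use Ss sets_m in auto)
    finally have "ennreal \<alpha> \<le> (SUP n. emeasure m (S n y))" unfolding \<alpha>(1) .
    moreover have "ennreal (\<alpha>/2) < ennreal \<alpha>" using \<alpha>(2) by (simp add: ennreal_less_iff)
    ultimately have "ennreal (\<alpha>/2) < (SUP n. emeasure m (S n y))" by (rule order_less_le_trans[rotated])
    then obtain n where "ennreal (\<alpha>/2) < emeasure m (S n y)" by (auto simp: less_SUP_iff)
    then show "y \<in> (\<Union>n. G n)" by (auto simp: G_def intro: less_imp_le)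
  qed simp
  ultimately obtain n p r where r: "0 < r" "ball p r \<subseteq> G n" using Baire_closed_cover_ball[of G] by metis
  have target: "emeasure m {y. (y, a) \<in> R n} \<le> ennreal (1 / c) * emeasure m (K n)" for a
  proof -
    have "ennreal ((1 - of_rat (1/2)) powr N) * emeasure m {y. (y, a) \<in> R n} \<le> emeasure m (K n)"
    proof (rule contraction_to[OF sec(2) Ks, where F = "K n" and x = a])
      show "closed (K n)" using K(1) by (rule compact_imp_closed)
      fix y assume "y \<in> {y. (y, a) \<in> R n}"
      then obtain z where "z \<in> K n" "dist y z = dist y a / 2" "dist z a = dist y a / 2"
        by (auto simp: R_def)
      then show "\<exists>\<gamma>. geodesic_between \<gamma> y a \<and> \<gamma> (of_rat (1/2)) \<in> K n"
        using geodesic_through_midpoint[of y z a] by blast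
    qed auto
    then have "ennreal (1 / c) * (ennreal c * emeasure m {y. (y, a) \<in> R n}) \<le> ennreal (1 / c) * emeasure m (K n)"
      unfolding half c_def[symmetric] by (intro mult_left_mono) auto
    then show ?thesis using c by (simp add: mult.assoc[symmetric] ennreal_mult'[symmetric])
  qed
  interpret P: pair_sigma_finite m m ..
  define f :: "'a \<Rightarrow> 'a \<Rightarrow> ennreal" where "f y a = indicator (ball p r) y * indicator (S n y) a" for y a
  have Rm: "R n \<in> sets (borel \<Otimes>\<^sub>M borel)"
  proof -
    have "- R n \<in> sets (borel \<Otimes>\<^sub>M borel)"
      using cR by (intro open_prod_in_pair_sets[OF D D]) auto
    from sets.compl_sets[OF this] show ?thesis by (simp add: space_pair_measure Compl_eq_Diff_UNIV double_diff)
  qed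
  have mm: "sets (m \<Otimes>\<^sub>M m) = sets (borel \<Otimes>\<^sub>M borel)" by (intro sets_pair_measure_cong sets_m)
  have fm: "case_prod f \<in> borel_measurable (m \<Otimes>\<^sub>M m)"
  proof -
    have "case_prod f = indicator ((ball p r \<times> A) \<inter> R n)"
      by (auto simp: f_def S_def fun_eq_iff split: split_indicator)
    moreover have "(ball p r \<times> A) \<inter> R n \<in> sets (m \<Otimes>\<^sub>M m)"
      unfolding mm using Rm A(1) by (intro sets.Int pair_measureI) auto
    ultimately show ?thesis by (simp add: borel_measurable_indicator)
  qed
  have "ennreal (\<alpha>/2) * emeasure m (ball p r) = (\<integral>\<^sup>+y. ennreal (\<alpha>/2) * indicator (ball p r) y \<partial>m)"
    using sets_m by (subst nn_integral_cmult_indicator) auto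
  also have "\<dots> \<le> (\<integral>\<^sup>+y. (\<integral>\<^sup>+a. f y a \<partial>m) \<partial>m)"
  proof (rule nn_integral_mono)
    fix y
    have "(\<integral>\<^sup>+a. f y a \<partial>m) = indicator (ball p r) y * emeasure m (S n y)"
      unfolding f_def using Ss sets_m by (subst nn_integral_cmult_indicator) auto
    then show "ennreal (\<alpha>/2) * indicator (ball p r) y \<le> (\<integral>\<^sup>+a. f y a \<partial>m)"
      using r(2) by (auto simp: G_def split: split_indicator)
  qed
  also have "\<dots> = (\<integral>\<^sup>+a. (\<integral>\<^sup>+y. f y a \<partial>m) \<partial>m)" using P.Fubini'[OF fm] by simp
  also have "\<dots> \<le> (\<integral>\<^sup>+a. (ennreal (1 / c) * emeasure m (K n)) * indicator A a \<partial>m)"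
  proof (rule nn_integral_mono)
    fix a
    have "(\<integral>\<^sup>+y. f y a \<partial>m) \<le> (\<integral>\<^sup>+y. indicator A a * indicator {y. (y, a) \<in> R n} y \<partial>m)"
      by (intro nn_integral_mono) (auto simp: f_def S_def split: split_indicator)
    also have "\<dots> = indicator A a * emeasure m {y. (y, a) \<in> R n}"
      using sec sets_m by (subst nn_integral_cmult_indicator) auto
    also have "\<dots> \<le> indicator A a * (ennreal (1 / c) * emeasure m (K n))"
      using target by (intro mult_left_mono) auto
    finally show "(\<integral>\<^sup>+y. f y a \<partial>m) \<le> (ennreal (1 / c) * emeasure m (K n)) * indicator A a"
      by (simp add: mult.commute)
  qed
  also have "\<dots> = (ennreal (1 / c) * emeasure m (K n)) * emeasure m A"
    using A(1) sets_m by (subst nn_integral_cmult_indicator) auto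
  also have "\<dots> < \<top>" using K(3)[of n] A(3) by (simp add: ennreal_mult_less_top)
  finally have "emeasure m (ball p r) < \<top>" using \<alpha>(2) by (auto simp: ennreal_mult_less_top)
  then show ?thesis using r(1) by blast
qed

text \<open>
  Every ball is contracted into a ball of finite measure at a time close to \<open>1\<close>.
\<close>

lemma bounded_finite:
  "emeasure m (cball q r) < \<top>"
proof -
  obtain p \<rho> where p: "0 < \<rho>" "emeasure m (ball p \<rho>) < \<top>" using exists_finite_ball by blast
  define L where "L = \<bar>r\<bar> + dist q p + 1"
  have L: "0 < L" by (simp add: L_def add_nonneg_pos)
  obtain s where s: "s \<in> {0..<1}" "(1 - real_of_rat s) * L < \<rho>"
  proof -
    have "max 0 (1 - \<rho> / L) < 1" using p(1) L by simp
    then obtain s where "max 0 (1 - \<rho> / L) < real_of_rat s" "real_of_rat s < 1"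
      using of_rat_dense by blast
    then show ?thesis using that[of s] L by (auto simp: field_simps)
  qed
  have "ennreal ((1 - of_rat s) powr N) * emeasure m (cball q r) \<le> emeasure m (ball p \<rho>)"
  proof (rule contraction_to[where F = UNIV and x = p, OF _ _ closed_UNIV s(1)])
    fix y assume y: "y \<in> cball q r"
    show "\<exists>\<gamma>. geodesic_between \<gamma> y p \<and> \<gamma> (of_rat s) \<in> UNIV" using ex_geodesic by blast
    fix \<gamma> assume g: "geodesic_between \<gamma> y p"
    have "dist y p \<le> L" using y dist_triangle[of y p q] by (auto simp: L_def dist_commute)
    have "dist (\<gamma> (of_rat s)) (\<gamma> 1) = (1 - of_rat s) * dist y p"
      using geodesic_betweenD[OF g, of "of_rat s" 1] s(1) by simp
    also have "\<dots> \<le> (1 - of_rat s) * L" using \<open>dist y p \<le> L\<close> s(1) by (intro mult_left_mono) auto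
    also note s(2)
    finally show "\<gamma> (of_rat s) \<in> ball p \<rho>" using g by (simp add: geodesic_between_def dist_commute)
  qed auto
  then have "ennreal ((1 - of_rat s) powr N) * emeasure m (cball q r) < \<top>" using p(2) by simp
  moreover have "0 < (1 - real_of_rat s) powr N" using s(1) by simp
  ultimately show ?thesis by (auto simp: ennreal_mult_less_top)
qed

section \<open>Prolongation of geodesics and uniqueness\<close>

text \<open>
  Let \<open>W\<close> be a Borel set of extendable points that contains almost all of them, and suppose that a compact set \<open>A\<close> disjoint
  from \<open>W\<close> has positive measure. Positions at time \<open>s = 1/(k+2)\<close> on geodesics from \<open>A\<close> to \<open>x\<close> are extendable, hence up to a null set
  outside \<open>A\<close>, and they lie in a neighbourhood \<open>U k\<close> of \<open>A\<close> that shrinks to \<open>A\<close>. So contraction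
  gives \<open>(1-s)\<^sup>N m(A) \<le> m(U k) - m(A)\<close>, and the right-hand side tends to \<open>0\<close> since \<open>m\<close> is finite on bounded sets.
\<close>

lemma extendable_almost_everywhere:
  "\<exists>Z\<in>null_sets m. \<forall>z. z \<notin> Z \<longrightarrow> (\<exists>r \<gamma> y. 0 < r \<and> r < 1 \<and> geodesic_between \<gamma> y x \<and> \<gamma> (of_rat r) = z)"
proof -
  define I where "I = {r::rat. 0 < r \<and> r < 1}"
  define E where "E r = {p::'a \<times> 'a geodesic_code. code_pair_to x (snd p)} \<inter> {p. snd p (True, r) = fst p}" for r
  have "closed (E r)" for r unfolding E_def by (intro closed_Int closed_code_pair_to closed_code_eq_fst)
  moreover have "\<forall>p\<in>E r. code_pair_to x (snd p)" for r by (auto simp: E_def)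
  ultimately have "\<forall>r. \<exists>V Z. V \<in> sets borel \<and> V \<subseteq> fst ` E r \<and> Z \<in> null_sets m \<and> fst ` E r \<subseteq> V \<union> Z"
    by (intro allI projection_measurable_up_to_null)
  then obtain V Z where VZ: "\<And>r. V r \<in> sets borel" "\<And>r. V r \<subseteq> fst ` E r" "\<And>r. Z r \<in> null_sets m" "\<And>r. fst ` E r \<subseteq> V r \<union> Z r"
    by metis
  have in_E: "\<gamma> (of_rat r) \<in> fst ` E r" if "geodesic_between \<gamma> y x" for \<gamma> y r
  proof -
    have "(\<gamma> (of_rat r), \<lambda>(i, r). if i then \<gamma> (of_rat r) else \<gamma> (of_rat r)) \<in> E r"
      using code_pair_to_of_geodesics[OF that that] by (simp add: E_def)
    then show ?thesis by force
  qed
  have E_ext: "\<exists>\<gamma> y. geodesic_between \<gamma> y x \<and> \<gamma> (of_rat r) = z" if "z \<in> fst ` E r" "r \<in> I" for z r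
  proof -
    obtain g where g: "(z, g) \<in> E r" using \<open>z \<in> fst ` E r\<close> by (metis imageE prod.collapse)
    then have rg: "rat_geodesic_to x (\<lambda>r. g (True, r))" by (simp add: E_def code_pair_to_def)
    have "extend_rat (\<lambda>r. g (True, r)) (of_rat r) = z"
      using extend_rat_of_rat[OF rg, of r] that(2) g by (simp add: I_def E_def)
    then show ?thesis using geodesic_between_extend_rat[OF rg] by blast
  qed
  have cI: "countable I" by (simp add: I_def)
  define W where "W = (\<Union>r\<in>I. V r)"
  define Y where "Y = (\<Union>r\<in>I. Z r)"
  have W: "W \<in> sets borel" unfolding W_def using cI VZ(1) by (intro sets.countable_UN') auto
  have Y: "Y \<in> null_sets m" unfolding Y_def using cI VZ(3) by (rule null_sets_UN')
  obtain B where B: "incseq B" "\<And>n. B n \<in> sets borel" "\<And>n. B n \<subseteq> cball x (real n)"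
    "\<And>n. emeasure m (B n) < \<top>" "(\<Union>n. B n) = UNIV"
    using incseq_bounded_finite_cover by blast
  have "B n - W \<in> null_sets m" for n
  proof (rule ccontr)
    assume "B n - W \<notin> null_sets m"
    moreover have meas: "B n - W \<in> sets borel" using B(2) W by (intro sets.Diff)
    ultimately have pos: "emeasure m (B n - W) \<noteq> 0" using sets_m by (auto simp: null_setsI)
    have Bm: "B n \<in> sets m" using B(2) sets_m by simp
    have fin: "emeasure m (B n - W) < \<top>"
      by (rule order_le_less_trans[OF emeasure_mono[OF Diff_subset Bm] B(4)])
    obtain \<beta> where \<beta>: "emeasure m (B n - W) = ennreal \<beta>" "0 < \<beta>"
      using pos fin by (cases "emeasure m (B n - W)") auto
    obtain A where A: "compact A" "A \<subseteq> B n - W" "emeasure m (B n - W) \<le> emeasure m A + ennreal (\<beta>/2)"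
      using compact_inner_regular[OF meas fin, of "\<beta>/2"] \<beta>(2) by auto
    have As: "A \<in> sets m" "A \<in> sets borel" "closed A" using A(1) sets_m by (simp_all add: compact_imp_closed)
    have "emeasure m A \<noteq> 0"
      using A(3) \<beta> by (auto simp: )
    then have "A \<noteq> {}" by auto
    have Ax: "A \<subseteq> cball x (real n)" using A(2) B(3) by blast
    define U where "U k = {w. infdist w A \<le> real n / (real k + 2)} \<inter> cball x (2 * real n + 1)" for k :: nat
    have Uc: "closed (U k)" for k
      unfolding U_def by (intro closed_Int closed_Collect_le continuous_intros) auto
    have Um: "U k \<in> sets m" for k using Uc sets_m by simp
    have Ufin: "emeasure m (U k) < \<top>" for k
      by (rule order_le_less_trans[OF emeasure_mono bounded_finite[of x "2 * real n + 1"]]) (auto simp: U_def sets_m)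
    have step0: "(\<lambda>k. 1 / (real k + 2)) \<longlonglongrightarrow> 0"
      using LIMSEQ_Suc[OF LIMSEQ_inverse_real_of_nat] by (simp add: inverse_eq_divide add.commute)
    have "decseq U"
    proof (rule decseq_SucI)
      fix k
      have "real n / (real (Suc k) + 2) \<le> real n / (real k + 2)" by (intro divide_left_mono) auto
      then show "U (Suc k) \<subseteq> U k" unfolding U_def by auto
    qed
    then have "(\<lambda>k. emeasure m (U k)) \<longlonglongrightarrow> emeasure m (\<Inter>k. U k)"
      using Um Ufin by (intro Lim_emeasure_decseq) (auto simp: less_top)
    moreover have "(\<Inter>k. U k) = A"
    proof (intro equalityI subsetI)
      fix w assume w: "w \<in> (\<Inter>k. U k)"
      have lim: "(\<lambda>k. real n / (real k + 2)) \<longlonglongrightarrow> 0"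
        using tendsto_mult_right_zero[OF step0, of "real n"] by simp
      have "infdist w A \<le> 0"
        by (rule LIMSEQ_le_const[OF lim]) (use w in \<open>auto simp: U_def\<close>)
      then have "infdist w A = 0" using infdist_nonneg[of w A] by linarith
      then show "w \<in> A" using As(3) \<open>A \<noteq> {}\<close> in_closed_iff_infdist_zero by blast
    next
      fix w assume "w \<in> A"
      then show "w \<in> (\<Inter>k. U k)" using Ax by (auto simp: U_def)
    qed
    ultimately have lim1: "(\<lambda>k. emeasure m (U k)) \<longlonglongrightarrow> emeasure m A" by simp
    have Afin: "emeasure m A < \<top>"
      using A(2) fin emeasure_mono[OF A(2)] meas sets_m by (metis order_le_less_trans)
    obtain \<alpha> where \<alpha>: "emeasure m A = ennreal \<alpha>" "0 < \<alpha>"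
      using \<open>emeasure m A \<noteq> 0\<close> Afin by (cases "emeasure m A") auto
    define u where "u k = enn2real (emeasure m (U k))" for k
    have u: "emeasure m (U k) = ennreal (u k)" "0 \<le> u k" for k using Ufin[of k] by (auto simp: u_def)
    have ulim: "u \<longlonglongrightarrow> \<alpha>"
      using lim1 \<alpha> u by (simp add: tendsto_ennreal_iff)
    have main: "(1 - 1 / (real k + 2)) powr N * \<alpha> \<le> u k - \<alpha>" for k
    proof -
      define s where "s = 1 / (rat_of_nat k + 2)"
      have s: "real_of_rat s = 1 / (real k + 2)" "s \<in> I" "s \<in> {0..<1}"
        by (auto simp: s_def I_def of_rat_divide of_rat_add divide_simps)
      have "ennreal ((1 - of_rat s) powr N) * emeasure m A \<le> emeasure m ((U k - A) \<union> Y)"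
      proof (rule contraction[OF As(2) _ closed_UNIV s(3)])
        show "(U k - A) \<union> Y \<in> sets borel" using Um As Y sets_m by auto
        fix y assume y: "y \<in> A"
        show "\<exists>\<gamma>. geodesic_between \<gamma> y x \<and> \<gamma> (of_rat s) \<in> UNIV" using ex_geodesic by blast
        fix \<gamma> assume g: "geodesic_between \<gamma> y x"
        let ?w = "\<gamma> (of_rat s)"
        have yx: "dist y x \<le> real n" using y Ax by (auto simp: dist_commute)
        have ends: "\<gamma> 0 = y" "\<gamma> 1 = x" using g by (auto simp: geodesic_between_def)
        have s01: "real_of_rat s \<in> {0..1}" using s(3) by simp
        have d: "dist ?w y = of_rat s * dist y x"
          using geodesic_betweenD[OF g s01, of 0] s01 ends by simp
        have "infdist ?w A \<le> dist ?w y" using y by (rule infdist_le)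
        also have "\<dots> \<le> of_rat s * real n" unfolding d using yx s01 by (intro mult_left_mono) auto
        also have "\<dots> = real n / (real k + 2)" by (simp add: s(1))
        finally have 1: "infdist ?w A \<le> real n / (real k + 2)" .
        have "dist ?w x = (1 - of_rat s) * dist y x"
          using geodesic_betweenD[OF g s01, of 1] s01 ends by simp
        also have "\<dots> \<le> 1 * dist y x" using s01 by (intro mult_right_mono) auto
        finally have 2: "?w \<in> cball x (2 * real n + 1)" using yx by (simp add: dist_commute)
        have "?w \<in> V s \<union> Z s" using in_E[OF g] VZ(4) by blast
        moreover have "V s \<subseteq> W" "Z s \<subseteq> Y" using s(2) by (auto simp: W_def Y_def)
        ultimately have "?w \<in> W \<union> Y" by blast
        then show "?w \<in> (U k - A) \<union> Y" using 1 2 A(2) by (auto simp: U_def)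
      qed
      also have "\<dots> = emeasure m (U k - A)"
        using Y Um As by (intro emeasure_Un_null_set) auto
      also have "\<dots> = emeasure m (U k) - emeasure m A"
        using Um As Afin Ax \<open>(\<Inter>k. U k) = A\<close> by (intro emeasure_Diff) auto
      also have "\<dots> = ennreal (u k - \<alpha>)" unfolding u(1) \<alpha>(1) using \<alpha>(2) by (simp add: ennreal_minus)
      finally have le: "ennreal ((1 - of_rat s) powr N * \<alpha>) \<le> ennreal (u k - \<alpha>)"
        unfolding \<alpha>(1) using \<alpha>(2) by (simp add: ennreal_mult')
      have "A \<subseteq> U k" using \<open>(\<Inter>k. U k) = A\<close> by blast
      then have "ennreal \<alpha> \<le> ennreal (u k)" unfolding u(1)[symmetric] \<alpha>(1)[symmetric] using Um by (intro emeasure_mono)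
      then have "0 \<le> u k - \<alpha>" using u(2) by simp
      then show ?thesis using le by (simp add: s(1))
    qed
    have lhs: "(\<lambda>k. (1 - 1 / (real k + 2)) powr N * \<alpha>) \<longlonglongrightarrow> (1 - 0) powr N * \<alpha>"
    proof -
      show ?thesis by (intro tendsto_intros step0) auto
    qed
    have "(1 - 0) powr N * \<alpha> \<le> \<alpha> - \<alpha>"
      by (rule LIMSEQ_le[OF lhs tendsto_diff[OF ulim tendsto_const]]) (use main in auto)
    then show False using \<alpha>(2) by simp
  qed
  then have "(\<Union>n. B n - W) \<in> null_sets m" by (rule null_sets_UN)
  moreover have "(\<Union>n. B n - W) = UNIV - W" using B(5) by auto
  ultimately have null: "UNIV - W \<in> null_sets m" by simp
  show ?thesis
  proof (intro bexI[OF _ null] allI impI)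
    fix z assume "z \<notin> UNIV - W"
    then obtain r where r: "r \<in> I" "z \<in> V r" by (auto simp: W_def)
    then have "z \<in> fst ` E r" using VZ(2) by blast
    from E_ext[OF this r(1)] show "\<exists>r \<gamma> y. 0 < r \<and> r < 1 \<and> geodesic_between \<gamma> y x \<and> \<gamma> (of_rat r) = z"
      using r(1) by (auto simp: I_def)
  qed
qed

text \<open>
  The last common time \<open>\<tau>\<close> before a time of disagreement decides between the two null sets, as
  explained at the beginning.
\<close>

lemma branching_null:
  "\<exists>Z\<in>null_sets m. {y. \<exists>\<gamma>1 \<gamma>2. geodesic_between \<gamma>1 y x \<and> geodesic_between \<gamma>2 y x \<and> (\<exists>t\<in>{0..1}. \<gamma>1 t \<noteq> \<gamma>2 t)} \<subseteq> Z"
    (is "\<exists>Z\<in>_. ?bad \<subseteq> Z")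
proof -
  define P where "P = (\<lambda>(a, b). fork_points a b)"
  define Q where "Q = (\<lambda>(a, b). splitting_starts a b)"
  define I where "I = {(a, b). close_times a b}"
  have cI: "countable I" by simp
  have "\<exists>Z\<in>null_sets m. P i \<subseteq> Z" if "i \<in> I" for i
    using fork_points_null[of "fst i" "snd i"] that by (simp add: I_def P_def case_prod_beta)
  then obtain Z1 where Z1: "Z1 \<in> null_sets m" "(\<Union>i\<in>I. P i) \<subseteq> Z1"
    using null_cover_UN[OF cI, of m P] by blast
  have "\<exists>Z\<in>null_sets m. Q i \<subseteq> Z" if "i \<in> I" for i
    using splitting_starts_null[of "fst i" "snd i"] that by (simp add: I_def Q_def case_prod_beta)
  then obtain Z2 where Z2: "Z2 \<in> null_sets m" "(\<Union>i\<in>I. Q i) \<subseteq> Z2"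
    using null_cover_UN[OF cI, of m Q] by blast
  obtain Z3 where Z3: "Z3 \<in> null_sets m"
    "\<And>z. z \<notin> Z3 \<Longrightarrow> \<exists>r \<gamma> y. 0 < r \<and> r < 1 \<and> geodesic_between \<gamma> y x \<and> \<gamma> (of_rat r) = z"
    using extendable_almost_everywhere by blast
  have "?bad \<subseteq> Z1 \<union> Z2 \<union> Z3"
  proof
    fix y assume "y \<in> ?bad"
    then obtain \<gamma>1 \<gamma>2 t where g1: "geodesic_between \<gamma>1 y x" and g2: "geodesic_between \<gamma>2 y x"
      and t: "t \<in> {0..1}" "\<gamma>1 t \<noteq> \<gamma>2 t" by blast
    have ends: "\<gamma>1 0 = y" "\<gamma>2 0 = y" "\<gamma>1 1 = x" "\<gamma>2 1 = x" using g1 g2 by (auto simp: geodesic_between_def)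
    have t01: "0 < t" "t < 1" using t ends by (auto simp: less_le) 
    \<comment> \<open>The agreement times up to \<open>t\<close> form a compact set that contains \<open>0\<close>.\<close>
    define S where "S = {s \<in> {0..t}. dist (\<gamma>1 s) (\<gamma>2 s) = 0}"
    have "compact S"
    proof -
      have "continuous_on {0..1} \<gamma>1" "continuous_on {0..1} \<gamma>2"
        using g1 g2 unfolding geodesic_between_def by blast+
      moreover have "{0..t} \<subseteq> {0..1}" using t01 by auto
      ultimately have c: "continuous_on {0..t} \<gamma>1" "continuous_on {0..t} \<gamma>2"
        using continuous_on_subset by blast+
      have "S = {0..t} \<inter> (\<lambda>s. dist (\<gamma>1 s) (\<gamma>2 s)) -` {0}" by (auto simp: S_def)
      then have "closed S"
        using continuous_closed_preimage[OF continuous_on_dist[OF c] closed_atLeastAtMost closed_singleton] by simp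
      then have "compact ({0..t} \<inter> S)" by (intro compact_Int_closed compact_Icc)
      moreover have "{0..t} \<inter> S = S" by (auto simp: S_def)
      ultimately show ?thesis by simp
    qed
    moreover have "S \<noteq> {}" using t01 ends by (auto simp: S_def intro!: exI[of _ 0])
    ultimately obtain \<tau> where \<tau>: "\<tau> \<in> S" "\<And>s. s \<in> S \<Longrightarrow> s \<le> \<tau>"
      using compact_attains_sup[of S] by blast
    have \<tau>0: "0 \<le> \<tau>" "\<tau> \<le> t" "\<gamma>1 \<tau> = \<gamma>2 \<tau>" using \<tau>(1) by (auto simp: S_def)
    have "\<tau> \<noteq> t" using \<tau>0 t by auto
    then have \<tau>t: "\<tau> < t" using \<tau>0 by simp
    have diff: "\<gamma>1 s \<noteq> \<gamma>2 s" if "\<tau> < s" "s \<le> t" for s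
      using \<tau>(2)[of s] that \<tau>0 by (auto simp: S_def)
    show "y \<in> Z1 \<union> Z2 \<union> Z3"
    proof (cases "\<tau> = 0")
      case False
      then have "0 < \<tau>" "\<tau> < 1" using \<tau>0 \<tau>t t01 by auto
      then obtain e where e: "0 < e" "e \<le> t - \<tau>" "\<And>a b. \<tau> - e < of_rat a \<Longrightarrow> of_rat a \<le> \<tau> \<Longrightarrow> \<tau> < of_rat b \<Longrightarrow> of_rat b < \<tau> + e \<Longrightarrow> close_times a b"
        using close_times_near[of \<tau> "t - \<tau>"] \<tau>t by auto
      obtain a where a: "\<tau> - e < of_rat a" "of_rat a < \<tau>" using of_rat_dense[of "\<tau> - e" \<tau>] e(1) by auto
      obtain b where b: "\<tau> < of_rat b" "of_rat b < \<tau> + e" using of_rat_dense[of \<tau> "\<tau> + e"] e(1) by auto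
      have ab: "(a, b) \<in> I" using e(3)[OF a(1) _ b] a(2) by (simp add: I_def)
      \<comment> \<open>The two geodesics need not agree before \<open>\<tau>\<close>; following the first one up to \<open>\<tau>\<close> makes them agree
        at the rational time \<open>a\<close>.\<close>
      define \<gamma> where "\<gamma> u = (if u \<le> \<tau> then \<gamma>1 u else \<gamma>2 u)" for u
      have "geodesic_between (\<lambda>u. if u \<le> \<tau> then \<gamma>1 u else \<gamma>2 u) (\<gamma>1 0) (\<gamma>2 1)"
      proof (rule geodesic_join)
        fix s r assume "0 \<le> s" "s \<le> r" "r \<le> \<tau>"
        then show "dist (\<gamma>1 s) (\<gamma>1 r) \<le> (r - s) * dist (\<gamma>1 0) (\<gamma>2 1)"
          using geodesic_betweenD[OF g1, of s r] \<open>\<tau> < 1\<close> by (simp add: ends)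
      next
        fix s r assume "\<tau> \<le> s" "s \<le> r" "r \<le> 1"
        then show "dist (\<gamma>2 s) (\<gamma>2 r) \<le> (r - s) * dist (\<gamma>1 0) (\<gamma>2 1)"
          using geodesic_betweenD[OF g2, of s r] \<tau>0 by (simp add: ends)
      qed (use \<tau>0 \<open>\<tau> < 1\<close> in auto)
      then have "geodesic_between \<gamma> y x" by (simp add: ends \<gamma>_def[abs_def])
      moreover have "\<gamma>1 (of_rat a) = \<gamma> (of_rat a)" using a by (simp add: \<gamma>_def)
      moreover have "\<gamma>1 (of_rat b) \<noteq> \<gamma> (of_rat b)"
        using diff[of "of_rat b"] b e(2) by (simp add: \<gamma>_def)
      ultimately have "y \<in> Q (a, b)" using g1 by (auto simp: Q_def splitting_starts_def)
      then show ?thesis using ab Z2(2) by blast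
    next
      case True
      show ?thesis
      proof (rule ccontr)
        assume "y \<notin> Z1 \<union> Z2 \<union> Z3"
        then obtain r \<gamma> w where r: "0 < r" "r < 1" and g: "geodesic_between \<gamma> w x" "\<gamma> (of_rat r) = y"
          using Z3(2)[of y] by blast
        let ?r = "real_of_rat r"
        have r01: "0 < ?r" "?r < 1" using r by simp_all
        \<comment> \<open>Prolonging both geodesics backwards by \<open>\<gamma>\<close> puts their common start \<open>y\<close> at the positive time \<open>r\<close>.\<close>
        define c where "c f u = (if u \<le> ?r then \<gamma> u else f ((u - ?r) / (1 - ?r)))" for f :: "real \<Rightarrow> 'a" and u
        have gends: "\<gamma> 0 = w" "\<gamma> 1 = x" using g by (auto simp: geodesic_between_def)
        have dyx: "dist y x = (1 - ?r) * dist w x"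
          using geodesic_betweenD[OF g(1), of ?r 1] r01 g(2) gends by simp
        have cgeo: "geodesic_between (c f) w x" if f: "geodesic_between f y x" for f
        proof -
          let ?f = "\<lambda>u. f ((u - ?r) / (1 - ?r))"
          have fe: "f 0 = y" "f 1 = x" using f by (auto simp: geodesic_between_def)
          have f1: "?f 1 = x" using r01 fe by simp
          have "geodesic_between (\<lambda>u. if u \<le> ?r then \<gamma> u else ?f u) (\<gamma> 0) (?f 1)"
          proof (rule geodesic_join)
            fix s r' assume "0 \<le> s" "s \<le> r'" "r' \<le> ?r"
            then show "dist (\<gamma> s) (\<gamma> r') \<le> (r' - s) * dist (\<gamma> 0) (?f 1)"
              using geodesic_betweenD[OF g(1), of s r'] r01 by (simp add: gends fe)
          next
            fix s r' assume sr: "?r \<le> s" "s \<le> r'" "r' \<le> 1"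
            have m: "(s - ?r) / (1 - ?r) \<le> (r' - ?r) / (1 - ?r)" using sr r01 by (intro divide_right_mono) auto
            have "dist (?f s) (?f r') = \<bar>(s - ?r) / (1 - ?r) - (r' - ?r) / (1 - ?r)\<bar> * dist y x"
              using sr r01 by (intro geodesic_betweenD[OF f]) (auto simp: field_simps)
            also have "\<dots> = ((r' - ?r) / (1 - ?r) - (s - ?r) / (1 - ?r)) * dist y x" using m by simp
            also have "\<dots> = (r' - s) / (1 - ?r) * dist y x" by (simp add: diff_divide_distrib[symmetric])
            also have "\<dots> = (r' - s) * dist w x" using r01 by (simp add: dyx)
            finally show "dist (?f s) (?f r') \<le> (r' - s) * dist (\<gamma> 0) (?f 1)" by (simp only: gends f1 order_refl)
          qed (use r01 g(2) fe in auto)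
          then show ?thesis unfolding gends f1 by (simp add: c_def[abs_def])
        qed
        have "0 < t * (1 - ?r)" using t01 r01 by simp
        then obtain e where e: "0 < e" "e \<le> t * (1 - ?r)" "\<And>a b. ?r - e < of_rat a \<Longrightarrow> of_rat a \<le> ?r \<Longrightarrow> ?r < of_rat b \<Longrightarrow> of_rat b < ?r + e \<Longrightarrow> close_times a b"
          using close_times_near[OF r01, of "t * (1 - ?r)"] by auto
        obtain b where b: "?r < of_rat b" "of_rat b < ?r + e" using of_rat_dense[of ?r "?r + e"] e(1) by auto
        have ab: "(r, b) \<in> I" using e(3)[of r b] e(1) b by (simp add: I_def)
        let ?s = "(of_rat b - ?r) / (1 - ?r)"
        have s: "0 < ?s" "?s \<le> t" using b e(2) r01 by (auto simp: divide_simps)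
        have "c \<gamma>1 (of_rat b) \<noteq> c \<gamma>2 (of_rat b)"
          using diff[of ?s] s b(1) True by (simp add: c_def)
        moreover have "c \<gamma>1 ?r = y" "c \<gamma>2 ?r = y" using g(2) by (simp_all add: c_def)
        ultimately have "y \<in> P (r, b)"
          using cgeo[OF g1] cgeo[OF g2] by (auto simp: P_def fork_points_def)
        then show False using ab Z1(2) \<open>y \<notin> Z1 \<union> Z2 \<union> Z3\<close> by blast
      qed
    qed
  qed
  moreover have "Z1 \<union> Z2 \<union> Z3 \<in> null_sets m" using Z1(1) Z2(1) Z3(1) by (intro null_sets.Un)
  ultimately show ?thesis by blast
qed

end

theorem theorem1p6:
  fixes m :: "'a::complete_space measure" and N :: real and x :: 'a
  assumes "geodesic_space TYPE('a)"
    and "sets m = sets borel"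
    and "sigma_finite_measure m"
    and "measure_support m = UNIV"
    and "1 \<le> N"
    and "strongly_displacement_convex (renyi_entropy N m)"
  shows "{y. \<exists>\<gamma>\<^sub>1 \<gamma>\<^sub>2. geodesic_between \<gamma>\<^sub>1 x y \<and> geodesic_between \<gamma>\<^sub>2 x y \<and>
             (\<exists>t\<in>{0..1}. \<gamma>\<^sub>1 t \<noteq> \<gamma>\<^sub>2 t)} \<in> null_sets (completion m)"
proof -
  obtain D :: "'a set" where D: "countable D" "closure D = UNIV"
    using separable_if_sigma_finite_full_support[OF assms(3,2,4)] .
  have "x \<in> measure_support m" using assms(4) by simp
  then have nz: "emeasure m UNIV \<noteq> 0" unfolding measure_support_def by (auto dest: spec[of _ UNIV])
  have ex: "\<exists>\<gamma>. geodesic_between \<gamma> y z" for y z :: 'a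
    using assms(1) unfolding geodesic_space_def by blast
  interpret geodesic_flow_space m N x D
    by (rule geodesic_flow_space.intro[OF assms(3,2,5,6) D ex nz])
  obtain Z where Z: "Z \<in> null_sets m" "{y. \<exists>\<gamma>1 \<gamma>2. geodesic_between \<gamma>1 y x \<and> geodesic_between \<gamma>2 y x \<and>
      (\<exists>t\<in>{0..1}. \<gamma>1 t \<noteq> \<gamma>2 t)} \<subseteq> Z"
    using branching_null by blast
  have rev: "geodesic_between (\<lambda>t. \<gamma> (1 - t)) y x" if g: "geodesic_between \<gamma> x y" for \<gamma> y
  proof -
    have e: "\<gamma> 0 = x" "\<gamma> 1 = y" using g unfolding geodesic_between_def by blast+
    define \<delta> where "\<delta> t = \<gamma> (1 - t)" for t
    have de: "\<delta> 0 = y" "\<delta> 1 = x" by (simp_all add: \<delta>_def e)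
    have "geodesic_between \<delta> (\<delta> 0) (\<delta> 1)"
    proof (rule geodesic_betweenI)
      fix s t :: real assume "0 \<le> s" "s \<le> t" "t \<le> 1"
      then show "dist (\<delta> s) (\<delta> t) \<le> (t - s) * dist (\<delta> 0) (\<delta> 1)"
        unfolding de unfolding \<delta>_def using geodesic_betweenD[OF g, of "1 - s" "1 - t"] by (simp add: dist_commute)
    qed
    then show ?thesis unfolding de by (simp add: \<delta>_def[abs_def])
  qed
  have "{y. \<exists>\<gamma>\<^sub>1 \<gamma>\<^sub>2. geodesic_between \<gamma>\<^sub>1 x y \<and> geodesic_between \<gamma>\<^sub>2 x y \<and>
             (\<exists>t\<in>{0..1}. \<gamma>\<^sub>1 t \<noteq> \<gamma>\<^sub>2 t)} \<subseteq> Z"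
  proof (intro subsetI)
    fix y assume "y \<in> {y. \<exists>\<gamma>\<^sub>1 \<gamma>\<^sub>2. geodesic_between \<gamma>\<^sub>1 x y \<and> geodesic_between \<gamma>\<^sub>2 x y \<and>
             (\<exists>t\<in>{0..1}. \<gamma>\<^sub>1 t \<noteq> \<gamma>\<^sub>2 t)}"
    then obtain \<gamma>1 \<gamma>2 t where g: "geodesic_between \<gamma>1 x y" "geodesic_between \<gamma>2 x y" "t \<in> {0..1}" "\<gamma>1 t \<noteq> \<gamma>2 t"
      by blast
    have "\<exists>t\<in>{0..1}. \<gamma>1 (1 - t) \<noteq> \<gamma>2 (1 - t)" using g(3,4) by (intro bexI[of _ "1 - t"]) auto
    then show "y \<in> Z" using rev[OF g(1)] rev[OF g(2)] Z(2) by blast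
  qed
  then show ?thesis by (rule null_sets_completion_subset[OF _ null_sets_completionI[OF Z(1)]])
qed

end
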